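(* Let $x,y,z$ be non-negative integers and let $\mathbf a=(a_1,\dots,a_m)$, $\mathbf b=(b_1,\dots,b_n)$ be sequences of non-negative integers. Then $$M(W^{(2)}_{x,y,z}(\mathbf a;\mathbf b))=\frac{M(W^{(2)}_{x+y,0,z}(\mathbf a;\mathbf b))\,M(W^{(2)}_{0,y,z}(\mathbf a;\mathbf b))}{M(W^{(2)}_{y,0,z}(\mathbf a;\mathbf b))}\cdot\frac{T(x+1,2a+b+2y+z-2,y)\,V(2x+2a+1,b+2y+z-1,y)}{T(1,2a+b+2y+z-2,y)\,V(2a+1,b+2y+z-1,y)}.$$ Moreover, put $\mu=2\lfloor\frac{m+1}{2}\rfloor$, $\mu'=2\lceil\frac{m-1}{2}\rceil$, $\nu=2\lfloor\frac{n+1}{2}\rfloor$, $\nu'=2\lceil\frac{n-1}{2}\rceil$, and $$\mathbf t^{+}=(0,a_1,\dots,a_{\mu-1},\,a_{\mu}+x+y+b_{\nu},\,b_{\nu-1},\dots,b_1),\qquad \mathbf t^{-}=(a_1,\dots,a_{\mu'},\,a_{\mu'+1}+x+y+b_{\nu'+1},\,b_{\nu'},\dots,b_1,z).$$ Then also $$M(W^{(2)}_{x,y,z}(\mathbf a;\mathbf b))=2^{-y+a_1-1}\,K'(\mathbf t^{+})\,K'(\mathbf t^{-})\cdot\frac{H_2(2o_a+2o_b)\,H_2(2e_a+2e_b+2z)}{H_2(2o_a+2o_b+2y)\,H_2(2e_a+2e_b+2y+2z)}\cdot\frac{H(2a+b+2y+z-1)\,H(b+y+z)}{H(2a+b+y+z-1)\,H(b+z)}$$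 $$\cdot\frac{T(x+1,2a+b+2y+z-2,y)\,V(2x+2a+1,b+2y+z-1,y)}{T(1,2a+b+2y+z-2,y)\,V(2a+1,b+2y+z-1,y)}.$$
   Context: Lattice and tilings. For real $u,k$ let $[u;k]$ be the point of the plane with Cartesian coordinates $(u,\frac{\sqrt3}{2}k)$. The triangular lattice has as vertices all $[u;k]$ with $k\in\mathbb Z$, $u-k/2\in\mathbb Z$; its faces are unit equilateral triangles, up-pointing or down-pointing. A region is a finite union of unit triangles. A lozenge is the union of two unit triangles sharing an edge; it is vertical if that edge is horizontal. A tiling of a region is a covering of it by lozenges contained in it, without gaps or overlaps. $M(R)$ is the sum of the weights of all tilings of $R$, the weight of a tiling being the product of the weights of its lozenges; lozenges have weight $1$ unless stated otherwise; $M(\emptyset)=1$. Sequences. $a=\sum a_i$, $b=\sum b_j$; $o_a,e_a$ are the sums of the $a_i$ with $i$ odd, resp. even; $o_b,e_b$ likewise. $a_i=0$ for $i>m$, $b_j=0$ for $j>n$; an empty sequence is treated as the one-term sequence $(0)$. Functions. $H(n)=\prod_{i=0}^{n-1}i!$ (equal to $1$ for $n\le0$); $H_2(n)=\prod_{i=1}^{\lfloor n/2\rfloor}(n-2i)!$; for $n\ge0$, $(x)_n=x(x+1)\cdots(x+n-1)$ and $[x]_n=x(x+2)\cdots(x+2n-2)$ (both $1$ for $n=0$); $T(x,n,m)=\prod_{i=0}^{m-1}(x+i)_{n-2i}$, $V(x,n,m)=\prod_{i=0}^{m-1}[x+2i]_{n-2i}$. Empty products are $1$. Quartered hexagons. For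 a sequence $\mathbf t=(t_1,\dots,t_{2l})$ of non-negative integers let $s_k=t_1+\dots+t_k$, $o_t=\sum_{i\text{ odd}}t_i$, $e_t=\sum_{i\text{ even}}t_i$. If $e_t\ge1$, take the region bounded by the base from $[0;0]$ to $[o_t+e_t;0]$, the segment from $[o_t+e_t;0]$ to $[o_t+\frac12;2e_t-1]$, the north side from there to $[\frac12;2e_t-1]$, and the west zigzag through $[0;0],[\frac12;1],[0;2],[\frac12;3],\dots,[\frac12;2e_t-1]$; remove from it, for each $1\le i\le l$, the up-pointing triangle with base from $[s_{2i-1};0]$ to $[s_{2i};0]$. Give weight $\frac12$ to each vertical lozenge whose two western (left) sides both lie on the west zigzag. $K'(\mathbf t)$ is $M$ of this weighted region; if $e_t=0$, $K'(\mathbf t)=1$. The weighted region $W^{(2)}_{x,y,z}(\mathbf a;\mathbf b)$. Let $L=x+y+a+b$, $A=2(y+o_a+o_b)-1$, $B=2(y+z+e_a+e_b)-1$, and let $\ell$ be the line $k=0$. Upper part (empty if $A=-1$): bounded by $\ell$ between $[0;0]$ and $[L;0]$, the segment from $[L;0]$ to $[L-\frac A2;A]$, the horizontal north side at height $k=A$, and the west zigzag through the points $[\alpha(k);k]$, $0\le k\le A$, with $\alpha(k)=0$ for $k$ even and $\frac12$ for $k$ odd. Lower part (empty if $B=-1$): bounded by $\ell$ between $[0;0]$ and $[L;0]$, the segments from $[L;0]$ to $[L+\frac z2;-z]$ and from there to $[L+z-\frac B2;-B]$, the horizontal south side at $k=-B$, and the west zigzag through $[\beta(k);-k]$, $0\le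 k\le B$, with $\beta(k)=0$ for $k$ even and $\frac12$ for $k$ odd. The region is the union of the two parts (lozenges may cross $\ell$) after removing: (i) from the upper part, everything at points $[u;k]$ with $u<a_1-k/2$ (an up-pointing half triangle of side $2a_1$); (ii) for $2\le i\le m$, the triangle of side $a_i$ having a side on $\ell$ from $[a_1+\dots+a_{i-1};0]$ to $[a_1+\dots+a_i;0]$, down-pointing (below $\ell$) if $i$ is even, up-pointing (above $\ell$) if $i$ is odd; (iii) for $1\le j\le n$, the triangle of side $b_j$ having a side on $\ell$ from $[L-b_1-\dots-b_j;0]$ to $[L-b_1-\dots-b_{j-1};0]$, up-pointing (above $\ell$) if $j$ is odd, down-pointing (below $\ell$) if $j$ is even. Each vertical lozenge of the region whose two western (left) sides both lie on the west boundary zigzag (the union of the upper and lower zigzags) has weight $\frac12$.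
   Formalization: In the second product formula the right side is multiplied by 2 when a_1=0, since as printed it is then half the true value (for x=y=z=0 and empty sequences, M=1 but the formula gives 1/2); for a_1≥1 the formula is unchanged. *)

theory Defs
  imports Complex_Main "HOL-Library.Disjoint_Sets"
begin

text \<open>
  A pair (u, k) stands for [u;k], the point of the plane with Cartesian coordinates
  (u, sqrt 3 / 2 * k).  A unit triangle is represented by the set of its three vertices, and a
  region by the set of its unit triangles.
\<close>

type_synonym point = "real \<times> int"
type_synonym triangle = "point set"
type_synonym region = "triangle set"
type_synonym lozenge = "triangle set"

definition lattice :: "point set" where
  "lattice = {(u, k). u - of_int k / 2 \<in> \<int>}"

definition up_tri :: "real \<Rightarrow> int \<Rightarrow> triangle" where
  "up_tri u k = {(u, k), (u + 1, k), (u + 1/2, k + 1)}"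

definition down_tri :: "real \<Rightarrow> int \<Rightarrow> triangle" where
  "down_tri u k = {(u, k), (u + 1, k), (u + 1/2, k - 1)}"

definition unit_triangles :: "triangle set" where
  "unit_triangles = {up_tri u k | u k. (u, k) \<in> lattice} \<union> {down_tri u k | u k. (u, k) \<in> lattice}"

text \<open>Two distinct unit triangles share an edge iff they have exactly two common vertices.\<close>

definition is_lozenge :: "lozenge \<Rightarrow> bool" where
  "is_lozenge l \<longleftrightarrow>
     (\<exists>s\<in>unit_triangles. \<exists>t\<in>unit_triangles. card (s \<inter> t) = 2 \<and> l = {s, t})"

definition tilings :: "region \<Rightarrow> lozenge set set" where
  "tilings R = {P. partition_on R P \<and> (\<forall>l\<in>P. is_lozenge l)}"

definition M :: "(lozenge \<Rightarrow> real) \<Rightarrow> region \<Rightarrow> real" where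
  "M w R = (\<Sum>P\<in>tilings R. \<Prod>l\<in>P. w l)"

text \<open>
  The region between heights k0 and k1 bounded on the left by the line u = lo k and on the right by
  u = hi k (both straight between consecutive integer heights).  A unit triangle lies in a single
  horizontal strip, where the region is convex, so it suffices to test its vertices.
\<close>

definition region_between :: "int \<Rightarrow> int \<Rightarrow> (int \<Rightarrow> real) \<Rightarrow> (int \<Rightarrow> real) \<Rightarrow> region" where
  "region_between k0 k1 lo hi =
     {t \<in> unit_triangles. \<forall>(u, k)\<in>t. k0 \<le> k \<and> k \<le> k1 \<and> lo k \<le> u \<and> u \<le> hi k}"

text \<open>Triangles of side s having a side from [p;0] to [p+s;0], above resp. below the line k = 0.\<close>

definition up_dent :: "nat \<Rightarrow> nat \<Rightarrow> region" where
  "up_dent p s = region_between 0 (int s)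
     (\<lambda>k. real p + of_int k / 2) (\<lambda>k. real p + real s - of_int k / 2)"

definition down_dent :: "nat \<Rightarrow> nat \<Rightarrow> region" where
  "down_dent p s = region_between (- int s) 0
     (\<lambda>k. real p - of_int k / 2) (\<lambda>k. real p + real s + of_int k / 2)"

definition zig :: "int \<Rightarrow> real" where
  "zig k = (if even k then 0 else 1/2)"

definition zig_edges :: "int \<Rightarrow> int \<Rightarrow> point set set" where
  "zig_edges k0 k1 = {{(zig k, k), (zig (k + 1), k + 1)} | k. k0 \<le> k \<and> k < k1}"

text \<open>
  The lozenge consisting of up_tri u k and down_tri u k is the vertical lozenge whose common
  edge is from [u;k] to [u+1;k]; its western sides are the two unit segments below.
\<close>

definition zig_weight :: "point set set \<Rightarrow> lozenge \<Rightarrow> real" where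
  "zig_weight Z l =
     (if \<exists>u k. l = {up_tri u k, down_tri u k} \<and>
               {(u, k), (u + 1/2, k + 1)} \<in> Z \<and> {(u, k), (u + 1/2, k - 1)} \<in> Z
      then 1/2 else 1)"

text \<open>Sequences are lists, indexed from 1 and continued by zeros; the empty one counts as (0).\<close>

definition nth1 :: "nat list \<Rightarrow> nat \<Rightarrow> nat" where
  "nth1 xs i = (if 1 \<le> i \<and> i \<le> length xs then xs ! (i - 1) else 0)"

definition seq_len :: "nat list \<Rightarrow> nat" where
  "seq_len xs = max 1 (length xs)"

definition psum :: "nat list \<Rightarrow> nat \<Rightarrow> nat" where
  "psum xs k = (\<Sum>i=1..k. nth1 xs i)"

definition osum :: "nat list \<Rightarrow> nat" where
  "osum xs = (\<Sum>i | i \<in> {1..length xs} \<and> odd i. nth1 xs i)"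

definition esum :: "nat list \<Rightarrow> nat" where
  "esum xs = (\<Sum>i | i \<in> {1..length xs} \<and> even i. nth1 xs i)"

definition H :: "int \<Rightarrow> real" where
  "H n = (\<Prod>i<nat n. fact i)"

definition H2 :: "nat \<Rightarrow> real" where
  "H2 n = (\<Prod>i=1..n div 2. fact (n - 2 * i))"

definition bracket :: "real \<Rightarrow> nat \<Rightarrow> real" where
  "bracket x n = (\<Prod>i<n. x + 2 * real i)"

text \<open>
  T and V are only used for arguments such that the lengths n - 2 i in the product are non-negative.
\<close>

definition T :: "real \<Rightarrow> int \<Rightarrow> nat \<Rightarrow> real" where
  "T x n m = (\<Prod>i<m. pochhammer (x + real i) (nat (n - 2 * int i)))"

definition V :: "real \<Rightarrow> int \<Rightarrow> nat \<Rightarrow> real" where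
  "V x n m = (\<Prod>i<m. bracket (x + 2 * real i) (nat (n - 2 * int i)))"

definition quartered_hexagon :: "nat list \<Rightarrow> region" where
  "quartered_hexagon t =
     region_between 0 (2 * int (esum t) - 1) zig (\<lambda>k. real (osum t + esum t) - of_int k / 2)
     - (\<Union>i\<in>{1..length t div 2}. up_dent (psum t (2 * i - 1)) (nth1 t (2 * i)))"

definition K' :: "nat list \<Rightarrow> real" where
  "K' t = (if esum t = 0 then 1
           else M (zig_weight (zig_edges 0 (2 * int (esum t) - 1))) (quartered_hexagon t))"

definition W_len :: "nat \<Rightarrow> nat \<Rightarrow> nat list \<Rightarrow> nat list \<Rightarrow> nat" where
  "W_len x y a b = x + y + sum_list a + sum_list b"

definition W_top :: "nat \<Rightarrow> nat list \<Rightarrow> nat list \<Rightarrow> int" where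
  "W_top y a b = 2 * int (y + osum a + osum b) - 1"

definition W_bot :: "nat \<Rightarrow> nat \<Rightarrow> nat list \<Rightarrow> nat list \<Rightarrow> int" where
  "W_bot y z a b = 2 * int (y + z + esum a + esum b) - 1"

text \<open>
  For W_top = -1 (resp. W_bot = -1) the range of heights is empty, and so is the part.  The line
  u = a_1 - k/2 consists of lattice edges, so that no unit triangle lies on both sides of it.
\<close>

definition W_upper :: "nat \<Rightarrow> nat \<Rightarrow> nat list \<Rightarrow> nat list \<Rightarrow> region" where
  "W_upper x y a b =
     {t \<in> region_between 0 (W_top y a b) zig (\<lambda>k. real (W_len x y a b) - of_int k / 2).
        \<forall>(u, k)\<in>t. real (nth1 a 1) - of_int k / 2 \<le> u}"

definition W_lower :: "nat \<Rightarrow> nat \<Rightarrow> nat \<Rightarrow> nat list \<Rightarrow> nat list \<Rightarrow> region" where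
  "W_lower x y z a b =
     region_between (- W_bot y z a b) 0 zig
       (\<lambda>k. if - int z \<le> k then real (W_len x y a b) - of_int k / 2
            else real (W_len x y a b) + real z + of_int k / 2)"

definition a_dents :: "nat list \<Rightarrow> region" where
  "a_dents a = (\<Union>i\<in>{2..length a}.
     (if even i then down_dent else up_dent) (psum a (i - 1)) (nth1 a i))"

text \<open>Subtraction of naturals below is exact, as psum b j is at most sum_list b.\<close>

definition b_dents :: "nat \<Rightarrow> nat list \<Rightarrow> region" where
  "b_dents L b = (\<Union>j\<in>{1..length b}.
     (if odd j then up_dent else down_dent) (L - psum b j) (nth1 b j))"

definition W :: "nat \<Rightarrow> nat \<Rightarrow> nat \<Rightarrow> nat list \<Rightarrow> nat list \<Rightarrow> region" where
  "W x y z a b =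
     W_upper x y a b \<union> W_lower x y z a b - a_dents a - b_dents (W_len x y a b) b"

definition W_zigzag :: "nat \<Rightarrow> nat \<Rightarrow> nat list \<Rightarrow> nat list \<Rightarrow> point set set" where
  "W_zigzag y z a b = zig_edges 0 (W_top y a b) \<union> zig_edges (- W_bot y z a b) 0"

definition MW :: "nat \<Rightarrow> nat \<Rightarrow> nat \<Rightarrow> nat list \<Rightarrow> nat list \<Rightarrow> real" where
  "MW x y z a b = M (zig_weight (W_zigzag y z a b)) (W x y z a b)"

text \<open>
  For m, n at least 1, the floor of (m+1)/2 is (m+1) div 2 and the ceiling of (m-1)/2 is m div 2.
\<close>

definition t_plus :: "nat \<Rightarrow> nat \<Rightarrow> nat list \<Rightarrow> nat list \<Rightarrow> nat list" where
  "t_plus x y a b =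
     (let mu = 2 * ((seq_len a + 1) div 2); nu = 2 * ((seq_len b + 1) div 2)
      in 0 # map (nth1 a) [1..<mu] @ [nth1 a mu + x + y + nth1 b nu]
         @ rev (map (nth1 b) [1..<nu]))"

definition t_minus :: "nat \<Rightarrow> nat \<Rightarrow> nat \<Rightarrow> nat list \<Rightarrow> nat list \<Rightarrow> nat list" where
  "t_minus x y z a b =
     (let mu' = 2 * (seq_len a div 2); nu' = 2 * (seq_len b div 2)
      in map (nth1 a) [1..<mu' + 1] @ [nth1 a (mu' + 1) + x + y + nth1 b (nu' + 1)]
         @ rev (map (nth1 b) [1..<nu' + 1]) @ [z])"

text \<open>
  In TV_quot, a and b are the sums of the two sequences.

  On the second product formula for MW: the power of 2 in the source, 2 powi (a_1 - y - 1), is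
  right for a_1 > 0 but half of the correct value for a_1 = 0.  For instance, for x = y = z = 0 and
  empty sequences the region is empty, so MW = 1, and both values of K' are 1, while the formula
  would give 1/2.  The theorem therefore carries an extra factor 2 when a_1 = 0.
\<close>

definition TV_quot :: "nat \<Rightarrow> nat \<Rightarrow> nat \<Rightarrow> nat \<Rightarrow> nat \<Rightarrow> real" where
  "TV_quot x y z a b =
     (T (real x + 1) (2 * int a + int b + 2 * int y + int z - 2) y
        * V (2 * real x + 2 * real a + 1) (int b + 2 * int y + int z - 1) y)
     / (T 1 (2 * int a + int b + 2 * int y + int z - 2) y
        * V (2 * real a + 1) (int b + 2 * int y + int z - 1) y)"

end

theory Submission
  imports Defs "Jordan_Normal_Form.Determinant"
begin

text \<open>
  Cutting along the line of height 0, a tiling is determined by the set S of positions of the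
  vertical lozenges that cross the line and by tilings of the two parts.  In a part, the positions of
  the vertical lozenges on consecutive lines interlace, and by the central difference calculus the
  weighted number of tilings is the determinant of even polynomials in the positions of the removed
  unit triangles on the base, hence a constant times the product of the differences of their
  squares.  The large dents are replaced by their bottom rows, as the missing lozenges are forced.
  The positions of all dents together form the complement of the gap between the two sequences, so
  that summing over S leaves a discrete Selberg sum that depends on a and b only via their sums.  This
  sum is a determinant by the Cauchy-Binet formula, and with suitable bases of even polynomials its
  entries have a closed form.
\<close>

section \<open>Determinants\<close>

text \<open>The half-weighted lozenges turn the zigzag into a mirror: every row of positions extends
  to a set symmetric about it, in which position 0 is its own image and counts half. This is why
  sums along rows are central differences, and why even functions at integers alternate with odd
  functions at half-integers. Let P and Q be the dent positions above and below the line. In the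
  product of the two determinants for P \<union> S and Q \<union> S, the factors within P and within
  Q split off, the factors within S appear squared, and the mixed ones depend on P \<union> Q alone.
  Quartered hexagons with dents P and Q are evaluated by the same determinant, which identifies the
  split-off factors with \<open>K'\<close>. The power of 2 has a geometric origin: filling the half
  triangle of side 2 a_1 from its bottom row forces lozenges of weight 1/2 at the heights 2, 4, ...,
  2 (a_1 - 1). There are none of them both for a_1 = 0 and for a_1 = 1, hence the correction at a_1
  = 0. The first formula follows from the second by cancellation, since \<open>t_plus\<close> and
  \<open>t_minus\<close> involve x and y only through x + y.\<close>

definition dt :: "nat \<Rightarrow> (nat \<Rightarrow> nat \<Rightarrow> 'a::comm_ring_1) \<Rightarrow> 'a" where
  "dt n f = Determinant.det (mat n n (\<lambda>(i, j). f i j))"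

lemma dt_leibniz:
  "dt n f = (\<Sum>p | p permutes {..<n}. of_int (sign p) * (\<Prod>i<n. f i (p i)))"
proof -
  have "i < n \<Longrightarrow> p permutes {..<n} \<Longrightarrow> p i < n" for p i
    using permutes_in_image[of p "{..<n}" i] by simp
  then show ?thesis
    unfolding dt_def Determinant.det_def by (auto simp: lessThan_atLeast0 intro!: sum.cong prod.cong)
qed

lemma dt_cong: "(\<And>i j. i < n \<Longrightarrow> j < n \<Longrightarrow> f i j = g i j) \<Longrightarrow> dt n f = dt n g"
  unfolding dt_def by (rule arg_cong[of _ _ Determinant.det]) auto

lemma dt_0 [simp]: "dt 0 f = 1"
  by (simp add: dt_leibniz)

lemma dt_transpose: "dt n (\<lambda>i j. f j i) = dt n f"
proof -
  have "mat n n (\<lambda>(i, j). f j i) = transpose_mat (mat n n (\<lambda>(i, j). f i j))" by auto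
  then show ?thesis unfolding dt_def by (simp add: Determinant.det_transpose[of _ n])
qed

lemma dt_mult: "dt n f * dt n g = dt n (\<lambda>i j. \<Sum>k<n. f i k * g k j)"
proof -
  have "mat n n (\<lambda>(i, j). \<Sum>k<n. f i k * g k j) = mat n n (\<lambda>(i, j). f i j) * mat n n (\<lambda>(i, j). g i j)"
    by (rule eq_matI) (auto simp: scalar_prod_def lessThan_atLeast0)
  then show ?thesis unfolding dt_def by (simp add: Determinant.det_mult[of _ n])
qed

lemma dt_lower_triangular:
  assumes "\<And>i j. i < j \<Longrightarrow> j < n \<Longrightarrow> f i j = 0"
  shows "dt n f = (\<Prod>i<n. f i i)"
proof -
  have "dt n f = prod_list (diag_mat (mat n n (\<lambda>(i, j). f i j)))"
    unfolding dt_def using assms by (intro Determinant.det_lower_triangular[of n]) auto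
  also have "\<dots> = prod_list (map (\<lambda>i. f i i) [0..<n])"
    by (auto simp: diag_mat_def intro!: arg_cong[of _ _ prod_list])
  also have "\<dots> = (\<Prod>i\<in>set [0..<n]. f i i)"
    by (simp only: prod.distinct_set_conv_list[OF distinct_upt])
  finally show ?thesis by (simp add: lessThan_atLeast0)
qed

lemma dt_upper_triangular: "(\<And>i j. j < i \<Longrightarrow> i < n \<Longrightarrow> f i j = 0) \<Longrightarrow> dt n f = (\<Prod>i<n. f i i)"
  using dt_lower_triangular[of n "\<lambda>i j. f j i"] unfolding dt_transpose[of n f] by blast

lemma dt_rows_mult: "dt n (\<lambda>i j. c i * f i j) = (\<Prod>i<n. c i) * dt n f"
  by (simp add: dt_leibniz prod.distrib sum_distrib_left mult.left_commute)

lemma dt_cols_mult: "dt n (\<lambda>i j. c j * f i j) = (\<Prod>i<n. c i) * dt n f"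
  using dt_rows_mult[of n c "\<lambda>i j. f j i"]
  unfolding dt_transpose[of n f] dt_transpose[of n "\<lambda>i j. c j * f i j"] .

lemma dt_permute_rows:
  assumes "p permutes {..<n}"
  shows "dt n (\<lambda>i. f (p i)) = of_int (sign p) * dt n f"
proof -
  have p: "p i < n" if "i < n" for i
    using permutes_in_image[OF assms, of i] that by simp
  have "dt n (\<lambda>i j. f (p i) j) = Determinant.det (mat n n (\<lambda>(i, j). mat n n (\<lambda>(i, j). f i j) $$ (p i, j)))"
    unfolding dt_def by (rule arg_cong[of _ _ Determinant.det], rule eq_matI) (simp_all add: p)
  also have "\<dots> = of_int (sign p) * dt n f"
    unfolding dt_def using assms by (subst det_permute_rows[of _ n]) (auto simp: lessThan_atLeast0)
  finally show ?thesis .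
qed

lemma dt_identical_rows:
  assumes "i \<noteq> i'" "i < n" "i' < n" "\<And>j. j < n \<Longrightarrow> f i j = f i' j"
  shows "dt n f = 0"
  unfolding dt_def by (rule det_identical_rows[of _ n i i']) (use assms in \<open>auto simp: row_def\<close>)

lemma dt_sum_rows:
  assumes "\<And>i. i < n \<Longrightarrow> finite (A i)"
  shows "dt n (\<lambda>i j. \<Sum>s\<in>A i. f i s j) = (\<Sum>s\<in>Pi\<^sub>E {..<n} A. dt n (\<lambda>i. f i (s i)))"
proof -
  have "(\<Prod>i<n. \<Sum>s\<in>A i. f i s (p i)) = (\<Sum>s\<in>Pi\<^sub>E {..<n} A. \<Prod>i<n. f i (s i) (p i))" for p
    using assms by (intro prod_sum_PiE) auto
  then show ?thesis
    by (simp add: dt_leibniz sum_distrib_left) (rule sum.swap)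
qed

lemma dt_first_column:
  assumes "\<And>i. 0 < i \<Longrightarrow> i \<le> n \<Longrightarrow> f i 0 = 0"
  shows "dt (Suc n) f = f 0 0 * dt n (\<lambda>i j. f (Suc i) (Suc j))"
proof -
  let ?A = "mat (Suc n) (Suc n) (\<lambda>(i, j). f i j)"
  have d: "mat_delete ?A 0 0 = mat n n (\<lambda>(i, j). f (Suc i) (Suc j))"
    by (auto simp: mat_delete_def)
  have "dt (Suc n) f = (\<Sum>i<Suc n. ?A $$ (i, 0) * cofactor ?A i 0)"
    unfolding dt_def by (rule laplace_expansion_column) auto
  also have "\<dots> = (\<Sum>i\<in>{0}. ?A $$ (i, 0) * cofactor ?A i 0)"
    using assms by (intro sum.mono_neutral_right) auto
  finally show ?thesis by (simp add: cofactor_def d dt_def)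
qed

text \<open>Every row is reduced by the original preceding row, all at once; this is left
  multiplication by the bidiagonal matrix with 1 on the diagonal and -1 below it, of determinant
  1.\<close>

lemma dt_row_differences:
  "dt n (\<lambda>i j. f i j - (if i = 0 then 0 else f (i - 1) j)) = dt n f"
proof -
  define g where "g = (\<lambda>i k. if k = i then 1 else if Suc k = i then - 1 else (0::'a))"
  have "dt n g = 1" by (subst dt_lower_triangular) (auto simp: g_def)
  moreover have "(\<Sum>k<n. g i k * f k j) = f i j - (if i = 0 then 0 else f (i - 1) j)" if "i < n" for i j
  proof -
    have "(\<Sum>k<n. g i k * f k j) = (\<Sum>k<n. (if k = i then f i j else 0)
        + (if i \<noteq> 0 \<and> k = i - 1 then - f (i - 1) j else 0))"
      by (rule sum.cong) (auto simp: g_def)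
    also have "\<dots> = f i j - (if i = 0 then 0 else f (i - 1) j)"
      using that by (cases "i = 0") (auto simp: sum.distrib)
    finally show ?thesis .
  qed
  ultimately show ?thesis
    using dt_mult[of n g f] by (metis (no_types, lifting) dt_cong mult_1)
qed

text \<open>Row differences turn the column of ones into the first unit vector. This is how a row
  with n + 1 positions is related to one with n positions between them.\<close>

lemma dt_drop_ones:
  assumes "\<And>i. i \<le> n \<Longrightarrow> f i 0 = 1"
  shows "dt (Suc n) f = dt n (\<lambda>i j. f (Suc i) (Suc j) - f i (Suc j))"
proof -
  have "dt (Suc n) f = dt (Suc n) (\<lambda>i j. f i j - (if i = 0 then 0 else f (i - 1) j))"
    by (simp add: dt_row_differences)
  also have "\<dots> = dt n (\<lambda>i j. f (Suc i) (Suc j) - f i (Suc j))"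
    by (subst dt_first_column) (auto simp: assms)
  finally show ?thesis .
qed

text \<open>The expansion is found by subtracting a multiple of the monic \<open>N (Suc n)\<close>
  and recursing, not by divided differences, so the nodes may coincide and nothing has to be
  inverted.\<close>

lemma newton_expansion:
  fixes p :: "'a::comm_ring_1 poly"
  assumes "degree p \<le> n"
  shows "\<exists>c. c n = coeff p n \<and> (\<forall>x. poly p x = (\<Sum>k\<le>n. c k * (\<Prod>i<k. x - X i)))"
  using assms
proof (induction n arbitrary: p)
  case 0
  then obtain a where "p = [:a:]" by (metis degree_eq_zeroE le_zero_eq)
  then show ?case by (intro exI[of _ "\<lambda>_. a"]) simp
next
  case (Suc n)
  define N where "N n = (\<Prod>i<n. [:- X i, 1:])" for n
  have N: "degree (N k) \<le> k \<and> coeff (N k) k = 1" for k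
  proof (induction k)
    case (Suc k)
    have e: "N (Suc k) = pCons 0 (N k) - smult (X k) (N k)" by (simp add: N_def algebra_simps)
    have "degree (N (Suc k)) \<le> Suc k" unfolding e using Suc
      by (intro degree_diff_le order_trans[OF degree_pCons_le] order_trans[OF degree_smult_le]) auto
    moreover
    have "coeff (N k) (Suc k) = 0" using Suc by (intro coeff_eq_0) auto
    ultimately show ?case using Suc by (simp add: e)
  qed (simp add: N_def)
  define a where "a = coeff p (Suc n)"
  define q where "q = p - smult a (N (Suc n))"
  have "degree q \<le> Suc n" unfolding q_def using Suc.prems N[of "Suc n"]
    by (intro degree_diff_le) (auto intro: order_trans[OF degree_smult_le])
  moreover have "coeff q (Suc n) = 0" using N[of "Suc n"] by (simp add: q_def a_def)
  ultimately have "degree q \<le> n"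
    by (metis degree_0 le0 le_SucE leading_coeff_0_iff)
  then obtain c where c: "\<And>x. poly q x = (\<Sum>k\<le>n. c k * (\<Prod>i<k. x - X i))"
    using Suc.IH by meson
  have "poly p x = (\<Sum>k\<le>Suc n. (c(Suc n := a)) k * (\<Prod>i<k. x - X i))" for x
  proof -
    have "poly p x = poly q x + a * poly (N (Suc n)) x" by (simp add: q_def)
    also have "poly (N (Suc n)) x = (\<Prod>i<Suc n. x - X i)" unfolding N_def poly_prod by simp
    finally show ?thesis by (simp add: c)
  qed
  then show ?case by (intro exI[of _ "c(Suc n := a)"]) (simp add: a_def)
qed

text \<open>LU factorization: with the points \<open>X i\<close> themselves as Newton nodes, the
  k-th basis polynomial vanishes at \<open>X i\<close> for i < k, while the degree bounds make the
  coefficient matrix upper triangular.\<close>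

lemma dt_vandermonde:
  fixes q :: "nat \<Rightarrow> 'a::comm_ring_1 poly"
  assumes "\<And>j. j < n \<Longrightarrow> degree (q j) \<le> j"
  shows "dt n (\<lambda>i j. poly (q j) (X i)) = (\<Prod>j<n. coeff (q j) j) * (\<Prod>j<n. \<Prod>i<j. X j - X i)"
proof -
  have "\<forall>j\<in>{..<n}. \<exists>c. c j = coeff (q j) j \<and> (\<forall>x. poly (q j) x = (\<Sum>k\<le>j. c k * (\<Prod>i<k. x - X i)))"
    using assms newton_expansion by blast
  then obtain c where c: "\<And>j. j < n \<Longrightarrow> c j j = coeff (q j) j"
    "\<And>j x. j < n \<Longrightarrow> poly (q j) x = (\<Sum>k\<le>j. c j k * (\<Prod>i<k. x - X i))"
    by (metis bchoice lessThan_iff)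
  define u where "u k j = (if k \<le> j then c j k else 0)" for k j
  define l where "l i k = (\<Prod>h<k. X i - X h)" for i k
  have "dt n (\<lambda>i j. poly (q j) (X i)) = dt n (\<lambda>i j. \<Sum>k<n. l i k * u k j)"
  proof (rule dt_cong)
    fix i j assume "i < n" "j < n"
    then show "poly (q j) (X i) = (\<Sum>k<n. l i k * u k j)"
      unfolding c(2)[OF \<open>j < n\<close>] u_def l_def
      by (intro sum.mono_neutral_cong_left) (auto simp: mult.commute)
  qed
  also have "\<dots> = dt n l * dt n u" by (simp add: dt_mult)
  also have "dt n l = (\<Prod>j<n. \<Prod>i<j. X j - X i)"
  proof (subst dt_lower_triangular)
    fix i j assume "i < j" "j < n"
    then show "l i j = 0" by (auto simp: l_def intro!: prod_zero)
  qed (simp add: l_def)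
  also have "dt n u = (\<Prod>j<n. coeff (q j) j)"
    by (subst dt_upper_triangular) (auto simp: u_def c(1))
  finally show ?thesis by (simp add: mult.commute)
qed

section \<open>Sums over sets and over transversals\<close>

definition enum :: "nat set \<Rightarrow> nat \<Rightarrow> nat" where
  "enum S i = sorted_list_of_set S ! i"

lemma enum_image:
  assumes "strict_mono_on {..<n} s" "i < n"
  shows "enum (s ` {..<n}) i = s i"
proof -
  have "sorted_wrt (<) (map s [0..<n])"
    using assms(1) by (auto simp: sorted_wrt_iff_nth_less strict_mono_on_def)
  then have "sorted_list_of_set (s ` {..<n}) = map s [0..<n]"
    by (intro strict_sorted_equal) (auto simp: lessThan_atLeast0)
  then show ?thesis using assms(2) by (simp add: enum_def)
qed

lemma enum_less: "finite S \<Longrightarrow> i < j \<Longrightarrow> j < card S \<Longrightarrow> enum S i < enum S j"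
  unfolding enum_def
  using sorted_wrt_nth_less[OF sorted_list_of_set.strict_sorted_key_list_of_set[of S]] by simp

lemma bij_betw_enum: "finite S \<Longrightarrow> bij_betw (enum S) {..<card S} S"
  unfolding enum_def using bij_betw_nth[of "sorted_list_of_set S" "{..<card S}" S] by simp

lemma enum_in: "finite S \<Longrightarrow> i < card S \<Longrightarrow> enum S i \<in> S"
  using bij_betw_enum bij_betwE by blast

lemma prod_enum: "finite S \<Longrightarrow> (\<Prod>i<card S. g (enum S i)) = prod g S"
  using prod.reindex_bij_betw[OF bij_betw_enum] .

lemma card_less_enum:
  assumes "finite S" "i < card S"
  shows "card (S \<inter> {..<enum S i}) = i"
proof -
  have "S \<inter> {..<enum S i} = enum S ` {..<i}"
  proof (intro equalityI subsetI)
    fix x assume x: "x \<in> S \<inter> {..<enum S i}"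
    then obtain j where "j < card S" "x = enum S j"
      using bij_betw_enum[OF assms(1)] by (auto simp: bij_betw_def)
    then show "x \<in> enum S ` {..<i}"
      using x enum_less[OF assms(1), of i j] by (cases "j < i") (auto, metis not_less_iff_gr_or_eq)
  qed (use assms enum_less enum_in in auto)
  moreover have "inj_on (enum S) {..<i}"
    using bij_betw_enum[OF assms(1)] assms(2) by (auto simp: bij_betw_def intro: inj_on_subset)
  ultimately show ?thesis by (simp add: card_image)
qed

text \<open>An injective function is determined by its image S and the permutation that relates it
  to the increasing enumeration of S. The restriction supplies the default value outside
  \<open>{..<n}\<close> that membership in the function space demands.\<close>

lemma sum_injective_functions:
  assumes "finite A"
  shows "(\<Sum>s | s \<in> {..<n} \<rightarrow>\<^sub>E A \<and> inj_on s {..<n}. F s)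
    = (\<Sum>S | S \<subseteq> A \<and> card S = n. \<Sum>p | p permutes {..<n}. F (restrict (enum S \<circ> p) {..<n}))"
proof -
  let ?X = "{s. s \<in> {..<n} \<rightarrow>\<^sub>E A \<and> inj_on s {..<n}}"
  let ?Y = "{S. S \<subseteq> A \<and> card S = n}"
  have fin: "finite ?X" "finite ?Y"
    using finite_PiE[of "{..<n}" "\<lambda>_. A"] assms by (auto intro: finite_subset[OF _ finite_Pow_iff[THEN iffD2, OF assms]])
  have img: "(\<lambda>s. s ` {..<n}) ` ?X \<subseteq> ?Y"
  proof
    fix S assume "S \<in> (\<lambda>s. s ` {..<n}) ` ?X"
    then obtain s where s: "S = s ` {..<n}" "s \<in> {..<n} \<rightarrow>\<^sub>E A" "inj_on s {..<n}" by blast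
    show "S \<in> ?Y" using PiE_mem[OF s(2)] card_image[OF s(3)] by (auto simp: s(1))
  qed
  have "sum F ?X = (\<Sum>S\<in>?Y. \<Sum>s | s \<in> ?X \<and> s ` {..<n} = S. F s)"
    by (rule sum.group[OF fin img, symmetric])
  also have "\<dots> = (\<Sum>S\<in>?Y. \<Sum>p | p permutes {..<n}. F (restrict (enum S \<circ> p) {..<n}))"
  proof (rule sum.cong[OF refl])
    fix S assume "S \<in> ?Y"
    then have S: "S \<subseteq> A" "card S = n" "finite S" using assms finite_subset by auto
    have e: "bij_betw (enum S) {..<n} S" using bij_betw_enum S by metis
    note inv = bij_betw_inv_into_left[OF e] bij_betw_inv_into_right[OF e]
    let ?g = "\<lambda>s i. if i < n then inv_into {..<n} (enum S) (s i) else i"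
    let ?h = "\<lambda>p. restrict (enum S \<circ> p) {..<n}"
    show "(\<Sum>s | s \<in> ?X \<and> s ` {..<n} = S. F s) = (\<Sum>p | p permutes {..<n}. F (?h p))"
    proof (rule sum.reindex_bij_witness[where i = ?h and j = ?g])
      fix s assume "s \<in> {s \<in> ?X. s ` {..<n} = S}"
      then have s: "s \<in> {..<n} \<rightarrow>\<^sub>E A" "bij_betw s {..<n} S" by (auto simp: bij_betw_def)
      have sS: "s i \<in> S" if "i < n" for i using that s(2) by (auto simp: bij_betw_def)
      show 1: "?h (?g s) = s"
      proof
        fix i show "?h (?g s) i = s i"
          using inv(2)[OF sS, of i] PiE_arb[OF s(1), of i] by (cases "i < n") auto
      qed
      have "bij_betw (inv_into {..<n} (enum S) \<circ> s) {..<n} {..<n}"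
        using bij_betw_trans[OF s(2) bij_betw_inv_into[OF e]] .
      then have "bij_betw (?g s) {..<n} {..<n}"
        by (rule bij_betw_cong[THEN iffD1, rotated]) auto
      then have "?g s permutes {..<n}" by (rule bij_imp_permutes) simp
      then show "?g s \<in> {p. p permutes {..<n}}" by simp
      show "F (?h (?g s)) = F s" unfolding 1 ..
    next
      fix p assume "p \<in> {p. p permutes {..<n}}"
      then have p: "p permutes {..<n}" by simp
      have pn: "p i < n \<longleftrightarrow> i < n" for i using permutes_in_image[OF p, of i] by simp
      show "?g (?h p) = p"
        using pn inv permutes_not_in[OF p] by (auto simp: fun_eq_iff)
      have "bij_betw (enum S \<circ> p) {..<n} S"
        using bij_betw_trans[OF permutes_imp_bij[OF p] e] .
      then have "bij_betw (?h p) {..<n} S"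
        by (rule bij_betw_cong[THEN iffD1, rotated]) auto
      then show "?h p \<in> {s \<in> ?X. s ` {..<n} = S}"
        using S by (auto simp: bij_betw_def)
    qed
  qed
  finally show ?thesis .
qed

text \<open>Multilinear expansion over all functions from rows to points: a non-injective one gives
  two equal rows, and the injective ones with image S differ by a permutation, whose sign combines
  with the product of the g-values to the determinant of g on S.\<close>

lemma dt_cauchy_binet:
  fixes f g :: "nat \<Rightarrow> nat \<Rightarrow> 'a::comm_ring_1"
  assumes "finite A"
  shows "(\<Sum>S | S \<subseteq> A \<and> card S = n. prod w S * dt n (\<lambda>i j. f j (enum S i)) * dt n (\<lambda>i j. g j (enum S i)))
    = dt n (\<lambda>i j. \<Sum>s\<in>A. w s * f i s * g j s)"
proof -
  let ?F = "\<lambda>s. dt n (\<lambda>i j. w (s i) * g i (s i) * f j (s i))"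
  have F: "?F s = (\<Prod>i<n. w (s i)) * ((\<Prod>i<n. g i (s i)) * dt n (\<lambda>i j. f j (s i)))" for s
    by (simp add: dt_rows_mult prod.distrib mult.assoc)
  have fin: "finite ({..<n} \<rightarrow>\<^sub>E A)" using assms by (simp add: finite_PiE)
  \<comment> \<open>After transposition the factor with g depends on the row only, so it can be
    pulled out of the determinant and only f stays inside.\<close>
  have "dt n (\<lambda>i j. \<Sum>s\<in>A. w s * f i s * g j s) = dt n (\<lambda>i j. \<Sum>s\<in>A. w s * g i s * f j s)"
    using dt_transpose[of n "\<lambda>i j. \<Sum>s\<in>A. w s * f i s * g j s"] by (simp add: mult_ac)
  also have "\<dots> = (\<Sum>s\<in>{..<n} \<rightarrow>\<^sub>E A. ?F s)"
    using assms by (subst dt_sum_rows) auto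
  also have "\<dots> = (\<Sum>s | s \<in> {..<n} \<rightarrow>\<^sub>E A \<and> inj_on s {..<n}. ?F s)"
  proof (rule sum.mono_neutral_right[OF fin])
    show "\<forall>s\<in>({..<n} \<rightarrow>\<^sub>E A) - {s \<in> {..<n} \<rightarrow>\<^sub>E A. inj_on s {..<n}}. ?F s = 0"
    proof
      fix s assume "s \<in> ({..<n} \<rightarrow>\<^sub>E A) - {s \<in> {..<n} \<rightarrow>\<^sub>E A. inj_on s {..<n}}"
      then obtain i j where "i < n" "j < n" "i \<noteq> j" "s i = s j" by (auto simp: inj_on_def)
      then have "dt n (\<lambda>i j. f j (s i)) = 0" by (intro dt_identical_rows[of i j]) auto
      then show "?F s = 0" by (simp add: F)
    qed
  qed auto
  also have "\<dots> = (\<Sum>S | S \<subseteq> A \<and> card S = n. \<Sum>p | p permutes {..<n}. ?F (restrict (enum S \<circ> p) {..<n}))"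
    by (rule sum_injective_functions[OF assms])
  also have "\<dots> = (\<Sum>S | S \<subseteq> A \<and> card S = n. prod w S * dt n (\<lambda>i j. f j (enum S i)) * dt n (\<lambda>i j. g j (enum S i)))"
  proof (rule sum.cong[OF refl])
    fix S assume "S \<in> {S. S \<subseteq> A \<and> card S = n}"
    then have S: "S \<subseteq> A" "card S = n" "finite S" using assms finite_subset by auto
    have *: "?F (restrict (enum S \<circ> p) {..<n})
        = prod w S * dt n (\<lambda>i j. f j (enum S i)) * (of_int (sign p) * (\<Prod>i<n. g i (enum S (p i))))"
      if p: "p permutes {..<n}" for p
    proof -
      have "?F (restrict (enum S \<circ> p) {..<n}) = ?F (enum S \<circ> p)" by (rule dt_cong) simp
      also have "\<dots> = (\<Prod>i<n. w (enum S (p i))) * ((\<Prod>i<n. g i (enum S (p i))) * (of_int (sign p) * dt n (\<lambda>i j. f j (enum S i))))"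
        unfolding F using dt_permute_rows[OF p, of "\<lambda>i j. f j (enum S i)"] by simp
      also have "(\<Prod>i<n. w (enum S (p i))) = prod w S"
        using prod.permute[OF p, of "\<lambda>i. w (enum S i)"] prod_enum[OF S(3), of w] S(2) by (simp add: o_def)
      finally show ?thesis by (simp only: mult_ac)
    qed
    have "(\<Sum>p | p permutes {..<n}. ?F (restrict (enum S \<circ> p) {..<n}))
      = (\<Sum>p | p permutes {..<n}. prod w S * dt n (\<lambda>i j. f j (enum S i)) * (of_int (sign p) * (\<Prod>i<n. g i (enum S (p i)))))"
      by (rule sum.cong[OF refl], rule *) simp
    also have "\<dots> = prod w S * dt n (\<lambda>i j. f j (enum S i)) * dt n (\<lambda>i j. g i (enum S j))"
      by (simp add: dt_leibniz[of n "\<lambda>i j. g i (enum S j)"] sum_distrib_left)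
    also have "dt n (\<lambda>i j. g i (enum S j)) = dt n (\<lambda>i j. g j (enum S i))"
      by (rule dt_transpose)
    finally show "(\<Sum>p | p permutes {..<n}. ?F (restrict (enum S \<circ> p) {..<n}))
      = prod w S * dt n (\<lambda>i j. f j (enum S i)) * dt n (\<lambda>i j. g j (enum S i))" .
  qed
  finally show ?thesis by simp
qed

section \<open>Sets with exactly one element in each of several consecutive intervals\<close>

definition transversal :: "nat \<Rightarrow> (nat \<Rightarrow> nat) \<Rightarrow> nat set \<Rightarrow> bool" where
  "transversal n c Y \<longleftrightarrow> Y \<subseteq> {c 0..<c n} \<and> (\<forall>i<n. card (Y \<inter> {c i..<c (Suc i)}) = 1)"

lemma mono_upto:
  fixes c :: "nat \<Rightarrow> nat"
  assumes "\<And>i. i < n \<Longrightarrow> c i \<le> c (Suc i)" "i \<le> j" "j \<le> n"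
  shows "c i \<le> c j"
  using assms(2,3)
proof (induction j rule: dec_induct)
  case (step m)
  then show ?case using assms(1)[of m] by simp
qed simp

lemma in_some_cell:
  fixes c :: "nat \<Rightarrow> nat"
  assumes "x \<in> {c 0..<c n}"
  shows "\<exists>i<n. x \<in> {c i..<c (Suc i)}"
  using assms
proof (induction n)
  case (Suc n)
  then show ?case by (cases "x < c n") (auto intro: less_SucI)
qed simp

lemma choice_strict_mono:
  fixes c :: "nat \<Rightarrow> nat"
  assumes "\<And>i. i < n \<Longrightarrow> c i \<le> c (Suc i)" "s \<in> (\<Pi>\<^sub>E i\<in>{..<n}. {c i..<c (Suc i)})"
  shows "strict_mono_on {..<n} s"
proof (rule strict_mono_onI)
  fix i j assume ij: "i \<in> {..<n}" "j \<in> {..<n}" "i < j"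
  then have "c (Suc i) \<le> c j" using mono_upto[of n c "Suc i" j, OF assms(1)] by simp
  then show "s i < s j" using PiE_mem[OF assms(2), of i] PiE_mem[OF assms(2), of j] ij by auto
qed

text \<open>The cells are disjoint and ordered, so a transversal is the same as a choice of one
  point from each cell.\<close>

lemma sum_transversals:
  assumes c: "\<And>i. i < n \<Longrightarrow> c i \<le> c (Suc i)"
  shows "(\<Sum>Y | transversal n c Y. G Y) = (\<Sum>s\<in>(\<Pi>\<^sub>E i\<in>{..<n}. {c i..<c (Suc i)}). G (s ` {..<n}))"
proof (rule sum.reindex_bij_witness[where i = "\<lambda>s. s ` {..<n}"
      and j = "\<lambda>Y. restrict (\<lambda>i. the_elem (Y \<inter> {c i..<c (Suc i)})) {..<n}"])
  fix Y assume "Y \<in> {Y. transversal n c Y}"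
  then have Y: "Y \<subseteq> {c 0..<c n}" "\<And>i. i < n \<Longrightarrow> card (Y \<inter> {c i..<c (Suc i)}) = 1"
    by (auto simp: transversal_def)
  let ?t = "\<lambda>i. the_elem (Y \<inter> {c i..<c (Suc i)})"
  have t': "?t i \<in> Y \<inter> {c i..<c (Suc i)} \<and> (\<forall>x\<in>Y \<inter> {c i..<c (Suc i)}. x = ?t i)" if i: "i < n" for i
  proof -
    obtain x where "Y \<inter> {c i..<c (Suc i)} = {x}"
      using Y(2)[OF i] by (metis card_1_singletonE)
    then show ?thesis by simp
  qed
  show 1: "restrict ?t {..<n} ` {..<n} = Y"
  proof (intro equalityI subsetI)
    fix x assume "x \<in> Y"
    then obtain i where "i < n" "x \<in> {c i..<c (Suc i)}" using Y(1) in_some_cell[of x c n] by blast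
    then have "x = ?t i" using t'[of i] \<open>x \<in> Y\<close> by blast
    then show "x \<in> restrict ?t {..<n} ` {..<n}" using \<open>i < n\<close> by auto
  qed (use t' in auto)
  show "restrict ?t {..<n} \<in> (\<Pi>\<^sub>E i\<in>{..<n}. {c i..<c (Suc i)})" using t' by auto
  show "G (restrict ?t {..<n} ` {..<n}) = G Y" unfolding 1 ..
next
  fix s assume s: "s \<in> (\<Pi>\<^sub>E i\<in>{..<n}. {c i..<c (Suc i)})"
  have s': "s i \<in> {c i..<c (Suc i)}" if "i < n" for i using PiE_mem[OF s] that by auto
  have e: "s ` {..<n} \<inter> {c i..<c (Suc i)} = {s i}" if "i < n" for i
  proof -
    have J: "j = i" if "j < n" "s j \<in> {c i..<c (Suc i)}" for j
    proof (rule ccontr)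
      assume "j \<noteq> i"
      then have "c (Suc i) \<le> c j \<or> c (Suc j) \<le> c i"
        using mono_upto[of n c "Suc i" j, OF c] mono_upto[of n c "Suc j" i, OF c] \<open>i < n\<close> \<open>j < n\<close>
        by (cases "i < j") auto
      then show False using that s'[of j] by auto
    qed
    show ?thesis using s'[OF that] that J by blast
  qed
  show "restrict (\<lambda>i. the_elem (s ` {..<n} \<inter> {c i..<c (Suc i)})) {..<n} = s"
  proof
    fix i show "restrict (\<lambda>i. the_elem (s ` {..<n} \<inter> {c i..<c (Suc i)})) {..<n} i = s i"
      using e[of i] PiE_arb[OF s, of i] by (cases "i < n") auto
  qed
  have "c 0 \<le> s i \<and> s i < c n" if "i < n" for i
    using s'[OF that] mono_upto[of n c 0 i, OF c] mono_upto[of n c "Suc i" n, OF c] that by auto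
  then show "s ` {..<n} \<in> {Y. transversal n c Y}"
    using e by (auto simp: transversal_def)
qed

lemma transversal_card:
  assumes "\<And>i. i < n \<Longrightarrow> c i \<le> c (Suc i)" "transversal n c Y" "k \<le> n"
  shows "card (Y \<inter> {..<c k}) = k"
  using assms(3)
proof (induction k)
  case 0
  have "Y \<inter> {..<c 0} = {}" using assms(2) by (auto simp: transversal_def)
  then show ?case by simp
next
  case (Suc k)
  have e: "Y \<inter> {..<c (Suc k)} = (Y \<inter> {..<c k}) \<union> (Y \<inter> {c k..<c (Suc k)})"
    using assms(1)[of k] Suc.prems by auto
  have "card (Y \<inter> {..<c (Suc k)}) = card (Y \<inter> {..<c k}) + card (Y \<inter> {c k..<c (Suc k)})"
    unfolding e by (rule card_Un_disjoint) auto
  then show ?case using assms(2) Suc by (simp add: transversal_def)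
qed

text \<open>A choice from ordered cells is automatically increasing, hence equal to the enumeration
  of its image. Row i then depends on cell i alone, and multilinearity allows each row to be summed
  separately.\<close>

lemma sum_transversals_dt:
  fixes f :: "nat \<Rightarrow> nat \<Rightarrow> 'a::comm_ring_1"
  assumes c: "\<And>i. i < n \<Longrightarrow> c i \<le> c (Suc i)"
  shows "(\<Sum>Y | transversal n c Y. prod w Y * dt n (\<lambda>i j. f j (enum Y i)))
    = dt n (\<lambda>i j. \<Sum>y=c i..<c (Suc i). w y * f j y)"
proof -
  have *: "prod w (s ` {..<n}) * dt n (\<lambda>i j. f j (enum (s ` {..<n}) i)) = dt n (\<lambda>i j. w (s i) * f j (s i))"
    if s: "s \<in> (\<Pi>\<^sub>E i\<in>{..<n}. {c i..<c (Suc i)})" for s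
  proof -
    note m = choice_strict_mono[OF c s]
    have "dt n (\<lambda>i j. f j (enum (s ` {..<n}) i)) = dt n (\<lambda>i j. f j (s i))"
      by (rule dt_cong) (simp add: enum_image[OF m])
    moreover have "prod w (s ` {..<n}) = (\<Prod>i<n. w (s i))"
      using strict_mono_on_imp_inj_on[OF m] by (simp add: prod.reindex)
    ultimately show ?thesis by (simp add: dt_rows_mult)
  qed
  show ?thesis
    by (subst dt_sum_rows, simp)
      (subst sum_transversals[where n = n and c = c, OF c], assumption, rule sum.cong[OF refl], rule *)
qed

section \<open>Central factorials and interlacing sets\<close>

definition delta :: "nat set \<Rightarrow> real" where
  "delta S = (\<Prod>j\<in>S. \<Prod>i\<in>S \<inter> {..<j}. (real j)\<^sup>2 - (real i)\<^sup>2)"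

lemma delta_enum:
  assumes "finite S"
  shows "delta S = (\<Prod>j<card S. \<Prod>i<j. (real (enum S j))\<^sup>2 - (real (enum S i))\<^sup>2)"
proof -
  have "delta S = (\<Prod>j<card S. \<Prod>i\<in>S \<inter> {..<enum S j}. (real (enum S j))\<^sup>2 - (real i)\<^sup>2)"
    unfolding delta_def by (rule prod_enum[OF assms, symmetric])
  also have "\<dots> = (\<Prod>j<card S. \<Prod>i<j. (real (enum S j))\<^sup>2 - (real (enum S i))\<^sup>2)"
  proof (rule prod.cong[OF refl])
    fix j assume j: "j \<in> {..<card S}"
    have inj: "inj_on (enum S) {..<j}"
      using bij_betw_enum[OF assms] j by (auto simp: bij_betw_def intro: inj_on_subset)
    have "enum S ` {..<j} = S \<inter> {..<enum S j}"
    proof (rule card_subset_eq)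
      show "enum S ` {..<j} \<subseteq> S \<inter> {..<enum S j}"
        using j enum_in[OF assms] enum_less[OF assms, of _ j] by auto
      show "card (enum S ` {..<j}) = card (S \<inter> {..<enum S j})"
        using card_image[OF inj] card_less_enum[OF assms, of j] j by simp
    qed simp
    then show "(\<Prod>i\<in>S \<inter> {..<enum S j}. (real (enum S j))\<^sup>2 - (real i)\<^sup>2)
        = (\<Prod>i<j. (real (enum S j))\<^sup>2 - (real (enum S i))\<^sup>2)"
      using prod.reindex[OF inj, of "\<lambda>i. (real (enum S j))\<^sup>2 - (real i)\<^sup>2"] by simp
  qed
  finally show ?thesis .
qed

lemma delta_pos: "finite S \<Longrightarrow> delta S > 0"
  unfolding delta_def by (intro prod_pos) (auto intro!: prod_pos power_strict_mono)

text \<open>Each mixed pair occurs once, as larger square minus smaller square, hence the absolute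
  value.\<close>

lemma delta_Un:
  assumes "finite A" "finite B" "A \<inter> B = {}"
  shows "delta (A \<union> B) = delta A * delta B * (\<Prod>s\<in>B. \<Prod>p\<in>A. \<bar>(real s)\<^sup>2 - (real p)\<^sup>2\<bar>)"
proof -
  let ?d = "\<lambda>j i. (real j)\<^sup>2 - (real i)\<^sup>2"
  have split: "(\<Prod>i\<in>(A \<union> B) \<inter> {..<j}. ?d j i) = (\<Prod>i\<in>A \<inter> {..<j}. ?d j i) * (\<Prod>i\<in>B \<inter> {..<j}. ?d j i)" for j
    unfolding Int_Un_distrib2 using assms by (intro prod.union_disjoint) auto
  have "delta (A \<union> B) = (\<Prod>j\<in>A. (\<Prod>i\<in>A \<inter> {..<j}. ?d j i) * (\<Prod>i\<in>B \<inter> {..<j}. ?d j i))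
      * (\<Prod>j\<in>B. (\<Prod>i\<in>A \<inter> {..<j}. ?d j i) * (\<Prod>i\<in>B \<inter> {..<j}. ?d j i))"
    unfolding delta_def split using assms by (intro prod.union_disjoint) auto
  also have "\<dots> = delta A * delta B * ((\<Prod>j\<in>A. \<Prod>i\<in>B \<inter> {..<j}. ?d j i) * (\<Prod>j\<in>B. \<Prod>i\<in>A \<inter> {..<j}. ?d j i))"
    by (simp add: delta_def prod.distrib)
  also have "(\<Prod>j\<in>A. \<Prod>i\<in>B \<inter> {..<j}. ?d j i) = (\<Prod>j\<in>A. \<Prod>i\<in>B. if i < j then ?d j i else 1)"
    by (rule prod.cong[OF refl]) (subst prod.inter_restrict[OF assms(2)], simp)
  also have "\<dots> = (\<Prod>s\<in>B. \<Prod>p\<in>A. if s < p then ?d p s else 1)" by (rule prod.swap)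
  also have "(\<Prod>j\<in>B. \<Prod>i\<in>A \<inter> {..<j}. ?d j i) = (\<Prod>s\<in>B. \<Prod>p\<in>A. if p < s then ?d s p else 1)"
    by (rule prod.cong[OF refl]) (subst prod.inter_restrict[OF assms(1)], simp)
  also have "(\<Prod>s\<in>B. \<Prod>p\<in>A. if s < p then ?d p s else 1) * \<dots> = (\<Prod>s\<in>B. \<Prod>p\<in>A. \<bar>?d s p\<bar>)"
    unfolding prod.distrib[symmetric]
  proof (intro prod.cong refl)
    fix s p assume "s \<in> B" "p \<in> A"
    then have "s \<noteq> p" using assms(3) by auto
    then show "(if s < p then ?d p s else 1) * (if p < s then ?d s p else 1) = \<bar>?d s p\<bar>"
      using power_strict_mono[of "real p" "real s" 2] power_strict_mono[of "real s" "real p" 2]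
      by (cases "s < p") auto
  qed
  finally show ?thesis .
qed

text \<open>Column j is a polynomial of degree j in the squared position, so that only its leading
  coefficient \<open>k j * e j ^ j\<close> survives. The choice \<open>e = -1\<close> covers
  products of reversed differences.\<close>

lemma dt_even_vandermonde:
  assumes "finite S" "card S = n"
  shows "dt n (\<lambda>i j. k j * (\<Prod>p<j. e j * ((real (enum S i))\<^sup>2 - d p))) = (\<Prod>j<n. k j * e j ^ j) * delta S"
proof -
  define q where "q j = smult (k j * e j ^ j) (\<Prod>p<j. [:- d p, 1:])" for j
  have c: "degree (\<Prod>p<j. [:- d p, 1:]) = j \<and> coeff (\<Prod>p<j. [:- d p, 1:]) j = 1" for j
  proof -
    have "lead_coeff (\<Prod>p<j. [:- d p, 1:]) = (\<Prod>p<j. lead_coeff [:- d p, 1:])" by (rule lead_coeff_prod)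
    moreover have "degree (\<Prod>p<j. [:- d p, 1:]) = (\<Sum>p<j. degree [:- d p, 1:])" by (rule degree_prod_eq_sum_degree) simp
    ultimately show ?thesis by simp
  qed
  have "dt n (\<lambda>i j. k j * (\<Prod>p<j. e j * ((real (enum S i))\<^sup>2 - d p)))
      = dt n (\<lambda>i j. poly (q j) ((real (enum S i))\<^sup>2))"
    by (rule dt_cong) (simp add: q_def poly_prod prod.distrib)
  also have "\<dots> = (\<Prod>j<n. coeff (q j) j) * (\<Prod>j<n. \<Prod>i<j. (real (enum S j))\<^sup>2 - (real (enum S i))\<^sup>2)"
    by (rule dt_vandermonde) (use c in \<open>auto simp: q_def intro: order_trans[OF degree_smult_le]\<close>)
  finally show ?thesis using c assms by (simp add: delta_enum q_def)
qed

text \<open>Meant for products of differences of squares: after a shift by one half, their linear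
  factors regroup into those of another such product, and \<open>r\<close> collects the unmatched
  factors at the ends.\<close>

lemma prod_lessThan_Suc_eq:
  fixes f g r :: "nat \<Rightarrow> 'a::comm_monoid_mult"
  assumes "f 0 = r 0" "\<And>j. r j * f (Suc j) = r (Suc j) * g j"
  shows "(\<Prod>i<Suc j. f i) = r j * (\<Prod>i<j. g i)"
proof (induction j)
  case (Suc j)
  have "(\<Prod>i<Suc (Suc j). f i) = (r j * f (Suc j)) * (\<Prod>i<j. g i)"
    using Suc by (simp add: mult_ac)
  then show ?case by (simp add: assms(2) mult_ac)
qed (simp add: assms(1))

text \<open>Together with \<open>odd_factorial\<close> these are the central factorials of x of
  order 2 j and 2 j + 1, divided by the factorial of the order; the central difference lowers the
  order by one.\<close>

definition even_factorial :: "nat \<Rightarrow> real \<Rightarrow> real" where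
  "even_factorial j x = (\<Prod>i<j. x\<^sup>2 - (real i)\<^sup>2) / fact (2 * j)"

definition odd_factorial :: "nat \<Rightarrow> real \<Rightarrow> real" where
  "odd_factorial j x = x * (\<Prod>i<j. x\<^sup>2 - (real i + 1/2)\<^sup>2) / fact (2 * j + 1)"

text \<open>All but two linear factors of either product on the left are common to both and form
  \<open>?C\<close>; what remains is an identity of quadratic polynomials in x.\<close>

lemma even_factorial_difference: "even_factorial (Suc j) (x + 1) - even_factorial (Suc j) x = odd_factorial j (x + 1/2)"
proof -
  let ?C = "\<Prod>i<j. (x + 1/2)\<^sup>2 - (real i + 1/2)\<^sup>2"
  have "(\<Prod>i<Suc j. (x + 1)\<^sup>2 - (real i)\<^sup>2) = (x + 1) * (x + 1 + real j) * ?C"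
    by (rule prod_lessThan_Suc_eq) (simp_all add: power2_eq_square algebra_simps)
  moreover have "(\<Prod>i<Suc j. x\<^sup>2 - (real i)\<^sup>2) = x * (x - real j) * ?C"
    by (rule prod_lessThan_Suc_eq) (simp_all add: power2_eq_square algebra_simps)
  ultimately have "even_factorial (Suc j) (x + 1) - even_factorial (Suc j) x
      = ((x + 1) * (x + 1 + real j) - x * (x - real j)) * ?C / fact (2 * Suc j)"
    unfolding even_factorial_def by (simp only: diff_divide_distrib left_diff_distrib)
  also have "(x + 1) * (x + 1 + real j) - x * (x - real j) = (2 * real j + 2) * (x + 1/2)"
    by (simp add: algebra_simps)
  also have "fact (2 * Suc j) = (2 * real j + 2) * fact (2 * j + 1)"
    by (simp add: algebra_simps)
  finally show ?thesis by (simp add: odd_factorial_def del: fact_Suc)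
qed

lemma odd_factorial_difference: "odd_factorial j (x + 1/2) - odd_factorial j (x - 1/2) = even_factorial j x"
\<comment> \<open>For j > 0 all three products share a factor x and the factors in
  \<open>?C\<close>; for j = 0 they are empty and there is nothing to split off.\<close>
proof (cases j)
  case 0
  then show ?thesis by (simp add: odd_factorial_def even_factorial_def)
next
  case (Suc k)
  let ?C = "\<Prod>i<k. x\<^sup>2 - (real i + 1)\<^sup>2"
  have p1: "(\<Prod>i<Suc k. (x + 1/2)\<^sup>2 - (real i + 1/2)\<^sup>2) = x * (x + 1 + real k) * ?C"
    by (rule prod_lessThan_Suc_eq) (simp_all add: power2_eq_square algebra_simps)
  have p2: "(\<Prod>i<Suc k. (x - 1/2)\<^sup>2 - (real i + 1/2)\<^sup>2) = x * (x - 1 - real k) * ?C"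
    by (rule prod_lessThan_Suc_eq) (simp_all add: power2_eq_square algebra_simps)
  have p3: "(\<Prod>i<Suc k. x\<^sup>2 - (real i)\<^sup>2) = x * x * ?C"
    by (rule prod_lessThan_Suc_eq) (simp_all add: power2_eq_square algebra_simps)
  have "odd_factorial j (x + 1/2) - odd_factorial j (x - 1/2)
      = ((x + 1/2) * (x * (x + 1 + real k) * ?C) - (x - 1/2) * (x * (x - 1 - real k) * ?C)) / fact (2 * j + 1)"
    unfolding odd_factorial_def Suc p1 p2 diff_divide_distrib ..
  also have "(x + 1/2) * (x * (x + 1 + real k) * ?C) - (x - 1/2) * (x * (x - 1 - real k) * ?C)
      = (2 * real j + 1) * (x * x * ?C)"
  proof -
    have "(x + 1/2) * (x * (x + 1 + r) * C) - (x - 1/2) * (x * (x - 1 - r) * C) = (2 * (1 + r) + 1) * (x * x * C)"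
      for r C :: real by (simp add: algebra_simps)
    then show ?thesis unfolding Suc of_nat_Suc .
  qed
  also have "fact (2 * j + 1) = (2 * real j + 1) * fact (2 * j)"
    by (simp add: algebra_simps)
  finally show ?thesis unfolding even_factorial_def Suc p3 by (simp del: fact_Suc)
qed

lemma sum_odd_factorial:
  assumes "m \<le> n"
  shows "(\<Sum>y=m..<n. odd_factorial j (real y + 1/2)) = even_factorial (Suc j) (real n) - even_factorial (Suc j) (real m)"
  using sum_Suc_diff'[OF assms, of "\<lambda>y. even_factorial (Suc j) (real y)"]
  by (simp add: even_factorial_difference[symmetric] add.commute)

abbreviation half0 :: "nat \<Rightarrow> real" where
  "half0 x \<equiv> (if x = 0 then 1/2 else 1)"

text \<open>Halving the weight of 0 turns the sum of the even function over 0, 1, ..., n - 1 into half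
  of a sum over a symmetric interval.\<close>

lemma sum_even_factorial: "(\<Sum>x<n. half0 x * even_factorial j (real x)) = (if n = 0 then 0 else odd_factorial j (real n - 1/2))"
proof (induction n)
  case (Suc n)
  have neg: "odd_factorial j (- y) = - odd_factorial j y" for y by (simp add: odd_factorial_def)
  show ?case
  proof (cases n)
    case 0
    then show ?thesis using odd_factorial_difference[of j 0] neg[of "1/2"] by simp
  next
    case (Suc m)
    then show ?thesis using Suc.IH odd_factorial_difference[of j "real n"] by (simp add: algebra_simps)
  qed
qed simp

definition even_det :: "nat \<Rightarrow> nat set \<Rightarrow> real" where
  "even_det n X = dt n (\<lambda>i j. even_factorial j (real (enum X i)))"

text \<open>On odd lines the zigzag is shifted by one half, so index y stands for the position y +
  1/2.\<close>

definition odd_det :: "nat \<Rightarrow> nat set \<Rightarrow> real" where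
  "odd_det n Y = dt n (\<lambda>i j. odd_factorial j (real (enum Y i) + 1/2))"

lemma even_det_eq:
  assumes "finite X" "card X = n"
  shows "even_det n X = delta X / H2 (2 * n)"
proof -
  have "even_det n X = dt n (\<lambda>i j. (1 / fact (2 * j)) * (\<Prod>p<j. 1 * ((real (enum X i))\<^sup>2 - (real p)\<^sup>2)))"
    unfolding even_det_def even_factorial_def by (intro dt_cong) simp
  also have "\<dots> = (\<Prod>j<n. 1 / fact (2 * j)) * delta X"
    by (subst dt_even_vandermonde[OF assms]) simp
  also have "(\<Prod>j<n. 1 / fact (2 * j)) = 1 / H2 (2 * n)"
  proof -
    have "H2 (2 * n) = (\<Prod>j<n. fact (2 * j))"
      unfolding H2_def by (rule prod.reindex_bij_witness[where i = "\<lambda>j. n - j" and j = "\<lambda>i. n - i"]) (auto simp: diff_mult_distrib2)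
    then show ?thesis by (simp add: prod_dividef)
  qed
  finally show ?thesis by simp
qed

text \<open>Summing row i over the cell between two consecutive points of X telescopes to a
  difference of even central factorials. These are the row differences left when the constant column
  0 of \<open>even_det\<close> is removed.\<close>

lemma sum_odd_det:
  assumes "finite X" "card X = Suc n"
  shows "(\<Sum>Y | transversal n (enum X) Y. odd_det n Y) = even_det (Suc n) X"
proof -
  let ?c = "enum X"
  have le: "enum X i \<le> enum X (Suc i)" if "i < n" for i
    using enum_less[OF assms(1), of i "Suc i"] that assms(2) by simp
  have "(\<Sum>Y | transversal n (enum X) Y. odd_det n Y)
      = (\<Sum>Y | transversal n (enum X) Y. prod (\<lambda>_. 1) Y * dt n (\<lambda>i j. odd_factorial j (real (enum Y i) + 1/2)))"
    by (simp add: odd_det_def)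
  also have "\<dots> = dt n (\<lambda>i j. \<Sum>y=enum X i..<enum X (Suc i). 1 * odd_factorial j (real y + 1/2))"
    by (rule sum_transversals_dt[where n = n and c = ?c, OF le])
  also have "\<dots> = dt n (\<lambda>i j. even_factorial (Suc j) (real (enum X (Suc i))) - even_factorial (Suc j) (real (enum X i)))"
    by (rule dt_cong) (simp add: sum_odd_factorial le)
  also have "\<dots> = even_det (Suc n) X"
    unfolding even_det_def by (rule dt_drop_ones[symmetric]) (simp add: even_factorial_def)
  finally show ?thesis .
qed

text \<open>The integer positions separated by the half-integers y + 1/2: position y itself still
  lies to the left of y + 1/2, hence \<open>Suc\<close>. The first cell starts at the
  zigzag.\<close>

definition odd_cells :: "nat set \<Rightarrow> nat \<Rightarrow> nat" where
  "odd_cells Y i = (case i of 0 \<Rightarrow> 0 | Suc k \<Rightarrow> Suc (enum Y k))"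

lemma odd_cells_mono:
  assumes "finite Y" "i < card Y"
  shows "odd_cells Y i \<le> odd_cells Y (Suc i)"
  using enum_less[OF assms(1), of "i - 1" i] assms(2) by (cases i) (auto simp: odd_cells_def)

text \<open>The half weight at 0 makes every sum from 0 up to y a single odd central factorial at y
  + 1/2. A cell is a difference of two such initial segments, so the summed rows are row differences
  of \<open>odd_det\<close>.\<close>

lemma sum_even_det:
  assumes "finite Y" "card Y = n"
  shows "(\<Sum>X | transversal n (odd_cells Y) X. prod half0 X * even_det n X) = odd_det n Y"
proof -
  let ?c = "odd_cells Y"
  note le = odd_cells_mono[OF assms(1), unfolded assms(2)]
  have "(\<Sum>X | transversal n ?c X. prod half0 X * even_det n X)
      = (\<Sum>X | transversal n ?c X. prod half0 X * dt n (\<lambda>i j. even_factorial j (real (enum X i))))"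
    by (simp add: even_det_def)
  also have "\<dots> = dt n (\<lambda>i j. \<Sum>x=?c i..<?c (Suc i). half0 x * even_factorial j (real x))"
    by (rule sum_transversals_dt[where n = n and c = ?c, OF le])
  also have "\<dots> = dt n (\<lambda>i j. odd_factorial j (real (enum Y i) + 1/2) - (if i = 0 then 0 else odd_factorial j (real (enum Y (i - 1)) + 1/2)))"
  proof (rule dt_cong)
    fix i j assume "i < n" "j < n"
    have "(\<Sum>x=?c i..<?c (Suc i). half0 x * even_factorial j (real x))
      = (\<Sum>x<?c (Suc i). half0 x * even_factorial j (real x)) - (\<Sum>x<?c i. half0 x * even_factorial j (real x))"
      using le[OF \<open>i < n\<close>] sum_diff_nat_ivl[of 0 "?c i" "?c (Suc i)" "\<lambda>x. half0 x * even_factorial j (real x)"]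
      by (simp add: lessThan_atLeast0)
    also have "\<dots> = odd_factorial j (real (enum Y i) + 1/2) - (if i = 0 then 0 else odd_factorial j (real (enum Y (i - 1)) + 1/2))"
      unfolding sum_even_factorial by (cases i) (simp_all add: odd_cells_def algebra_simps)
    finally show "(\<Sum>x=?c i..<?c (Suc i). half0 x * even_factorial j (real x))
      = odd_factorial j (real (enum Y i) + 1/2) - (if i = 0 then 0 else odd_factorial j (real (enum Y (i - 1)) + 1/2))" .
  qed
  also have "\<dots> = odd_det n Y"
    unfolding odd_det_def by (rule dt_row_differences)
  finally show ?thesis .
qed

text \<open>For s in the gap \<open>{a..<m}\<close> this collects the weight of the crossing lozenge
  at s and the mixed factors of s with all dent positions, which fill \<open>{..<a}\<close> and
  \<open>{m..<m + c}\<close>.\<close>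

definition selberg_weight :: "nat \<Rightarrow> nat \<Rightarrow> nat \<Rightarrow> nat \<Rightarrow> real" where
  "selberg_weight a c m s = half0 s * (\<Prod>p<a. (real s)\<^sup>2 - (real p)\<^sup>2) * (\<Prod>p=m..<m+c. (real p)\<^sup>2 - (real s)\<^sup>2)"

lemma bracket_Suc: "bracket x (Suc n) = bracket x n * (x + 2 * real n)"
  by (simp add: bracket_def)

lemma bracket_add: "bracket x (n + k) = bracket x n * bracket (x + 2 * real n) k"
  by (induction k) (simp_all add: bracket_Suc bracket_def[of _ 0] algebra_simps)

lemma bracket_pos: "x > 0 \<Longrightarrow> bracket x n > 0"
  unfolding bracket_def by (intro prod_pos) auto

lemma bracket_pochhammer: "bracket x n = 2 ^ n * pochhammer (x / 2) n"
  by (induction n) (simp_all add: bracket_Suc bracket_def[of _ 0] pochhammer_Suc algebra_simps)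

text \<open>A discrete beta integral, by induction on c with a arbitrary: writing the last factor as
  the difference of (m + c)^2 - a^2 and s^2 - a^2 leaves one sum with the same a and one with a + 1,
  both with smaller c. For c = 0 the sum is a central difference.\<close>

lemma sum_selberg_weight:
  assumes "m > 0" "a \<le> m"
  shows "(\<Sum>s=a..<m. selberg_weight a c m s)
    = fact c / 2 * pochhammer (real m - real a) (2 * a + c)
        * bracket (2 * real m - 1) (Suc c) / bracket (2 * real a + 1) (Suc c)"
  using assms
proof (induction c arbitrary: a)
  case 0
  have prod_eq: "(\<Prod>i<a. (real m - 1/2)\<^sup>2 - (real i + 1/2)\<^sup>2) = pochhammer (real m - real a) (2 * a)"
  proof (induction a)
    case (Suc a)
    have "pochhammer (real m - real (Suc a)) (2 * Suc a)
        = (real m - real (Suc a)) * (pochhammer (real m - real a) (2 * a) * (real m + real a))"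
      using pochhammer_rec[of "real m - real (Suc a)" "Suc (2 * a)"]
        pochhammer_Suc[of "real m - real a" "2 * a"] by simp
    also have "\<dots> = pochhammer (real m - real a) (2 * a) * ((real m - 1/2)\<^sup>2 - (real a + 1/2)\<^sup>2)"
      by (simp add: power2_eq_square algebra_simps)
    finally show ?case by (simp add: Suc)
  qed simp
  \<comment> \<open>The even central factorial of order 2 a vanishes at all s < a, so the summation
    can start at 0.\<close>
  have "(\<Sum>s=a..<m. selberg_weight a 0 m s) = (\<Sum>s<m. half0 s * even_factorial a (real s) * fact (2 * a))"
  proof (rule sum.mono_neutral_cong_left)
    show "\<forall>s\<in>{..<m} - {a..<m}. half0 s * even_factorial a (real s) * fact (2 * a) = 0"
      by (auto simp: even_factorial_def intro!: prod_zero)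
  qed (auto simp: selberg_weight_def even_factorial_def)
  also have "\<dots> = fact (2 * a) * odd_factorial a (real m - 1/2)"
    using sum_even_factorial[of a m] 0 by (simp add: sum_distrib_right[symmetric])
  also have "\<dots> = (real m - 1/2) * pochhammer (real m - real a) (2 * a) / (2 * real a + 1)"
    by (simp add: odd_factorial_def prod_eq)
  finally show ?case by (simp add: bracket_def field_simps)
next
  case (Suc c)
  let ?P = "pochhammer (real m - real a) (2 * a + c)"
  let ?B = "bracket (2 * real m - 1) (Suc c)"
  let ?D = "bracket (2 * real a + 1) (Suc (Suc c))"
  have D: "?D = bracket (2 * real a + 1) (Suc c) * (2 * real a + 2 * real c + 3)"
    "?D = (2 * real a + 1) * bracket (2 * real (Suc a) + 1) (Suc c)"
    using bracket_add[of "2 * real a + 1" 1 "Suc c"]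
    by (simp_all add: bracket_Suc[of _ "Suc c"] bracket_def[of _ "Suc 0"] algebra_simps)
  have pos: "bracket (2 * real a + 1) (Suc c) > 0" "bracket (2 * real (Suc a) + 1) (Suc c) > 0" "?D > 0"
    by (auto intro!: bracket_pos)
  have step: "selberg_weight a (Suc c) m s = ((real m + real c)\<^sup>2 - (real a)\<^sup>2) * selberg_weight a c m s - selberg_weight (Suc a) c m s" for s
    by (simp add: selberg_weight_def algebra_simps)
  have Sa: "(\<Sum>s=a..<m. selberg_weight (Suc a) c m s)
      = fact c / 2 * ((real m - real a - 1) * ?P * (real m + real a + real c)) * ?B * (2 * real a + 1) / ?D"
  \<comment> \<open>The induction hypothesis needs a + 1 <= m. For a = m the sum is empty and the
    rising factorial starts with the factor 0.\<close>
  proof (cases "a = m")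
    case True
    then have "?P = 0" using Suc.prems by (simp add: pochhammer_0_left)
    then show ?thesis using True by simp
  next
    case False
    then have "Suc a \<le> m" using Suc.prems by simp
    have "selberg_weight (Suc a) c m a = 0" by (simp add: selberg_weight_def)
    then have "(\<Sum>s=a..<m. selberg_weight (Suc a) c m s) = (\<Sum>s=Suc a..<m. selberg_weight (Suc a) c m s)"
      using \<open>Suc a \<le> m\<close> by (simp add: sum.atLeast_Suc_lessThan)
    also have "\<dots> = fact c / 2 * pochhammer (real m - real (Suc a)) (2 * Suc a + c) * ?B
        / bracket (2 * real (Suc a) + 1) (Suc c)"
      using Suc.IH[OF Suc.prems(1) \<open>Suc a \<le> m\<close>] .
    also have "pochhammer (real m - real (Suc a)) (2 * Suc a + c)
        = (real m - real a - 1) * ?P * (real m + real a + real c)"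
      using pochhammer_rec[of "real m - real (Suc a)" "Suc (2 * a + c)"]
        pochhammer_Suc[of "real m - real a" "2 * a + c"] by (simp add: algebra_simps)
    finally show ?thesis using pos by (simp add: D(2))
  qed
  have "(\<Sum>s=a..<m. selberg_weight a (Suc c) m s)
      = ((real m + real c)\<^sup>2 - (real a)\<^sup>2) * (\<Sum>s=a..<m. selberg_weight a c m s) - (\<Sum>s=a..<m. selberg_weight (Suc a) c m s)"
    by (simp add: step sum_subtractf sum_distrib_left)
  also have "(\<Sum>s=a..<m. selberg_weight a c m s) = fact c / 2 * ?P * ?B * (2 * real a + 2 * real c + 3) / ?D"
    using Suc.IH[OF Suc.prems] pos by (simp add: D(1))
  also have "((real m + real c)\<^sup>2 - (real a)\<^sup>2) * \<dots> - (\<Sum>s=a..<m. selberg_weight (Suc a) c m s)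
      = fact c / 2 * ?P * ?B / ?D * (real m + real a + real c)
        * ((real m + real c - real a) * (2 * real a + 2 * real c + 3) - (real m - real a - 1) * (2 * real a + 1))"
  proof -
    have "((M + C)\<^sup>2 - A\<^sup>2) * (f * P * B * q / D) - f * ((M - A - 1) * P * (M + A + C)) * B * t / D
        = f * P * B / D * (M + A + C) * ((M + C - A) * q - (M - A - 1) * t)" for M A C f P B D q t :: real
    proof -
      define k where "k = f * P * B / D"
      have "((M + C)\<^sup>2 - A\<^sup>2) * (k * q) - k * (M - A - 1) * (M + A + C) * t
          = k * (M + A + C) * ((M + C - A) * q - (M - A - 1) * t)"
        by (simp add: power2_eq_square algebra_simps)
      then show ?thesis by (simp add: k_def mult_ac)
    qed
    then show ?thesis unfolding Sa .
  qed
  also have "(real m + real c - real a) * (2 * real a + 2 * real c + 3) - (real m - real a - 1) * (2 * real a + 1)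
      = (real c + 1) * (2 * real m + 2 * real c + 1)"
    by (simp add: algebra_simps)
  finally have "(\<Sum>s=a..<m. selberg_weight a (Suc c) m s) = fact c / 2 * ?P * ?B / ?D * (real m + real a + real c)
    * ((real c + 1) * (2 * real m + 2 * real c + 1))" .
  moreover have "pochhammer (real m - real a) (2 * a + Suc c) = ?P * (real m + real a + real c)"
    using pochhammer_Suc[of "real m - real a" "2 * a + c"] by (simp add: algebra_simps)
  moreover have "bracket (2 * real m - 1) (Suc (Suc c)) = ?B * (2 * real m + 2 * real c + 1)"
    by (simp add: bracket_Suc[of _ "Suc c"] algebra_simps)
  moreover have "fact (Suc c) = (real c + 1) * fact c" by simp
  ultimately show ?case by (simp only: mult_ac times_divide_eq_left times_divide_eq_right)
qed

section \<open>A discrete Selberg sum\<close>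

text \<open>By the Chu-Vandermonde identity the matrix is a product of a polynomial Vandermonde matrix in
  the basis of rising factorials and a triangular matrix.\<close>

lemma dt_pochhammer:
  fixes u v :: real
  shows "dt n (\<lambda>i j. pochhammer (X i + u) j * pochhammer (X i + v + real j) (n - 1 - j))
    = (\<Prod>j<n. pochhammer (v - u) j) * (\<Prod>j<n. \<Prod>i<j. X j - X i)"
proof -
  define q :: "nat \<Rightarrow> real poly" where "q k = (\<Prod>p<k. [:u + real p, 1:])" for k
  have q: "poly (q k) x = pochhammer (x + u) k" for k x
    by (simp add: q_def poly_prod pochhammer_prod lessThan_atLeast0 add_ac)
  have c: "degree (q k) = k \<and> coeff (q k) k = 1" for k
  proof -
    have "lead_coeff (q k) = (\<Prod>p<k. lead_coeff [:u + real p, 1:])" unfolding q_def by (rule lead_coeff_prod)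
    moreover have "degree (q k) = (\<Sum>p<k. degree [:u + real p, 1:])" unfolding q_def by (rule degree_prod_eq_sum_degree) simp
    ultimately show ?thesis by simp
  qed
  define l where "l k j = (if j \<le> k then real ((n - 1 - j) choose (k - j)) * pochhammer (v - u) (n - 1 - k) else 0)"
    for k j :: nat
  have "pochhammer (x + u) j * pochhammer (x + v + real j) (n - 1 - j) = (\<Sum>k<n. poly (q k) x * l k j)"
    if "j < n" for x j
  proof -
    have "pochhammer (x + v + real j) (n - 1 - j)
        = (\<Sum>i\<le>n - 1 - j. real ((n - 1 - j) choose i) * pochhammer (x + u + real j) i * pochhammer (v - u) (n - 1 - j - i))"
      using pochhammer_binomial_sum[of "x + u + real j" "v - u" "n - 1 - j"] by (simp add: add_ac)
    then have "pochhammer (x + u) j * pochhammer (x + v + real j) (n - 1 - j)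
        = (\<Sum>i\<le>n - 1 - j. poly (q (j + i)) x * l (j + i) j)"
      by (simp add: sum_distrib_left q l_def pochhammer_product'[of "x + u" j] mult_ac)
    also have "\<dots> = (\<Sum>k=j..<n. poly (q k) x * l k j)"
      using that by (intro sum.reindex_bij_witness[where i = "\<lambda>k. k - j" and j = "\<lambda>i. j + i"]) auto
    also have "\<dots> = (\<Sum>k<n. poly (q k) x * l k j)"
      by (intro sum.mono_neutral_left) (auto simp: l_def)
    finally show ?thesis .
  qed
  then have "dt n (\<lambda>i j. pochhammer (X i + u) j * pochhammer (X i + v + real j) (n - 1 - j))
      = dt n (\<lambda>i j. \<Sum>k<n. poly (q k) (X i) * l k j)"
    by (intro dt_cong) simp
  also have "\<dots> = dt n (\<lambda>i k. poly (q k) (X i)) * dt n l" by (rule dt_mult[symmetric])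
  also have "dt n l = (\<Prod>j<n. pochhammer (v - u) (n - 1 - j))"
    by (subst dt_lower_triangular) (auto simp: l_def)
  also have "\<dots> = (\<Prod>j<n. pochhammer (v - u) j)"
    using prod.nat_diff_reindex[of "pochhammer (v - u)" n] by simp
  also have "dt n (\<lambda>i k. poly (q k) (X i)) = (\<Prod>j<n. \<Prod>i<j. X j - X i)"
    by (subst dt_vandermonde) (simp_all add: c)
  finally show ?thesis by (simp add: mult.commute)
qed

lemma prod_differences: "(\<Prod>i<j. real j - real i) = fact j"
  using prod.nat_diff_reindex[of "\<lambda>i. real (Suc i)" j]
  by (simp add: fact_prod_Suc lessThan_atLeast0 of_nat_diff)

text \<open>Taking the factorial \<open>fact (u - 1 + i)\<close> and the longest denominator, the
  one of the last column, out of row i leaves a polynomial in i: a rising factorial of length j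
  times one of length n - 1 - j. This is the shape of \<open>dt_pochhammer\<close>.\<close>

lemma dt_fact_bracket:
  assumes "u > 0"
  shows "dt n (\<lambda>i j. fact (u - 1 + i + j) / bracket (2 * real a + 1) (Suc c + i + j))
    = (\<Prod>j<n. fact (u - 1 + j) / bracket (2 * real a + 1) (c + j + n)
        * (\<Prod>k<j. 2 * real a + 2 * real c + 3 - 2 * real u + 2 * real k) * fact j)"
proof -
  \<comment> \<open>The first factor missing from the denominator is 2 a + 1 + 2 (c + 1 + i + j),
    which is twice i + \<open>?v\<close> + j.\<close>
  let ?v = "real a + real c + 3 / 2"
  have "dt n (\<lambda>i j. fact (u - 1 + i + j) / bracket (2 * real a + 1) (Suc c + i + j))
      = dt n (\<lambda>i j. (fact (u - 1 + i) / bracket (2 * real a + 1) (c + i + n))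
          * (2 ^ (n - 1 - j) * (pochhammer (real i + real u) j * pochhammer (real i + ?v + real j) (n - 1 - j))))"
  proof (rule dt_cong)
    fix i j assume ij: "i < n" "j < n"
    have f: "fact (u - 1 + i + j) = fact (u - 1 + i) * pochhammer (real i + real u) j"
      using pochhammer_product'[of "1::real" "u - 1 + i" j] assms
      by (simp add: pochhammer_fact[symmetric] add_ac of_nat_diff)
    have "c + i + n = (Suc c + i + j) + (n - 1 - j)" using ij by simp
    then have "bracket (2 * real a + 1) (c + i + n) = bracket (2 * real a + 1) (Suc c + i + j)
        * bracket (2 * real a + 1 + 2 * real (Suc c + i + j)) (n - 1 - j)"
      by (simp only: bracket_add)
    also have "bracket (2 * real a + 1 + 2 * real (Suc c + i + j)) (n - 1 - j)
        = 2 ^ (n - 1 - j) * pochhammer (real i + ?v + real j) (n - 1 - j)"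
      unfolding bracket_pochhammer by (rule arg_cong[of _ _ "\<lambda>x. 2 ^ _ * pochhammer x _"]) (simp add: field_simps)
    finally have b: "bracket (2 * real a + 1) (c + i + n) = bracket (2 * real a + 1) (Suc c + i + j)
        * (2 ^ (n - 1 - j) * pochhammer (real i + ?v + real j) (n - 1 - j))" .
    have "bracket (2 * real a + 1) (c + i + n) \<noteq> 0"
      using bracket_pos[of "2 * real a + 1" "c + i + n"] by simp
    then show "fact (u - 1 + i + j) / bracket (2 * real a + 1) (Suc c + i + j)
      = (fact (u - 1 + i) / bracket (2 * real a + 1) (c + i + n))
          * (2 ^ (n - 1 - j) * (pochhammer (real i + real u) j * pochhammer (real i + ?v + real j) (n - 1 - j)))"
      unfolding b f by (simp add: field_simps)
  qed
  also have "\<dots> = (\<Prod>i<n. fact (u - 1 + i) / bracket (2 * real a + 1) (c + i + n))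
      * ((\<Prod>j<n. 2 ^ (n - 1 - j)) * ((\<Prod>j<n. pochhammer (?v - real u) j) * (\<Prod>j<n. \<Prod>i<j. real j - real i)))"
    unfolding dt_rows_mult dt_cols_mult dt_pochhammer ..
  also have "(\<Prod>j<n. 2 ^ (n - 1 - j)) = (\<Prod>j<n. 2 ^ j :: real)"
    using prod.nat_diff_reindex[of "\<lambda>j. 2 ^ j :: real" n] by simp
  finally have "dt n (\<lambda>i j. fact (u - 1 + i + j) / bracket (2 * real a + 1) (Suc c + i + j))
      = (\<Prod>j<n. fact (u - 1 + j) / bracket (2 * real a + 1) (c + j + n) * (2 ^ j * pochhammer (?v - real u) j) * fact j)"
    unfolding prod_differences by (simp only: prod.distrib mult_ac)
  moreover have "2 ^ j * pochhammer (?v - real u) j = (\<Prod>k<j. 2 * real a + 2 * real c + 3 - 2 * real u + 2 * real k)" for j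
  proof -
    have "2 ^ j * pochhammer w j = bracket (2 * w) j" for w :: real
      by (simp add: bracket_pochhammer)
    then have "2 ^ j * pochhammer (?v - real u) j = bracket (2 * (?v - real u)) j" .
    also have "\<dots> = (\<Prod>k<j. 2 * real a + 2 * real c + 3 - 2 * real u + 2 * real k)"
      unfolding bracket_def by (intro prod.cong) (simp_all add: algebra_simps)
    finally show ?thesis .
  qed
  ultimately show ?thesis by simp
qed

text \<open>The two factors of the squared \<open>delta\<close> are expanded in different bases:
  \<open>f\<close> extends the zeros of the weight below the gap, \<open>g\<close> those above it.
  Every entry is then a one-variable sum of the same kind with enlarged parameters.\<close>

lemma selberg_sum:
  fixes a c x y :: nat
  defines "m \<equiv> a + x + y"
  shows "(\<Sum>S | S \<subseteq> {a..<m} \<and> card S = y. prod (selberg_weight a c m) S * (delta S)\<^sup>2)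
    = (\<Prod>j<y. fact (c + j) * bracket (2 * real m - 1 - 2 * real j) (c + 2 * j + 1)
        * fact (m + a + c - 1 + j) * bracket (2 * real a + 1) j * fact j
        / (2 * fact (m - a - 1 - j) * bracket (2 * real a + 1) (c + j + y)))"
proof -
  txt \<open>Multiplication by f i and g j turns the parameters a and c of the weight into a + i and c + j.\<close>
  define f where "f i s = (\<Prod>p<i. (real s)\<^sup>2 - (real (a + p))\<^sup>2)" for i s :: nat
  define g where "g j s = (\<Prod>p<j. (real (m + c + p))\<^sup>2 - (real s)\<^sup>2)" for j s :: nat
  let ?\<S> = "{S. S \<subseteq> {a..<m} \<and> card S = y}"
  have fin: "finite S" if "S \<in> ?\<S>" for S using that finite_subset by auto
  have f: "dt y (\<lambda>i j. f j (enum S i)) = delta S" if "S \<in> ?\<S>" for S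
    using dt_even_vandermonde[of S y "\<lambda>_. 1" "\<lambda>_. 1" "\<lambda>p. (real (a + p))\<^sup>2"] fin[OF that] that
    by (simp add: f_def)
  have g: "dt y (\<lambda>i j. g j (enum S i)) = (\<Prod>j<y. (- 1) ^ j) * delta S" if "S \<in> ?\<S>" for S
    using dt_even_vandermonde[of S y "\<lambda>_. 1" "\<lambda>_. - 1" "\<lambda>p. (real (m + c + p))\<^sup>2"] fin[OF that] that
    by (simp add: g_def)
  define A where "A i = bracket (2 * real a + 1) i / fact (m - a - 1 - i)" for i
  define B where "B j = fact (c + j) / 2 * bracket (2 * real m - 1) (Suc (c + j))" for j
  have entry: "(\<Sum>s=a..<m. selberg_weight a c m s * f i s * g j s)
      = A i * (B j * (fact (m + a + c - 1 + i + j) / bracket (2 * real a + 1) (Suc c + i + j)))"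
    if "i < y" "j < y" for i j
  proof -
    have m: "m > 0" "a + i < m" using that by (auto simp: m_def)
    have "selberg_weight a c m s * f i s * g j s = selberg_weight (a + i) (c + j) m s" for s
    proof -
      have "(\<Prod>p<a + i. (real s)\<^sup>2 - (real p)\<^sup>2) = (\<Prod>p<a. (real s)\<^sup>2 - (real p)\<^sup>2) * f i s"
        unfolding f_def by (induction i) (simp_all add: mult.assoc)
      moreover have "(\<Prod>p=m..<m + (c + j). (real p)\<^sup>2 - (real s)\<^sup>2) = (\<Prod>p=m..<m + c. (real p)\<^sup>2 - (real s)\<^sup>2) * g j s"
        unfolding g_def by (induction j) (simp_all add: mult.assoc add.assoc[symmetric])
      ultimately show ?thesis by (simp add: selberg_weight_def mult_ac)
    qed
    then have "(\<Sum>s=a..<m. selberg_weight a c m s * f i s * g j s) = (\<Sum>s=a..<m. selberg_weight (a + i) (c + j) m s)" by simp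
    also have "\<dots> = (\<Sum>s=a+i..<m. selberg_weight (a + i) (c + j) m s)"
    proof (rule sum.mono_neutral_right)
      show "\<forall>s\<in>{a..<m} - {a + i..<m}. selberg_weight (a + i) (c + j) m s = 0"
        by (auto simp: selberg_weight_def intro!: prod_zero)
    qed auto
    also have "\<dots> = fact (c + j) / 2 * pochhammer (real m - real (a + i)) (2 * (a + i) + (c + j))
        * bracket (2 * real m - 1) (Suc (c + j)) / bracket (2 * real (a + i) + 1) (Suc (c + j))"
      using m by (intro sum_selberg_weight) auto
    \<comment> \<open>The rising factorial ends at m + a + c - 1 + i + j whatever its start, so
      apart from row factors only i + j enters; this leads to the determinant of
      \<open>dt_fact_bracket\<close>.\<close>
    also have "pochhammer (real m - real (a + i)) (2 * (a + i) + (c + j))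
        = fact (m + a + c - 1 + i + j) / fact (m - a - 1 - i)"
    proof -
      have "m + a + c - 1 + i + j = (m - a - 1 - i) + (2 * (a + i) + (c + j))" using m by simp
      then have f: "fact (m + a + c - 1 + i + j)
          = fact (m - a - 1 - i) * pochhammer (1 + real (m - a - 1 - i)) (2 * (a + i) + (c + j))"
        unfolding pochhammer_fact by (metis pochhammer_product')
      have e: "1 + real (m - a - 1 - i) = real m - real (a + i)" using m by (simp add: of_nat_diff)
      show ?thesis unfolding f e by simp
    qed
    also have "bracket (2 * real (a + i) + 1) (Suc (c + j))
        = bracket (2 * real a + 1) (Suc c + i + j) / bracket (2 * real a + 1) i"
      using bracket_add[of "2 * real a + 1" i "Suc (c + j)"] bracket_pos[of "2 * real a + 1" i]
      by (simp add: field_simps)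
    finally show ?thesis by (simp add: A_def B_def mult_ac)
  qed
  \<comment> \<open>The basis \<open>g\<close> has leading coefficients (-1)^j. Their product is
    moved to the other side, where it cancels the negative factors of the determinant.\<close>
  have sign: "(\<Prod>j<y. (- 1) ^ j) * (\<Prod>j<y. (- 1) ^ j) = (1::real)"
    by (simp add: prod.distrib[symmetric] power_add[symmetric])
  have "(\<Sum>S\<in>?\<S>. prod (selberg_weight a c m) S * (delta S)\<^sup>2)
      = (\<Prod>j<y. (- 1) ^ j) * (\<Sum>S\<in>?\<S>. prod (selberg_weight a c m) S * dt y (\<lambda>i j. f j (enum S i)) * dt y (\<lambda>i j. g j (enum S i)))"
    unfolding sum_distrib_left
  proof (rule sum.cong[OF refl])
    fix S assume S: "S \<in> ?\<S>"
    have "(\<Prod>j<y. (- 1) ^ j) * (prod (selberg_weight a c m) S * dt y (\<lambda>i j. f j (enum S i)) * dt y (\<lambda>i j. g j (enum S i)))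
      = ((\<Prod>j<y. (- 1) ^ j) * (\<Prod>j<y. (- 1) ^ j)) * (prod (selberg_weight a c m) S * (delta S)\<^sup>2)"
      unfolding f[OF S] g[OF S] by (simp only: power2_eq_square mult_ac)
    then show "prod (selberg_weight a c m) S * (delta S)\<^sup>2
      = (\<Prod>j<y. (- 1) ^ j) * (prod (selberg_weight a c m) S * dt y (\<lambda>i j. f j (enum S i)) * dt y (\<lambda>i j. g j (enum S i)))"
      by (simp only: sign mult_1_left)
  qed
  also have "\<dots> = (\<Prod>j<y. (- 1) ^ j) * dt y (\<lambda>i j. \<Sum>s=a..<m. selberg_weight a c m s * f i s * g j s)"
    by (subst dt_cauchy_binet) auto
  also have "dt y (\<lambda>i j. \<Sum>s=a..<m. selberg_weight a c m s * f i s * g j s)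
      = dt y (\<lambda>i j. A i * (B j * (fact (m + a + c - 1 + i + j) / bracket (2 * real a + 1) (Suc c + i + j))))"
    by (rule dt_cong) (rule entry)
  also have "\<dots> = (\<Prod>j<y. A j) * ((\<Prod>j<y. B j) * (\<Prod>j<y. fact (m + a + c - 1 + j) / bracket (2 * real a + 1) (c + j + y)
        * (\<Prod>k<j. 2 * real a + 2 * real c + 3 - 2 * real (m + a + c) + 2 * real k) * fact j))"
  \<comment> \<open>For y > 0 the base m + a + c of the factorials is positive, as
    \<open>dt_fact_bracket\<close> requires.\<close>
  proof (cases "y = 0")
    case False
    then show ?thesis unfolding dt_rows_mult dt_cols_mult by (subst dt_fact_bracket) (auto simp: m_def)
  qed simp
  also have "(\<Prod>j<y. (- 1) ^ j) * \<dots> = (\<Prod>j<y. A j * B j * (fact (m + a + c - 1 + j) / bracket (2 * real a + 1) (c + j + y)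
        * ((- 1) ^ j * (\<Prod>k<j. 2 * real a + 2 * real c + 3 - 2 * real (m + a + c) + 2 * real k)) * fact j))"
    by (simp only: prod.distrib mult_ac)
  also have "\<dots> = (\<Prod>j<y. fact (c + j) * bracket (2 * real m - 1 - 2 * real j) (c + 2 * j + 1)
        * fact (m + a + c - 1 + j) * bracket (2 * real a + 1) j * fact j
        / (2 * fact (m - a - 1 - j) * bracket (2 * real a + 1) (c + j + y)))"
  proof (rule prod.cong[OF refl])
    fix j assume "j \<in> {..<y}"
    \<comment> \<open>Each factor equals -(2 m - 3 - 2 k), so the signs cancel; read backwards, the
      product is a \<open>bracket\<close> starting at 2 m - 1 - 2 j, which joins the one in
      \<open>B j\<close>.\<close>
    have "(- 1) ^ j * (\<Prod>k<j. 2 * real a + 2 * real c + 3 - 2 * real (m + a + c) + 2 * real k)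
        = (\<Prod>k<j. 2 * real m - 3 - 2 * real k)"
      by (induction j) (simp_all add: algebra_simps)
    also have "\<dots> = (\<Prod>k<j. 2 * real m - 3 - 2 * real (j - Suc k))"
      by (rule prod.nat_diff_reindex[symmetric])
    also have "\<dots> = bracket (2 * real m - 1 - 2 * real j) j"
      unfolding bracket_def by (rule prod.cong) (auto simp: of_nat_diff algebra_simps)
    finally have 1: "(- 1) ^ j * (\<Prod>k<j. 2 * real a + 2 * real c + 3 - 2 * real (m + a + c) + 2 * real k)
        = bracket (2 * real m - 1 - 2 * real j) j" .
    have "c + 2 * j + 1 = j + Suc (c + j)" by simp
    then have 2: "bracket (2 * real m - 1 - 2 * real j) (c + 2 * j + 1)
        = bracket (2 * real m - 1 - 2 * real j) j * bracket (2 * real m - 1) (Suc (c + j))"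
      by (simp only: bracket_add) simp
    show "A j * B j * (fact (m + a + c - 1 + j) / bracket (2 * real a + 1) (c + j + y)
        * ((- 1) ^ j * (\<Prod>k<j. 2 * real a + 2 * real c + 3 - 2 * real (m + a + c) + 2 * real k)) * fact j)
      = fact (c + j) * bracket (2 * real m - 1 - 2 * real j) (c + 2 * j + 1)
        * fact (m + a + c - 1 + j) * bracket (2 * real a + 1) j * fact j
        / (2 * fact (m - a - 1 - j) * bracket (2 * real a + 1) (c + j + y))"
      unfolding 1 2 A_def B_def by (simp add: mult_ac)
  qed
  finally show ?thesis .
qed

section \<open>Comparison of the Selberg sum with the products \<open>T\<close>, \<open>V\<close>
  and \<open>H\<close>\<close>

lemma H_add: "H (int (n + k)) = H (int n) * (\<Prod>i<k. fact (n + i))"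
  unfolding H_def nat_int by (induction k) (simp_all add: mult.assoc)

lemma H_pos: "H n > 0"
  unfolding H_def by (intro prod_pos) auto

lemma H2_pos: "H2 n > 0"
  unfolding H2_def by (intro prod_pos) auto

lemma pochhammer_fact_quotient: "pochhammer (1 + real n) k = fact (n + k) / fact n"
  using pochhammer_product'[of "1::real" n k] by (simp add: pochhammer_fact[symmetric])

text \<open>Some factors of \<open>T\<close> and \<open>V\<close> match those of the Selberg sum
  only after the order i -> y - 1 - i; each product is reversed as needed until a single index j < y
  remains.\<close>

lemma TV_quot_eq:
  fixes x y z a b :: nat
  defines "c \<equiv> b + z" and "m \<equiv> a + x + y"
  assumes "y > 0"
  shows "TV_quot x y z a b = (\<Prod>j<y. fact (m + a + c - 1 + j) * bracket (2 * real m - 1 - 2 * real j) (c + 2 * j + 1)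
      * bracket (2 * real a + 1) j * fact j
      / (fact (m - a - 1 - j) * fact (2 * a + c + y - 1 + j) * bracket (2 * real a + 1) (c + j + y)))"
proof -
  define n where "n = 2 * a + c + y - 1"
  define P where "P j = fact (x + n + j) * bracket (2 * real m - 1 - 2 * real j) (c + 2 * j + 1)
      / (fact (n + j) * bracket (2 * real a + 1) (c + j + y))" for j
  \<comment> \<open>Used with k = x for the numerator and with k = 0 for the denominator.\<close>
  have t: "T (real k + 1) (2 * int a + int b + 2 * int y + int z - 2) y
      = (\<Prod>i<y. fact (k + n + (y - Suc i)) / fact (k + i))" for k
    unfolding T_def
  proof (rule prod.cong[OF refl])
    fix i assume "i \<in> {..<y}"
    then have 1: "nat (2 * int a + int b + 2 * int y + int z - 2 - 2 * int i) = n + (y - Suc i) - i"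
      and 2: "k + n + (y - Suc i) = (k + i) + (n + (y - Suc i) - i)"
      unfolding n_def c_def by auto
    show "pochhammer (real k + 1 + real i) (nat (2 * int a + int b + 2 * int y + int z - 2 - 2 * int i))
        = fact (k + n + (y - Suc i)) / fact (k + i)"
      unfolding 1 2 using pochhammer_fact_quotient[of "k + i" "n + (y - Suc i) - i"] by (simp add: add_ac)
  qed
  have v1: "V (2 * real x + 2 * real a + 1) (int b + 2 * int y + int z - 1) y
      = (\<Prod>i<y. bracket (2 * real m - 1 - 2 * real (y - Suc i)) (c + 2 * (y - Suc i) + 1))"
    unfolding V_def
  proof (rule prod.cong[OF refl])
    fix i assume "i \<in> {..<y}"
    then have 1: "nat (int b + 2 * int y + int z - 1 - 2 * int i) = c + 2 * (y - Suc i) + 1"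
      and 2: "2 * real x + 2 * real a + 1 + 2 * real i = 2 * real m - 1 - 2 * real (y - Suc i)"
      unfolding c_def m_def by (auto simp: of_nat_diff)
    show "bracket (2 * real x + 2 * real a + 1 + 2 * real i) (nat (int b + 2 * int y + int z - 1 - 2 * int i))
        = bracket (2 * real m - 1 - 2 * real (y - Suc i)) (c + 2 * (y - Suc i) + 1)"
      unfolding 1 2 ..
  qed
  have v2: "V (2 * real a + 1) (int b + 2 * int y + int z - 1) y
      = (\<Prod>i<y. bracket (2 * real a + 1) (c + (y - Suc i) + y) / bracket (2 * real a + 1) i)"
    unfolding V_def
  proof (rule prod.cong[OF refl])
    fix i assume "i \<in> {..<y}"
    then have 1: "nat (int b + 2 * int y + int z - 1 - 2 * int i) = c + 2 * (y - Suc i) + 1"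
      and 2: "c + (y - Suc i) + y = i + (c + 2 * (y - Suc i) + 1)"
      unfolding c_def by auto
    show "bracket (2 * real a + 1 + 2 * real i) (nat (int b + 2 * int y + int z - 1 - 2 * int i))
        = bracket (2 * real a + 1) (c + (y - Suc i) + y) / bracket (2 * real a + 1) i"
      unfolding 1 2 bracket_add using bracket_pos[of "2 * real a + 1" i] by simp
  qed
  have "TV_quot x y z a b = (\<Prod>i<y. P (y - Suc i) * (bracket (2 * real a + 1) i * fact i / fact (x + i)))"
    unfolding TV_quot_def t v1 v2 t[of 0, simplified] P_def
    by (simp only: prod.distrib[symmetric] prod_dividef[symmetric])
      (intro prod.cong refl, simp add: mult_ac)
  also have "\<dots> = (\<Prod>i<y. P (y - Suc i)) * (\<Prod>i<y. bracket (2 * real a + 1) i * fact i) / (\<Prod>i<y. fact (x + i))"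
    by (simp only: prod.distrib prod_dividef times_divide_eq_right)
  also have "(\<Prod>i<y. P (y - Suc i)) = (\<Prod>j<y. P j)"
    by (rule prod.nat_diff_reindex)
  also have "(\<Prod>i<y. fact (x + i) :: real) = (\<Prod>j<y. fact (m - a - 1 - j))"
    using prod.nat_diff_reindex[of "\<lambda>i. fact (x + i) :: real" y]
    by (auto simp: m_def intro!: prod.cong)
  finally have "TV_quot x y z a b
      = (\<Prod>j<y. P j * (bracket (2 * real a + 1) j * fact j) / fact (m - a - 1 - j))"
    by (simp only: prod.distrib prod_dividef)
  moreover have idx: "x + n + j = m + a + c - 1 + j" for j
    using assms(3) by (simp add: n_def m_def)
  ultimately show ?thesis
    unfolding P_def idx n_def[symmetric] by (simp only: mult_ac times_divide_eq_left times_divide_eq_right divide_divide_eq_left)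
qed

text \<open>The quotient of the \<open>H\<close> values supplies just the factorials (2 a + c + y -
  1 + j)! and (c + j)! with c = b + z, after which the products agree factor by factor. The case y =
  0 is separate, as then the argument of \<open>H\<close> may be -1.\<close>

lemma selberg_sum_TV:
  fixes x y z a b :: nat
  defines "m \<equiv> a + x + y"
  shows "(\<Sum>S | S \<subseteq> {a..<m} \<and> card S = y. prod (selberg_weight a (b + z) m) S * (delta S)\<^sup>2)
    = (1/2) ^ y * (H (2 * int a + int b + 2 * int y + int z - 1) * H (int b + int y + int z)
         / (H (2 * int a + int b + int y + int z - 1) * H (int b + int z))) * TV_quot x y z a b"
proof (cases "y = 0")
  case True
  then show ?thesis
    unfolding m_def selberg_sum using H_pos[of "2 * int a + int b + int z - 1"] H_pos[of "int b + int z"]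
    by (simp add: TV_quot_def T_def V_def)
next
  case False
  define c where "c = b + z"
  define n where "n = 2 * a + c + y - 1"
  have "2 * int a + int b + 2 * int y + int z - 1 = int (n + y)"
    "2 * int a + int b + int y + int z - 1 = int n"
    "int b + int y + int z = int (c + y)" "int b + int z = int c"
    using False by (auto simp: n_def c_def)
  then have h: "H (2 * int a + int b + 2 * int y + int z - 1) * H (int b + int y + int z)
         / (H (2 * int a + int b + int y + int z - 1) * H (int b + int z))
      = (\<Prod>j<y. fact (n + j) * fact (c + j))"
    using H_pos[of "int n"] H_pos[of "int c"] by (simp only: H_add) (simp add: prod.distrib)
  have half: "(1/2) ^ y = (\<Prod>j<y. 1/2 :: real)" by simp
  show ?thesis
    unfolding m_def selberg_sum h half TV_quot_eq[OF False[unfolded neq0_conv]] prod.distrib[symmetric]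
    by (intro prod.cong refl) (simp add: n_def c_def mult_ac)
qed

section \<open>Weighted tilings of finite sets\<close>

text \<open>The predicate for tiles is a parameter, so the same facts serve edges of a path,
  lozenges in integer coordinates and lozenges in the plane.\<close>

definition tilesets :: "('a set \<Rightarrow> bool) \<Rightarrow> 'a set \<Rightarrow> 'a set set set" where
  "tilesets L R = {P. partition_on R P \<and> (\<forall>l\<in>P. L l)}"

definition tiling_sum :: "('a set \<Rightarrow> bool) \<Rightarrow> ('a set \<Rightarrow> real) \<Rightarrow> 'a set \<Rightarrow> real" where
  "tiling_sum L w R = (\<Sum>P\<in>tilesets L R. \<Prod>l\<in>P. w l)"

lemma M_eq_tiling_sum: "M w R = tiling_sum is_lozenge w R"
  by (simp add: M_def tiling_sum_def tilings_def tilesets_def)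

lemma tilesetsD:
  assumes "P \<in> tilesets L R"
  shows "\<Union>P = R" "disjoint P" "{} \<notin> P" "\<And>l. l \<in> P \<Longrightarrow> L l" "\<And>l. l \<in> P \<Longrightarrow> l \<subseteq> R"
  using assms by (auto simp: tilesets_def partition_on_def)

lemma tilesetsI:
  "\<Union>P = R \<Longrightarrow> disjoint P \<Longrightarrow> {} \<notin> P \<Longrightarrow> (\<And>l. l \<in> P \<Longrightarrow> L l) \<Longrightarrow> P \<in> tilesets L R"
  by (auto simp: tilesets_def partition_on_def)

lemma finite_tilesets: "finite R \<Longrightarrow> finite (tilesets L R)"
  by (rule finite_subset[of _ "Pow (Pow R)"]) (auto dest: tilesetsD)

lemma finite_tileset: "finite R \<Longrightarrow> P \<in> tilesets L R \<Longrightarrow> finite P"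
  by (rule finite_subset[of _ "Pow R"]) (auto dest: tilesetsD)

lemma tilesets_empty: "tilesets L {} = {{}}"
  by (auto simp: tilesets_def partition_on_def)

lemma tiling_sum_empty [simp]: "tiling_sum L w {} = 1"
  by (simp add: tiling_sum_def tilesets_empty)

definition crossings :: "('a set \<Rightarrow> bool) \<Rightarrow> 'a set \<Rightarrow> 'a set \<Rightarrow> 'a set set set" where
  "crossings L A B = {C. disjoint C \<and> (\<forall>l\<in>C. L l \<and> l \<subseteq> A \<union> B \<and> l \<inter> A \<noteq> {} \<and> l \<inter> B \<noteq> {})}"

text \<open>A tiling is recorded as the triple of its tiles meeting both sides, its tiles inside A
  and its tiles inside B.\<close>

lemma tiling_sum_split:
  assumes "finite A" "finite B" "A \<inter> B = {}"
  shows "tiling_sum L w (A \<union> B) = (\<Sum>C\<in>crossings L A B. prod w C * (tiling_sum L w (A - \<Union>C) * tiling_sum L w (B - \<Union>C)))"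
proof -
  let ?S = "SIGMA C:crossings L A B. tilesets L (A - \<Union>C) \<times> tilesets L (B - \<Union>C)"
  have fin: "finite (crossings L A B)"
    by (rule finite_subset[of _ "Pow (Pow (A \<union> B))"]) (use assms in \<open>auto simp: crossings_def\<close>)
  have "(\<Sum>C\<in>crossings L A B. prod w C * (tiling_sum L w (A - \<Union>C) * tiling_sum L w (B - \<Union>C)))
      = (\<Sum>(C, P, Q)\<in>?S. prod w C * (prod w P * prod w Q))"
  proof -
    have "prod w C * (tiling_sum L w (A - \<Union>C) * tiling_sum L w (B - \<Union>C))
        = (\<Sum>(P, Q)\<in>tilesets L (A - \<Union>C) \<times> tilesets L (B - \<Union>C). prod w C * (prod w P * prod w Q))" for C
    proof -
      have "tiling_sum L w (A - \<Union>C) * tiling_sum L w (B - \<Union>C)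
          = (\<Sum>(P, Q)\<in>tilesets L (A - \<Union>C) \<times> tilesets L (B - \<Union>C). prod w P * prod w Q)"
        unfolding tiling_sum_def by (simp only: sum_product sum.cartesian_product)
      then show ?thesis by (simp add: sum_distrib_left case_prod_beta)
    qed
    then show ?thesis
      using fin finite_tilesets[of "A - \<Union>_" L] finite_tilesets[of "B - \<Union>_" L] assms
      by (simp add: sum.Sigma)
  qed
  also have "\<dots> = tiling_sum L w (A \<union> B)"
    unfolding tiling_sum_def
  proof (rule sum.reindex_bij_witness[where
        j = "\<lambda>(C, P, Q). C \<union> P \<union> Q" and
        i = "\<lambda>P. ({l \<in> P. l \<inter> A \<noteq> {} \<and> l \<inter> B \<noteq> {}}, {l \<in> P. l \<subseteq> A}, {l \<in> P. l \<subseteq> B})"])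
    fix x assume "x \<in> ?S"
    then obtain C P Q where x: "x = (C, P, Q)" and C: "C \<in> crossings L A B"
      and P: "P \<in> tilesets L (A - \<Union>C)" and Q: "Q \<in> tilesets L (B - \<Union>C)" by auto
    note P' = tilesetsD[OF P] and Q' = tilesetsD[OF Q]
    have Cd: "disjoint C" "\<And>l. l \<in> C \<Longrightarrow> L l \<and> l \<subseteq> A \<union> B \<and> l \<inter> A \<noteq> {} \<and> l \<inter> B \<noteq> {}"
      using C by (auto simp: crossings_def)
    have PA: "l \<subseteq> A \<and> l \<noteq> {} \<and> l \<inter> \<Union>C = {}" if "l \<in> P" for l using P'(3) P'(5)[OF that] that by auto
    have QB: "l \<subseteq> B \<and> l \<noteq> {} \<and> l \<inter> \<Union>C = {}" if "l \<in> Q" for l using Q'(3) Q'(5)[OF that] that by auto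
    have "C = {l \<in> C \<union> P \<union> Q. l \<inter> A \<noteq> {} \<and> l \<inter> B \<noteq> {}}"
      using Cd(2) PA QB assms(3) by blast
    moreover have "P = {l \<in> C \<union> P \<union> Q. l \<subseteq> A}" using Cd(2) PA QB assms(3) by blast
    moreover have "Q = {l \<in> C \<union> P \<union> Q. l \<subseteq> B}" using Cd(2) PA QB assms(3) by blast
    ultimately show "(\<lambda>P. ({l \<in> P. l \<inter> A \<noteq> {} \<and> l \<inter> B \<noteq> {}}, {l \<in> P. l \<subseteq> A}, {l \<in> P. l \<subseteq> B}))
        ((\<lambda>(C, P, Q). C \<union> P \<union> Q) x) = x" unfolding x by simp
    show "(\<lambda>(C, P, Q). C \<union> P \<union> Q) x \<in> tilesets L (A \<union> B)"
      unfolding x prod.case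
    proof (rule tilesetsI)
      have "\<Union>C \<subseteq> A \<union> B" using Cd(2) by blast
      then show "\<Union>(C \<union> P \<union> Q) = A \<union> B" using P'(1) Q'(1) by auto
      show "disjoint (C \<union> P \<union> Q)"
      proof (rule disjoint_union, rule disjoint_union)
        show "\<Union>C \<inter> \<Union>P = {}" using PA by blast
        show "\<Union>(C \<union> P) \<inter> \<Union>Q = {}" using PA QB assms(3) by blast
      qed (use Cd(1) P'(2) Q'(2) in auto)
      show "{} \<notin> C \<union> P \<union> Q" using Cd(2) P'(3) Q'(3) by auto
      show "L l" if "l \<in> C \<union> P \<union> Q" for l using that Cd(2) P'(4) Q'(4) by auto
    qed
    have fins: "finite C" "finite P" "finite Q"
      using finite_tileset[OF _ P] finite_tileset[OF _ Q] assms(1,2) Cd(2)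
      by (auto intro: finite_subset[of C "Pow (A \<union> B)"])
    have "C \<inter> P = {}" "(C \<union> P) \<inter> Q = {}" using Cd(2) PA QB assms(3) by blast+
    then show "prod w ((\<lambda>(C, P, Q). C \<union> P \<union> Q) x) = (case x of (C, P, Q) \<Rightarrow> prod w C * (prod w P * prod w Q))"
      using fins by (simp add: x prod.union_disjoint mult.assoc)
  next
    fix P assume P: "P \<in> tilesets L (A \<union> B)"
    note P' = tilesetsD[OF P]
    let ?C = "{l \<in> P. l \<inter> A \<noteq> {} \<and> l \<inter> B \<noteq> {}}"
    have cases: "l \<in> ?C \<or> l \<subseteq> A \<or> l \<subseteq> B" if "l \<in> P" for l using P'(5)[OF that] that by blast
    show "(\<lambda>(C, P, Q). C \<union> P \<union> Q) (?C, {l \<in> P. l \<subseteq> A}, {l \<in> P. l \<subseteq> B}) = P"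
      using cases by auto
    have C: "?C \<in> crossings L A B"
      using P'(2,4,5) unfolding crossings_def disjoint_def by auto
    have disj: "l \<inter> l' = {}" if "l \<in> P" "l' \<in> P" "l \<noteq> l'" for l l'
      using P'(2) that unfolding disjoint_def by auto
    have part: "{l \<in> P. l \<subseteq> E} \<in> tilesets L (E - \<Union>?C)" if E: "E = A \<or> E = B" for E
    proof (rule tilesetsI)
      show "\<Union>{l \<in> P. l \<subseteq> E} = E - \<Union>?C"
      proof (intro equalityI subsetI)
        fix t assume "t \<in> \<Union>{l \<in> P. l \<subseteq> E}"
        then obtain l where l: "l \<in> P" "l \<subseteq> E" "t \<in> l" by auto
        have "t \<notin> l'" if "l' \<in> ?C" for l'
        proof
          assume "t \<in> l'"
          then have "l' = l" using disj[of l l'] that l by auto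
          then show False using that l(2) E assms(3) by blast
        qed
        then show "t \<in> E - \<Union>?C" using l by auto
      next
        fix t assume t: "t \<in> E - \<Union>?C"
        then have "t \<in> \<Union>P" using E unfolding P'(1) by auto
        then obtain l where l: "l \<in> P" "t \<in> l" by blast
        have "l \<notin> ?C" using t l(2) by blast
        then have "l \<subseteq> A \<or> l \<subseteq> B" using cases[OF l(1)] by blast
        moreover have "t \<notin> A \<inter> B" using assms(3) by simp
        ultimately have "l \<subseteq> E" using E t l(2) by auto
        then show "t \<in> \<Union>{l \<in> P. l \<subseteq> E}" using l by auto
      qed
      show "disjoint {l \<in> P. l \<subseteq> E}" using P'(2) by (auto simp: disjoint_def)
    qed (use P'(3,4) in auto)
    show "(?C, {l \<in> P. l \<subseteq> A}, {l \<in> P. l \<subseteq> B}) \<in> ?S"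
      by (intro SigmaI C part) auto
  qed
  finally show ?thesis by simp
qed

lemma tiling_sum_forced:
  assumes "finite R" "\<Union>F \<subseteq> R" "\<And>P. P \<in> tilesets L R \<Longrightarrow> F \<subseteq> P"
    and "disjoint F" "\<And>l. l \<in> F \<Longrightarrow> L l \<and> l \<noteq> {}"
  shows "tiling_sum L w R = prod w F * tiling_sum L w (R - \<Union>F)"
proof -
  have "finite F"
    by (rule finite_subset[of _ "Pow R"]) (use assms(1,2) in auto)
  have "(\<Sum>P\<in>tilesets L (R - \<Union>F). prod w F * prod w P) = tiling_sum L w R"
    unfolding tiling_sum_def
  proof (rule sum.reindex_bij_witness[where j = "\<lambda>P. P \<union> F" and i = "\<lambda>P. P - F"])
    fix P assume P: "P \<in> tilesets L (R - \<Union>F)"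
    note P' = tilesetsD[OF P]
    have dis: "l \<inter> l' = {}" if "l \<in> P" "l' \<in> F" for l l' using P'(5)[OF that(1)] that(2) by blast
    then have PF: "P \<inter> F = {}" using assms(5) by fastforce
    then show "P \<union> F - F = P" by auto
    show "P \<union> F \<in> tilesets L R"
    proof (rule tilesetsI)
      show "\<Union>(P \<union> F) = R" using P'(1) assms(2) by auto
      show "disjoint (P \<union> F)" using P'(2) assms(4) dis unfolding disjoint_def by blast
      show "{} \<notin> P \<union> F" using P'(3) assms(5) by auto
      show "L l" if "l \<in> P \<union> F" for l using that P'(4) assms(5) by auto
    qed
    show "prod w (P \<union> F) = prod w F * prod w P"
      using PF \<open>finite F\<close> finite_tileset[OF _ P] assms(1) by (simp add: prod.union_disjoint)
  next
    fix P assume P: "P \<in> tilesets L R"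
    note P' = tilesetsD[OF P] and F = assms(3)[OF P]
    show "P - F \<union> F = P" using F by auto
    have dis: "l \<inter> l' = {}" if "l \<in> P - F" "l' \<in> F" for l l'
    proof -
      have "l \<in> P" "l' \<in> P" "l \<noteq> l'" using that F by auto
      then show ?thesis by (rule disjointD[OF P'(2)])
    qed
    show "P - F \<in> tilesets L (R - \<Union>F)"
    proof (rule tilesetsI)
      show "\<Union>(P - F) = R - \<Union>F"
      proof (intro equalityI subsetI)
        fix t assume "t \<in> \<Union>(P - F)"
        then obtain l where l: "l \<in> P - F" "t \<in> l" by blast
        then show "t \<in> R - \<Union>F" using P'(5)[of l] dis[OF l(1)] by blast
      next
        fix t assume "t \<in> R - \<Union>F"
        then show "t \<in> \<Union>(P - F)" using P'(1) by blast
      qed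
      show "disjoint (P - F)" using P'(2) by (auto simp: disjoint_def)
    qed (use P'(3,4) in auto)
  qed
  then show ?thesis by (simp add: tiling_sum_def sum_distrib_left)
qed

lemma tiling_sum_image:
  assumes inj: "inj_on \<phi> R"
    and L: "\<And>l. l \<subseteq> R \<Longrightarrow> L' (\<phi> ` l) \<longleftrightarrow> L l"
    and w: "\<And>l. l \<subseteq> R \<Longrightarrow> L l \<Longrightarrow> w' (\<phi> ` l) = w l"
  shows "tiling_sum L' w' (\<phi> ` R) = tiling_sum L w R"
proof -
  let ?\<psi> = "inv_into R \<phi>"
  have inv: "?\<psi> ` \<phi> ` l = l" if "l \<subseteq> R" for l
    using inv_into_image_cancel[OF inj that] .
  have inv': "\<phi> ` ?\<psi> ` l = l" if "l \<subseteq> \<phi> ` R" for l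
    using image_inv_into_cancel[OF refl that] .
  have "tiling_sum L w R = tiling_sum L' w' (\<phi> ` R)"
    unfolding tiling_sum_def
  proof (rule sum.reindex_bij_witness[where j = "\<lambda>P. (`) \<phi> ` P" and i = "\<lambda>P. (`) ?\<psi> ` P"])
    fix P assume P: "P \<in> tilesets L R"
    note P' = tilesetsD[OF P]
    show "(`) ?\<psi> ` (`) \<phi> ` P = P"
      using inv[OF P'(5)] by (subst image_image) simp
    show "(`) \<phi> ` P \<in> tilesets L' (\<phi> ` R)"
    proof -
      have "(`) \<phi> ` P - {{}} = (`) \<phi> ` P" using P'(3) by auto
      then have "partition_on (\<phi> ` R) ((`) \<phi> ` P)"
        using partition_on_inj_image[of R P \<phi>] P inj by (simp add: tilesets_def)
      then show ?thesis using L P'(4,5) by (auto simp: tilesets_def)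
    qed
    have "inj_on ((`) \<phi>) P"
      by (rule inj_onI) (use inv P'(5) in metis)
    then show "prod w' ((`) \<phi> ` P) = prod w P"
      using w P'(4,5) by (simp add: prod.reindex)
  next
    fix Q assume Q: "Q \<in> tilesets L' (\<phi> ` R)"
    note Q' = tilesetsD[OF Q]
    show "(`) \<phi> ` (`) ?\<psi> ` Q = Q"
      using inv'[OF Q'(5)] by (subst image_image) simp
    have sub: "?\<psi> ` l \<subseteq> R" if "l \<in> Q" for l
      using Q'(5)[OF that] by (auto intro: inv_into_into)
    have "(`) ?\<psi> ` Q - {{}} = (`) ?\<psi> ` Q" using Q'(3) by auto
    then have "partition_on (?\<psi> ` \<phi> ` R) ((`) ?\<psi> ` Q)"
      using partition_on_inj_image[of "\<phi> ` R" Q ?\<psi>] Q by (simp add: tilesets_def inj_on_inv_into)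
    moreover have "L (?\<psi> ` l)" if "l \<in> Q" for l
      using L[OF sub[OF that]] inv'[OF Q'(5)[OF that]] Q'(4)[OF that] by simp
    ultimately show "(`) ?\<psi> ` Q \<in> tilesets L R"
      by (auto simp: tilesets_def inv)
  qed
  then show ?thesis by simp
qed

lemma tiling_sum_no_tiling: "(\<And>P. P \<notin> tilesets L R) \<Longrightarrow> tiling_sum L w R = 0"
  unfolding tiling_sum_def by (rule sum.neutral) blast

section \<open>Coverings of part of a path by disjoint edges\<close>

definition path_edge :: "nat set \<Rightarrow> bool" where
  "path_edge l \<longleftrightarrow> (\<exists>p. l = {p, Suc p})"

text \<open>A path with gaps has at most one tiling, and it has one iff every run between gaps has
  even length. Cumulative parities at the gaps express this; n always counts as a gap and closes the
  last run.\<close>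

lemma tiling_sum_path:
  "R \<subseteq> {..<n} \<Longrightarrow> tiling_sum path_edge (\<lambda>_. 1) R
    = (if \<forall>r\<in>{..n} - R. even (card (R \<inter> {..<r})) then 1 else 0)"
proof (induction n arbitrary: R rule: less_induct)
  case (less n)
  show ?case
  proof (cases n)
    case 0
    then show ?thesis using less.prems by simp
  next
    case (Suc k)
    show ?thesis
    proof (cases "k \<in> R")
      case False
      then have R: "R \<subseteq> {..<k}" using less.prems Suc by (force simp: less_Suc_eq)
      then have "R \<inter> {..<Suc k} = R \<inter> {..<k}" by auto
      then have "(\<forall>r\<in>{..n} - R. even (card (R \<inter> {..<r}))) \<longleftrightarrow> (\<forall>r\<in>{..k} - R. even (card (R \<inter> {..<r})))"
        using False R Suc by (auto simp: le_Suc_eq)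
      then show ?thesis using less.IH[of k R] R Suc by simp
    next
      case True
      \<comment> \<open>The last vertex k can only be matched with k - 1; this pair is forced and
        the induction continues below it.\<close>
      have neighbour: "\<exists>j. k = Suc j \<and> j \<in> R \<and> {j, k} \<in> P" if P: "P \<in> tilesets path_edge R" for P
      proof -
        obtain l where l: "l \<in> P" "k \<in> l" using tilesetsD(1)[OF P] True by blast
        then obtain p where p: "l = {p, Suc p}" "p \<in> R" "Suc p \<in> R"
          using tilesetsD(4,5)[OF P l(1)] by (auto simp: path_edge_def)
        then have "k = Suc p" using l(2) less.prems Suc by auto
        then show ?thesis using p l by auto
      qed
      show ?thesis
      proof (cases "\<exists>j. k = Suc j \<and> j \<in> R")
        case False
        then have "tiling_sum path_edge (\<lambda>_. 1) R = 0" using neighbour by (intro tiling_sum_no_tiling) blast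
        moreover have "\<not> (\<forall>r\<in>{..n} - R. even (card (R \<inter> {..<r})))"
        proof
          assume ev: "\<forall>r\<in>{..n} - R. even (card (R \<inter> {..<r}))"
          have n: "even (card (R \<inter> {..<n}))" using ev less.prems by auto
          \<comment> \<open>Here k is a run of length one, so the cumulative counts at the gaps k -
            1 and n differ by 1 and cannot both be even; for k = 0 the count at n is 1.\<close>
          have Rn: "R \<inter> {..<n} = insert k (R \<inter> {..<k - 1})"
            using True False Suc by (cases k) (auto simp: less_Suc_eq)
          have "even (card (R \<inter> {..<k - 1}))"
            using ev False Suc by (cases k) auto
          then show False using n unfolding Rn by (subst (asm) card_insert_disjoint) auto
        qed
        ultimately show ?thesis by simp
      next
        case True
        then obtain j where j: "k = Suc j" "j \<in> R" by blast
        let ?R = "R - {j, k}"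
        have "tiling_sum path_edge (\<lambda>_. 1) R = prod (\<lambda>_. 1) {{j, k}} * tiling_sum path_edge (\<lambda>_. 1) (R - \<Union>{{j, k}})"
        proof (rule tiling_sum_forced)
          show "finite R" using less.prems finite_subset by blast
          show "{{j, k}} \<subseteq> P" if "P \<in> tilesets path_edge R" for P
            using neighbour[OF that] j by auto
        qed (use j \<open>k \<in> R\<close> in \<open>auto simp: path_edge_def\<close>)
        moreover have R: "?R \<subseteq> {..<j}" using less.prems Suc j by (force simp: less_Suc_eq)
        moreover have "(\<forall>r\<in>{..j} - ?R. even (card (?R \<inter> {..<r}))) \<longleftrightarrow> (\<forall>r\<in>{..n} - R. even (card (R \<inter> {..<r})))"
        proof -
          have low: "?R \<inter> {..<r} = R \<inter> {..<r}" if "r \<le> j" for r using that j by auto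
          have "R \<inter> {..<n} = insert j (insert k (R \<inter> {..<j}))"
            using j \<open>k \<in> R\<close> Suc by (auto simp: less_Suc_eq)
          then have "even (card (R \<inter> {..<n})) \<longleftrightarrow> even (card (R \<inter> {..<j}))"
            using j by simp
          moreover have "{..j} - ?R = insert j ({..<j} - R)" "{..n} - R = insert n ({..<j} - R)"
            using j \<open>k \<in> R\<close> Suc less.prems by (auto simp: le_less less_Suc_eq)
          ultimately show ?thesis using low by auto
        qed
        ultimately show ?thesis using less.IH[of j ?R] j Suc by simp
      qed
    qed
  qed
qed

section \<open>Tilings of a trapezoid with a zigzag side\<close>

abbreviation below :: "nat set \<Rightarrow> nat \<Rightarrow> nat" where
  "below X m \<equiv> card (X \<inter> {..<m})"

lemma below_Suc: "below X (Suc m) = below X m + (if m \<in> X then 1 else 0)"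
proof -
  have "X \<inter> {..<Suc m} = (if m \<in> X then insert m (X \<inter> {..<m}) else X \<inter> {..<m})"
    by (auto simp: less_Suc_eq)
  then show ?thesis by simp
qed

lemma below_mono: "m \<le> n \<Longrightarrow> below X m \<le> below X n"
  by (intro card_mono) auto

lemma below_all: "X \<subseteq> {..<n} \<Longrightarrow> below X n = card X"
  by (simp add: Int_absorb2)

text \<open>This is the pattern p_0 <= q_0 < p_1 <= q_1 < ..., beginning with P, where q stands for
  the half-integer q + 1/2. The counting form fits the parity conditions for path tilings
  directly.\<close>

definition interlace :: "nat set \<Rightarrow> nat set \<Rightarrow> bool" where
  "interlace P Q \<longleftrightarrow> (\<forall>x\<in>P. below P x = below Q x) \<and> (\<forall>y\<in>Q. below P (Suc y) = Suc (below Q y))"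

lemma interlaceD: "interlace P Q \<Longrightarrow> x \<in> P \<Longrightarrow> below P x = below Q x"
  "interlace P Q \<Longrightarrow> y \<in> Q \<Longrightarrow> below P (Suc y) = Suc (below Q y)"
  by (auto simp: interlace_def)

text \<open>Parities suffice: moving east, the excess of P over Q starts at 0, and the two
  conditions let it only alternate between 0 and 1.\<close>

lemma interlace_parity:
  assumes "\<And>x. x \<in> P \<Longrightarrow> even (below P x + below Q x)"
    and "\<And>y. y \<in> Q \<Longrightarrow> odd (below P (Suc y) + below Q y)"
  shows "interlace P Q" and "below P m = below Q m \<or> below P m = Suc (below Q m)"
proof -
  have *: "below P m = below Q m \<or> below P m = Suc (below Q m)" for m
  proof (induction m)
    case (Suc m)
    then show ?case using assms(1)[of m] assms(2)[of m] by (auto simp: below_Suc split: if_splits)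
  qed simp
  show "below P m = below Q m \<or> below P m = Suc (below Q m)" by (rule *)
  show "interlace P Q"
    unfolding interlace_def
  proof (intro conjI ballI)
    fix x assume "x \<in> P"
    then show "below P x = below Q x" using assms(1)[of x] *[of x] by auto
  next
    fix y assume "y \<in> Q"
    then show "below P (Suc y) = Suc (below Q y)"
      using assms(2)[of y] *[of y] *[of "Suc y"] by (auto simp: below_Suc split: if_splits)
  qed
qed

lemma enum_obtain:
  assumes "finite S" "x \<in> S"
  obtains i where "i < card S" "x = enum S i"
  using bij_betw_enum[OF assms(1)] assms(2) by (auto simp: bij_betw_def)

lemma card_cell: "p \<le> q \<Longrightarrow> card (X \<inter> {p..<q}) = below X q - below X p"
proof -
  assume "p \<le> q"
  then have e: "X \<inter> {..<q} = (X \<inter> {..<p}) \<union> (X \<inter> {p..<q})" by auto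
  have "below X q = below X p + card (X \<inter> {p..<q})"
    unfolding e by (rule card_Un_disjoint) auto
  then show ?thesis by simp
qed

lemma transversalI:
  assumes "finite X" "\<And>i. i < n \<Longrightarrow> c i \<le> c (Suc i)" "\<And>i. i \<le> n \<Longrightarrow> below X (c i) = i" "card X = n"
  shows "transversal n c X"
proof -
  have "X \<inter> {..<c n} = X"
    using assms(1,4) assms(3)[of n] by (intro card_subset_eq) auto
  moreover have "X \<inter> {..<c 0} = {}" using assms(1) assms(3)[of 0] by simp
  ultimately have "X \<subseteq> {c 0..<c n}" by (auto simp: not_less[symmetric])
  then show ?thesis
    using assms(2,3) by (simp add: transversal_def card_cell)
qed

text \<open>With one more point in P, both ends of the pattern belong to P, and each point of Q has
  its own interval between neighbours in P.\<close>

lemma interlace_transversal_odd: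
  assumes "finite P" "finite Q" "card P = Suc (card Q)"
  shows "interlace P Q \<longleftrightarrow> transversal (card Q) (enum P) Q"
proof
  assume I: "interlace P Q"
  show "transversal (card Q) (enum P) Q"
  proof (rule transversalI)
    show "below Q (enum P i) = i" if "i \<le> card Q" for i
      using interlaceD(1)[OF I, of "enum P i"] enum_in[OF assms(1)] card_less_enum[OF assms(1)] that assms(3) by simp
    show "enum P i \<le> enum P (Suc i)" if "i < card Q" for i
      using enum_less[OF assms(1), of i "Suc i"] that assms(3) by simp
  qed (use assms in auto)
next
  assume tr: "transversal (card Q) (enum P) Q"
  have mono: "enum P i \<le> enum P (Suc i)" if "i < card Q" for i
    using enum_less[OF assms(1), of i "Suc i"] that assms(3) by simp
  note b = transversal_card[of "card Q" "enum P", OF mono tr]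
  show "interlace P Q"
    unfolding interlace_def
  proof (intro conjI ballI)
    fix x assume "x \<in> P"
    then obtain i where "i < card P" "x = enum P i" using enum_obtain[OF assms(1)] by metis
    then show "below P x = below Q x" using card_less_enum[OF assms(1)] b assms(3) by simp
  next
    fix y assume y: "y \<in> Q"
    then have "y \<in> {enum P 0..<enum P (card Q)}" using tr by (auto simp: transversal_def)
    then obtain i where i: "i < card Q" "y \<in> {enum P i..<enum P (Suc i)}"
      using in_some_cell[of y "enum P" "card Q"] by blast
    have "below P (enum P i) = i" "below P (enum P (Suc i)) = Suc i" "enum P i \<in> P"
      using card_less_enum[OF assms(1)] enum_in[OF assms(1)] i assms(3) by auto
    then have "Suc i \<le> below P (Suc y)" "below P (Suc y) \<le> Suc i"
      using below_mono[of "Suc (enum P i)" "Suc y" P] below_mono[of "Suc y" "enum P (Suc i)" P] i(2)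
      by (auto simp: below_Suc)
    moreover have "i \<le> below Q y" "Suc (below Q y) \<le> Suc i"
      using below_mono[of "enum P i" y Q] below_mono[of "Suc y" "enum P (Suc i)" Q] b i y
      by (auto simp: below_Suc)
    ultimately show "below P (Suc y) = Suc (below Q y)" by simp
  qed
qed

text \<open>With equally many points the pattern ends in Q, so here the cells are cut by Q and the
  westernmost one is bounded by the zigzag.\<close>

lemma interlace_transversal_even:
  assumes "finite P" "finite Q" "card P = card Q"
  shows "interlace P Q \<longleftrightarrow> transversal (card Q) (odd_cells Q) P"
proof -
  have c0: "odd_cells Q 0 = 0" and cS: "odd_cells Q (Suc i) = Suc (enum Q i)" for i
    by (simp_all add: odd_cells_def)
  have bQ: "below Q (odd_cells Q i) = i" if "i \<le> card Q" for i
    using that card_less_enum[OF assms(2)] enum_in[OF assms(2)] by (cases i) (auto simp: c0 cS below_Suc)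
  note mono = odd_cells_mono[OF assms(2)]
  show ?thesis
  proof
    assume I: "interlace P Q"
    show "transversal (card Q) (odd_cells Q) P"
    proof (rule transversalI)
      show "below P (odd_cells Q i) = i" if "i \<le> card Q" for i
      proof (cases i)
        case (Suc k)
        then show ?thesis
          using interlaceD(2)[OF I, of "enum Q k"] enum_in[OF assms(2)] card_less_enum[OF assms(2)] that by (simp add: cS)
      qed (simp add: c0)
    qed (use assms mono in auto)
  next
    assume tr: "transversal (card Q) (odd_cells Q) P"
    note b = transversal_card[of "card Q" "odd_cells Q", OF mono tr]
    show "interlace P Q"
      unfolding interlace_def
    proof (intro conjI ballI)
      fix y assume "y \<in> Q"
      then obtain i where "i < card Q" "y = enum Q i" using enum_obtain[OF assms(2)] by metis
      then show "below P (Suc y) = Suc (below Q y)"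
        using b[of "Suc i"] card_less_enum[OF assms(2)] by (simp add: cS)
    next
      fix x assume x: "x \<in> P"
      then have "x \<in> {odd_cells Q 0..<odd_cells Q (card Q)}" using tr by (auto simp: transversal_def)
      then obtain i where i: "i < card Q" "x \<in> {odd_cells Q i..<odd_cells Q (Suc i)}"
        using in_some_cell[of x "odd_cells Q" "card Q"] by blast
      have "i \<le> below P x" "Suc (below P x) \<le> Suc i"
        using below_mono[of "odd_cells Q i" x P] below_mono[of "Suc x" "odd_cells Q (Suc i)" P] b i x
        by (auto simp: below_Suc)
      moreover have "i \<le> below Q x" "below Q x \<le> i"
        using below_mono[of "odd_cells Q i" x Q] below_mono[of x "enum Q i" Q] bQ i card_less_enum[OF assms(2)]
        by (auto simp: cS)
      ultimately show "below P x = below Q x" by simp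
    qed
  qed
qed

text \<open>A strip of triangles is a path, along which the two orientations alternate.  Here P and Q are
  the sets of removed vertices of the two kinds.\<close>

definition path_set :: "nat \<Rightarrow> nat set \<Rightarrow> nat set \<Rightarrow> nat set" where
  "path_set n P Q = {p. p < n \<and> (if even p then p div 2 \<notin> P else p div 2 \<notin> Q)}"

lemma card_path_set:
  assumes "r \<le> n"
  shows "card (path_set n P Q \<inter> {..<r}) + below P ((r + 1) div 2) + below Q (r div 2) = r"
  using assms
proof (induction r)
  case (Suc r)
  have "path_set n P Q \<inter> {..<Suc r}
      = (if r \<in> path_set n P Q then insert r (path_set n P Q \<inter> {..<r}) else path_set n P Q \<inter> {..<r})"
    by (auto simp: less_Suc_eq)
  then have "card (path_set n P Q \<inter> {..<Suc r})
      = card (path_set n P Q \<inter> {..<r}) + (if r \<in> path_set n P Q then 1 else 0)" by simp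
  then show ?case
    using Suc by (cases "even r") (auto elim!: evenE oddE simp: below_Suc path_set_def split: if_splits)
qed simp

text \<open>The gaps are the vertices 2 x and 2 y + 1 for removed x and y, together with the end n.
  Among the first 2 x vertices, 2 x minus the removed ones remain, so the run condition becomes the
  parity condition for interlacing, and the gap n fixes the difference of the cardinalities.\<close>

lemma path_condition:
  assumes "P \<subseteq> {..<(n + 1) div 2}" "Q \<subseteq> {..<n div 2}"
  shows "(\<forall>r\<in>{..n} - path_set n P Q. even (card (path_set n P Q \<inter> {..<r})))
    \<longleftrightarrow> interlace P Q \<and> card P = card Q + n mod 2"
proof -
  have e: "even (card (path_set n P Q \<inter> {..<2 * x})) \<longleftrightarrow> even (below P x + below Q x)" if "2 * x \<le> n" for x
    using card_path_set[OF that, of P Q] by simp presburger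
  have o: "even (card (path_set n P Q \<inter> {..<2 * y + 1})) \<longleftrightarrow> odd (below P (Suc y) + below Q y)" if "2 * y + 1 \<le> n" for y
    using card_path_set[OF that, of P Q] by simp presburger
  have eq: "{..n} - path_set n P Q = insert n ((\<lambda>x. 2 * x) ` P \<union> (\<lambda>y. 2 * y + 1) ` Q)"
  proof (intro equalityI subsetI)
    fix r assume r: "r \<in> {..n} - path_set n P Q"
    then show "r \<in> insert n ((\<lambda>x. 2 * x) ` P \<union> (\<lambda>y. 2 * y + 1) ` Q)"
      by (cases "even r") (auto elim!: evenE oddE simp: path_set_def image_iff split: if_splits)
  next
    fix r assume "r \<in> insert n ((\<lambda>x. 2 * x) ` P \<union> (\<lambda>y. 2 * y + 1) ` Q)"
    then show "r \<in> {..n} - path_set n P Q" using assms by (auto simp: path_set_def)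
  qed
  have "(\<forall>r\<in>{..n} - path_set n P Q. even (card (path_set n P Q \<inter> {..<r})))
      \<longleftrightarrow> even (card (path_set n P Q \<inter> {..<n})) \<and> (\<forall>x\<in>P. even (below P x + below Q x))
        \<and> (\<forall>y\<in>Q. odd (below P (Suc y) + below Q y))"
  proof -
    have "(\<forall>x\<in>P. even (card (path_set n P Q \<inter> {..<2 * x}))) \<longleftrightarrow> (\<forall>x\<in>P. even (below P x + below Q x))"
      using assms(1) by (intro ball_cong refl e) auto
    moreover have "(\<forall>y\<in>Q. even (card (path_set n P Q \<inter> {..<2 * y + 1}))) \<longleftrightarrow> (\<forall>y\<in>Q. odd (below P (Suc y) + below Q y))"
      using assms(2) by (intro ball_cong refl o) auto
    ultimately show ?thesis unfolding eq ball_simps(7) ball_Un ball_simps(9) by blast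
  qed
  moreover have "even (card (path_set n P Q \<inter> {..<n})) \<longleftrightarrow> even (n + card P + card Q)"
    using card_path_set[of n n P Q] below_all[OF assms(1)] below_all[OF assms(2)] by simp presburger
  moreover have "(even (n + card P + card Q) \<and> (\<forall>x\<in>P. even (below P x + below Q x))
        \<and> (\<forall>y\<in>Q. odd (below P (Suc y) + below Q y))) \<longleftrightarrow> interlace P Q \<and> card P = card Q + n mod 2"
  proof safe
    assume p: "even (n + card P + card Q)" "\<forall>x\<in>P. even (below P x + below Q x)"
      "\<forall>y\<in>Q. odd (below P (Suc y) + below Q y)"
    then show "interlace P Q" by (intro interlace_parity) auto
    have "Q \<subseteq> {..<(n + 1) div 2}" using assms(2) by (rule order_trans) auto
    then have "card P = card Q \<or> card P = Suc (card Q)"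
      using interlace_parity(2)[of P Q "(n + 1) div 2"] p below_all[OF assms(1)] below_all[of Q] by auto
    then show "card P = card Q + n mod 2" using p(1) by auto presburger+
  next
    assume I: "interlace P Q" and c: "card P = card Q + n mod 2"
    show "even (n + card P + card Q)" unfolding c by presburger
    show "even (below P x + below Q x)" if "x \<in> P" for x using interlaceD(1)[OF I that] by simp
    show False if "y \<in> Q" "even (below P (Suc y) + below Q y)" for y
      using interlaceD(2)[OF I that(1)] that(2) by simp
  qed
  ultimately show ?thesis by simp
qed

section \<open>Integer coordinates for the triangles of a trapezoid and its strips\<close>

datatype tri = U nat nat | D nat nat

text \<open>\<open>U k i\<close> and \<open>D k i\<close> are the up- and down-pointing triangles whose horizontal side is at
  height k and starts i units to the right of the zigzag.\<close>

definition loz :: "tri set \<Rightarrow> bool" where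
  "loz l \<longleftrightarrow> (\<exists>k i. l = {U k i, D k i} \<or>
     (\<exists>j. l = {U k i, D (Suc k) j} \<and> (j = i \<or> (if even k then i = Suc j else j = Suc i))))"

lemma lozI: "l = {U k i, D (Suc k) j} \<Longrightarrow> j = i \<or> (if even k then i = Suc j else j = Suc i) \<Longrightarrow> loz l"
  unfolding loz_def by blast

text \<open>Only at even heights does the zigzag have a western corner; a vertical lozenge there has
  both western sides on it.\<close>

definition wt :: "tri set \<Rightarrow> real" where
  "wt l = (if \<exists>k. even k \<and> l = {U k 0, D k 0} then 1/2 else 1)"

text \<open>The number of unit segments on line k between the zigzag and the slanted east side at u
  = n - k/2.\<close>

definition width :: "nat \<Rightarrow> nat \<Rightarrow> nat" where
  "width n k = n - (k + 1) div 2"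

definition trapezoid :: "nat \<Rightarrow> nat \<Rightarrow> nat \<Rightarrow> tri set" where
  "trapezoid n K k0 = {U k i | k i. k0 \<le> k \<and> k < K \<and> i < width n k} \<union> {D k i | k i. k0 < k \<and> k \<le> K \<and> i < width n k}"

definition strip :: "nat \<Rightarrow> nat \<Rightarrow> tri set" where
  "strip n k = U k ` {..<width n k} \<union> D (Suc k) ` {..<width n (Suc k)}"

lemma mem_trapezoid [simp]:
  "U k i \<in> trapezoid n K k0 \<longleftrightarrow> k0 \<le> k \<and> k < K \<and> i < width n k"
  "D k i \<in> trapezoid n K k0 \<longleftrightarrow> k0 < k \<and> k \<le> K \<and> i < width n k"
  by (auto simp: trapezoid_def)

lemma mem_strip [simp]:
  "U k' i \<in> strip n k \<longleftrightarrow> k' = k \<and> i < width n k"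
  "D k' i \<in> strip n k \<longleftrightarrow> k' = Suc k \<and> i < width n k'"
  by (auto simp: strip_def)

lemma finite_strip: "finite (strip n k)"
  by (simp add: strip_def)

lemma finite_trapezoid: "finite (trapezoid n K k0)"
proof -
  have "trapezoid n K k0 \<subseteq> (\<lambda>(k, i). U k i) ` ({..K} \<times> {..<n}) \<union> (\<lambda>(k, i). D k i) ` ({..K} \<times> {..<n})"
    by (auto simp: trapezoid_def width_def image_iff)
  then show ?thesis by (rule finite_subset) simp
qed

lemma trapezoid_split:
  assumes "k < K"
  shows "trapezoid n K k = strip n k \<union> trapezoid n K (Suc k)" "strip n k \<inter> trapezoid n K (Suc k) = {}"
proof -
  have "t \<in> trapezoid n K k \<longleftrightarrow> t \<in> strip n k \<union> trapezoid n K (Suc k)" for t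
    using assms by (cases t) (auto simp: le_less Suc_le_eq dest: Suc_lessI)
  then show "trapezoid n K k = strip n k \<union> trapezoid n K (Suc k)" by blast
  have "\<not> (t \<in> strip n k \<and> t \<in> trapezoid n K (Suc k))" for t by (cases t) auto
  then show "strip n k \<inter> trapezoid n K (Suc k) = {}" by blast
qed

lemma trapezoid_top [simp]: "trapezoid n K K = {}"
  by (auto simp: trapezoid_def)

lemma wt_vertical: "wt {U k i, D k i} = (if even k then half0 i else 1)"
  by (auto simp: wt_def doubleton_eq_iff)

lemma wt_strip:
  assumes "l \<subseteq> strip n k"
  shows "wt l = 1"
proof -
  have "\<not> {U k' 0, D k' 0} \<subseteq> strip n k" for k' by (auto simp: strip_def)
  then show ?thesis using assms by (auto simp: wt_def)
qed

lemma strip_even_width: "even k \<Longrightarrow> width n (Suc k) = width n k - 1"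
  "odd k \<Longrightarrow> width n (Suc k) = width n k"
  by (auto elim!: evenE oddE simp: width_def)

text \<open>Reads a strip from west to east. The first triangle points up above an even line and
  down above an odd one.\<close>

definition chain :: "nat \<Rightarrow> nat \<Rightarrow> tri" where
  "chain k p = (if even p = even k then U k (p div 2) else D (Suc k) (p div 2))"

lemma div2_eq_iff:
  "even p \<and> p div 2 = i \<longleftrightarrow> p = 2 * i" "odd p \<and> p div 2 = i \<longleftrightarrow> p = 2 * i + 1" for p i :: nat
  by presburger+

lemma chain_eq_U: "chain k p = U k' i \<longleftrightarrow> k' = k \<and> p = 2 * i + k mod 2"
proof -
  have "chain k p = U k' i \<longleftrightarrow> even p = even k \<and> k = k' \<and> p div 2 = i" by (auto simp: chain_def)
  then show ?thesis using div2_eq_iff[of p i] by (cases "even k") (auto simp: mod_2_eq_odd)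
qed

lemma chain_eq_D: "chain k p = D k' i \<longleftrightarrow> k' = Suc k \<and> p = 2 * i + Suc k mod 2"
proof -
  have "chain k p = D k' i \<longleftrightarrow> even p \<noteq> even k \<and> Suc k = k' \<and> p div 2 = i" by (auto simp: chain_def)
  then show ?thesis using div2_eq_iff[of p i] by (cases "even k") (auto simp: mod_2_eq_odd)
qed

lemmas eq_chain = chain_eq_U[unfolded eq_commute[of "chain _ _"]] chain_eq_D[unfolded eq_commute[of "chain _ _"]]

lemma inj_chain: "inj (chain k)"
proof (rule injI)
  fix p q assume eq: "chain k p = chain k q"
  show "p = q"
  proof (cases "chain k q")
    case (U k' i)
    with eq have "chain k p = U k' i" by simp
    with U show ?thesis unfolding chain_eq_U by simp
  next
    case (D k' i)
    with eq have "chain k p = D k' i" by simp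
    with D show ?thesis unfolding chain_eq_D by simp
  qed
qed

lemma inj_image_doubleton:
  assumes "inj f" "f ` l = {s, t}"
  shows "\<exists>p q. l = {p, q} \<and> f p = s \<and> f q = t"
proof -
  obtain p q where pq: "p \<in> l" "q \<in> l" "f p = s" "f q = t" using assms(2) by (metis imageE insertI1 insertI2)
  then have "f ` l = f ` {p, q}" using assms(2) by simp
  then have "l = {p, q}" by (rule inj_image_eq_iff[OF assms(1), THEN iffD1])
  then show ?thesis using pq by blast
qed

lemma loz_chain: "loz (chain k ` l) \<longleftrightarrow> path_edge l"
proof
  assume "path_edge l"
  then obtain p where p: "l = {p, Suc p}" by (auto simp: path_edge_def)
  show "loz (chain k ` l)"
  proof (cases "even p = even k")
    case True
    then have "chain k ` l = {U k (p div 2), D (Suc k) (Suc p div 2)}" by (auto simp: p chain_def)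
    moreover have "Suc p div 2 = p div 2 \<or> (odd k \<and> Suc p div 2 = Suc (p div 2))"
      using True by presburger
    ultimately show ?thesis by (intro lozI[of _ k "p div 2" "Suc p div 2"]) auto
  next
    case False
    then have "chain k ` l = {U k (Suc p div 2), D (Suc k) (p div 2)}" by (auto simp: p chain_def)
    moreover have "p div 2 = Suc p div 2 \<or> (even k \<and> Suc p div 2 = Suc (p div 2))"
      using False by presburger
    ultimately show ?thesis by (intro lozI[of _ k "Suc p div 2" "p div 2"]) auto
  qed
next
  assume "loz (chain k ` l)"
  then obtain k' i where "chain k ` l = {U k' i, D k' i} \<or>
     (\<exists>j. chain k ` l = {U k' i, D (Suc k') j} \<and> (j = i \<or> (if even k' then i = Suc j else j = Suc i)))"
    unfolding loz_def by blast
  then show "path_edge l"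
  proof
    assume c: "chain k ` l = {U k' i, D k' i}"
    obtain p q where "chain k p = U k' i" "chain k q = D k' i"
      using inj_image_doubleton[OF inj_chain c] by blast
    then show ?thesis by (simp add: chain_eq_U chain_eq_D)
  next
    assume "\<exists>j. chain k ` l = {U k' i, D (Suc k') j} \<and> (j = i \<or> (if even k' then i = Suc j else j = Suc i))"
    then obtain j where c: "chain k ` l = {U k' i, D (Suc k') j}"
      and j: "j = i \<or> (if even k' then i = Suc j else j = Suc i)" by blast
    obtain p q where l: "l = {p, q}" and "chain k p = U k' i" "chain k q = D (Suc k') j"
      using inj_image_doubleton[OF inj_chain c] by blast
    then have "k' = k" "p = 2 * i + k mod 2" "q = 2 * j + Suc k mod 2"
      by (simp_all add: chain_eq_U chain_eq_D)
    then have "q = Suc p \<or> p = Suc q"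
      using j by (cases "even k") (auto elim!: evenE oddE)
    then show ?thesis unfolding path_edge_def l by auto
  qed
qed

lemma chain_path_set:
  assumes "w > 0" "even k \<Longrightarrow> w' = w - 1" "odd k \<Longrightarrow> w' = w"
  shows "chain k ` path_set (if even k then 2 * w - 1 else 2 * w) (if even k then X else Y) (if even k then Y else X)
    = U k ` {..<w} \<union> D (Suc k) ` {..<w'} - U k ` X - D (Suc k) ` Y" (is "chain k ` ?P = ?R")
proof -
  have "t \<in> chain k ` ?P \<longleftrightarrow> t \<in> ?R" for t
  proof (cases t)
    case (U k' i)
    have "t \<in> chain k ` S \<longleftrightarrow> k' = k \<and> 2 * i + k mod 2 \<in> S" for S
      by (auto simp: U image_iff eq_chain)
    then show ?thesis using assms by (cases "even k") (auto simp: U path_set_def)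
  next
    case (D k' i)
    have "t \<in> chain k ` S \<longleftrightarrow> k' = Suc k \<and> 2 * i + Suc k mod 2 \<in> S" for S
      by (auto simp: D image_iff eq_chain)
    then show ?thesis using assms by (cases "even k") (auto simp: D path_set_def)
  qed
  then show ?thesis by blast
qed

text \<open>Above an even line the strip is a path of odd length with up-pointing triangles at both
  ends, above an odd line a path of even length starting with a down-pointing one. Weights 1/2
  belong to lozenges astride a line and do not occur within a strip.\<close>

lemma tiling_sum_strip:
  assumes "X \<subseteq> {..<width n k}" "Y \<subseteq> {..<width n (Suc k)}" "width n k > 0"
  shows "tiling_sum loz wt (strip n k - U k ` X - D (Suc k) ` Y)
    = (if if even k then interlace X Y \<and> card X = Suc (card Y) else interlace Y X \<and> card Y = card X
       then 1 else 0)"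
proof -
  let ?n = "if even k then 2 * width n k - 1 else 2 * width n k"
  let ?P = "if even k then X else Y" and ?Q = "if even k then Y else X"
  have im: "strip n k - U k ` X - D (Suc k) ` Y = chain k ` path_set ?n ?P ?Q"
    unfolding strip_def using chain_path_set[of "width n k" k "width n (Suc k)" X Y] assms(3) strip_even_width[of k n] by simp
  have "tiling_sum loz wt (chain k ` path_set ?n ?P ?Q) = tiling_sum path_edge (\<lambda>_. 1) (path_set ?n ?P ?Q)"
  proof (rule tiling_sum_image)
    show "inj_on (chain k) (path_set ?n ?P ?Q)" by (rule inj_on_subset[OF inj_chain]) simp
    show "wt (chain k ` l) = 1" if "l \<subseteq> path_set ?n ?P ?Q" "path_edge l" for l
    proof (rule wt_strip)
      have "chain k ` l \<subseteq> chain k ` path_set ?n ?P ?Q" using that(1) by (rule image_mono)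
      then show "chain k ` l \<subseteq> strip n k" unfolding im[symmetric] by blast
    qed
  qed (rule loz_chain)
  also have "\<dots> = (if \<forall>r\<in>{..?n} - path_set ?n ?P ?Q. even (card (path_set ?n ?P ?Q \<inter> {..<r})) then 1 else 0)"
    by (rule tiling_sum_path) (auto simp: path_set_def)
  also have "(\<forall>r\<in>{..?n} - path_set ?n ?P ?Q. even (card (path_set ?n ?P ?Q \<inter> {..<r})))
      \<longleftrightarrow> interlace ?P ?Q \<and> card ?P = card ?Q + ?n mod 2"
  proof (rule path_condition)
    obtain v where "width n k = Suc v" using assms(3) gr0_implies_Suc by blast
    then have "even k \<Longrightarrow> (?n + 1) div 2 = width n k" "odd k \<Longrightarrow> (?n + 1) div 2 = width n (Suc k)"
      "even k \<Longrightarrow> ?n div 2 = width n (Suc k)" "odd k \<Longrightarrow> ?n div 2 = width n k"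
      using strip_even_width[of k n] by simp_all
    then show "?P \<subseteq> {..<(?n + 1) div 2}" "?Q \<subseteq> {..<?n div 2}"
      using assms(1,2) by (cases "even k"; simp)+
  qed
  also have "interlace ?P ?Q \<and> card ?P = card ?Q + ?n mod 2 \<longleftrightarrow>
     (if even k then interlace X Y \<and> card X = Suc (card Y) else interlace Y X \<and> card Y = card X)"
  proof -
    have "(2 * width n k - 1) mod 2 = 1" using assms(3) by presburger
    then show ?thesis by simp
  qed
  finally show ?thesis unfolding im .
qed

definition trapezoid_sum :: "nat \<Rightarrow> nat \<Rightarrow> nat \<Rightarrow> nat set \<Rightarrow> real" where
  "trapezoid_sum n K k X = tiling_sum loz wt (trapezoid n K k - U k ` X)"

lemma trapezoid_sum_top [simp]: "trapezoid_sum n K K {} = 1"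
  by (simp add: trapezoid_sum_def)

text \<open>Transfer step: the lowest strip is cut off, and Y records the vertical lozenges astride
  the cut. On the top line K no vertical lozenge can stand, hence the condition
  \<open>Suc k < K\<close> on the positions.\<close>

lemma trapezoid_sum_step:
  assumes "k < K"
  shows "trapezoid_sum n K k X = (\<Sum>Y\<in>Pow {i. Suc k < K \<and> i < width n (Suc k)}.
    (\<Prod>i\<in>Y. wt {U (Suc k) i, D (Suc k) i}) *
    (tiling_sum loz wt (strip n k - U k ` X - D (Suc k) ` Y) * trapezoid_sum n K (Suc k) Y))"
proof -
  let ?A = "strip n k - U k ` X" and ?B = "trapezoid n K (Suc k)"
  let ?I = "{i. Suc k < K \<and> i < width n (Suc k)}"
  let ?v = "\<lambda>i. {U (Suc k) i, D (Suc k) i}"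
  have R: "trapezoid n K k - U k ` X = ?A \<union> ?B" and dis: "?A \<inter> ?B = {}"
  proof -
    have "U k ` X \<inter> ?B = {}" by (auto simp: trapezoid_def)
    then show "trapezoid n K k - U k ` X = ?A \<union> ?B" "?A \<inter> ?B = {}"
      using trapezoid_split[OF assms, of n] by blast+
  qed
  have inj: "inj_on ?v Y" for Y by (rule inj_onI) (auto simp: doubleton_eq_iff)
  have cross: "crossings loz ?A ?B = (`) ?v ` Pow ?I"
  proof (intro equalityI subsetI)
    fix C assume C: "C \<in> crossings loz ?A ?B"
    have "\<exists>i\<in>?I. l = ?v i" if "l \<in> C" for l
    proof -
      have l: "loz l" "l \<subseteq> ?A \<union> ?B" "l \<inter> ?A \<noteq> {}" "l \<inter> ?B \<noteq> {}"
        using C that by (auto simp: crossings_def)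
      from l(1) obtain k' i where "l = {U k' i, D k' i} \<or> (\<exists>j. l = {U k' i, D (Suc k') j})"
        unfolding loz_def by blast
      then show ?thesis
      proof (elim disjE exE)
        assume "l = {U k' i, D k' i}"
        then show ?thesis using l(2-4) by (auto simp: strip_def trapezoid_def)
      next
        fix j assume "l = {U k' i, D (Suc k') j}"
        then show ?thesis using l(2-4) by (auto simp: strip_def trapezoid_def)
      qed
    qed
    then have "C = ?v ` {i \<in> ?I. ?v i \<in> C}" by auto
    then show "C \<in> (`) ?v ` Pow ?I" by blast
  next
    fix C assume "C \<in> (`) ?v ` Pow ?I"
    then obtain Y where Y: "Y \<subseteq> ?I" "C = ?v ` Y" by blast
    have "disjoint C" unfolding Y(2) disjoint_def by auto
    moreover have "loz (?v i) \<and> ?v i \<subseteq> ?A \<union> ?B \<and> ?v i \<inter> ?A \<noteq> {} \<and> ?v i \<inter> ?B \<noteq> {}" if "i \<in> Y" for i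
    proof -
      have "D (Suc k) i \<in> ?A" "U (Suc k) i \<in> ?B" using that Y(1) by auto
      moreover have "loz (?v i)" unfolding loz_def by blast
      ultimately show ?thesis by simp
    qed
    ultimately show "C \<in> crossings loz ?A ?B" unfolding crossings_def Y(2) by blast
  qed
  have "trapezoid_sum n K k X = (\<Sum>C\<in>(`) ?v ` Pow ?I. prod wt C * (tiling_sum loz wt (?A - \<Union>C) * tiling_sum loz wt (?B - \<Union>C)))"
    unfolding trapezoid_sum_def R using dis finite_strip finite_trapezoid
    by (subst tiling_sum_split) (simp_all add: cross)
  also have "\<dots> = (\<Sum>Y\<in>Pow ?I. prod wt (?v ` Y) * (tiling_sum loz wt (?A - \<Union>(?v ` Y)) * tiling_sum loz wt (?B - \<Union>(?v ` Y))))"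
  proof (subst sum.reindex)
    have "inj ?v" by (rule inj)
    then show "inj_on ((`) ?v) (Pow ?I)" by (simp add: inj_on_def inj_image_eq_iff)
  qed simp
  also have "\<dots> = (\<Sum>Y\<in>Pow ?I. (\<Prod>i\<in>Y. wt (?v i)) *
      (tiling_sum loz wt (strip n k - U k ` X - D (Suc k) ` Y) * trapezoid_sum n K (Suc k) Y))"
  proof (rule sum.cong[OF refl])
    fix Y assume "Y \<in> Pow ?I"
    have "?A - \<Union>(?v ` Y) = strip n k - U k ` X - D (Suc k) ` Y" by (auto simp: strip_def)
    moreover have "?B - \<Union>(?v ` Y) = trapezoid n K (Suc k) - U (Suc k) ` Y" by (auto simp: trapezoid_def)
    ultimately show "prod wt (?v ` Y) * (tiling_sum loz wt (?A - \<Union>(?v ` Y)) * tiling_sum loz wt (?B - \<Union>(?v ` Y)))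
      = (\<Prod>i\<in>Y. wt (?v i)) * (tiling_sum loz wt (strip n k - U k ` X - D (Suc k) ` Y) * trapezoid_sum n K (Suc k) Y)"
      by (simp add: prod.reindex[OF inj] trapezoid_sum_def)
  qed
  finally show ?thesis .
qed

text \<open>The next line is even, so its vertical lozenges carry exactly the weight
  \<open>half0\<close> for which \<open>sum_even_det\<close> returns the odd determinant; the number
  of positions stays the same.\<close>

lemma trapezoid_sum_odd_step:
  assumes "odd k" "Suc k < K" "Y \<subseteq> {..<width n k}" "width n k > 0"
    and IH: "\<And>X. X \<subseteq> {..<width n (Suc k)} \<Longrightarrow> trapezoid_sum n K (Suc k) X = (if card X = r then even_det r X else 0)"
  shows "trapezoid_sum n K k Y = (if card Y = r then odd_det r Y else 0)"
proof -
  have fY: "finite Y" using assms(3) finite_subset by blast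
  have w: "width n (Suc k) = width n k" using strip_even_width(2)[OF assms(1)] .
  have tr: "transversal (card Y) (odd_cells Y) X \<Longrightarrow> X \<subseteq> {..<width n (Suc k)}" for X
  proof (cases "card Y")
    case (Suc r)
    have "enum Y r < width n k" using enum_in[OF fY, of r] Suc assms(3) by auto
    then show "transversal (card Y) (odd_cells Y) X \<Longrightarrow> X \<subseteq> {..<width n (Suc k)}"
      by (auto simp: transversal_def Suc odd_cells_def w)
  qed (auto simp: transversal_def odd_cells_def)
  have I: "{i. Suc k < K \<and> i < width n (Suc k)} = {..<width n (Suc k)}" using assms(2) by auto
  have "trapezoid_sum n K k Y = (\<Sum>X\<in>Pow {..<width n (Suc k)}. (if transversal (card Y) (odd_cells Y) X then
      (if card Y = r then prod half0 X * even_det r X else 0) else 0))"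
    unfolding trapezoid_sum_step[OF Suc_lessD[OF assms(2)]] I
  proof (rule sum.cong[OF refl])
    fix X assume "X \<in> Pow {..<width n (Suc k)}"
    then have X: "X \<subseteq> {..<width n (Suc k)}" and fX: "finite X" using finite_subset by auto
    have "interlace X Y \<and> card X = card Y \<longleftrightarrow> transversal (card Y) (odd_cells Y) X"
    proof
      assume tr: "transversal (card Y) (odd_cells Y) X"
      have "card (X \<inter> {..<odd_cells Y (card Y)}) = card Y"
        by (rule transversal_card[OF odd_cells_mono[OF fY] tr]) auto
      moreover have "X \<inter> {..<odd_cells Y (card Y)} = X" using tr by (auto simp: transversal_def)
      ultimately show "interlace X Y \<and> card X = card Y"
        using tr interlace_transversal_even[OF fX fY] by simp
    qed (use interlace_transversal_even[OF fX fY] in blast)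
    then have "tiling_sum loz wt (strip n k - U k ` Y - D (Suc k) ` X)
        = (if transversal (card Y) (odd_cells Y) X then 1 else 0)"
      using tiling_sum_strip[OF assms(3) X assms(4)] assms(1) by simp
    moreover have "card X = card Y" if "transversal (card Y) (odd_cells Y) X"
      using \<open>interlace X Y \<and> card X = card Y \<longleftrightarrow> _\<close> that by blast
    ultimately show "(\<Prod>i\<in>X. wt {U (Suc k) i, D (Suc k) i}) *
        (tiling_sum loz wt (strip n k - U k ` Y - D (Suc k) ` X) * trapezoid_sum n K (Suc k) X)
      = (if transversal (card Y) (odd_cells Y) X then (if card Y = r then prod half0 X * even_det r X else 0) else 0)"
      using IH[OF X] assms(1) by (auto simp: wt_vertical)
  qed
  also have "\<dots> = (\<Sum>X | X \<subseteq> {..<width n (Suc k)} \<and> transversal (card Y) (odd_cells Y) X.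
      (if card Y = r then prod half0 X * even_det r X else 0))"
    by (subst sum.inter_filter[symmetric]) (auto intro: sum.cong)
  also have "{X. X \<subseteq> {..<width n (Suc k)} \<and> transversal (card Y) (odd_cells Y) X} = {X. transversal (card Y) (odd_cells Y) X}"
    using tr by blast
  also have "(\<Sum>X | transversal (card Y) (odd_cells Y) X. (if card Y = r then prod half0 X * even_det r X else 0))
      = (if card Y = r then odd_det r Y else 0)"
    using sum_even_det[OF fY] by auto
  finally show ?thesis .
qed

text \<open>The next line is odd and unweighted, and it has one position fewer, as in
  \<open>sum_odd_det\<close>. The last hypothesis says that only r = 0 can occur when the next line
  is the top.\<close>

lemma trapezoid_sum_even_step:
  assumes "even k" "k < K" "X \<subseteq> {..<width n k}" "width n k > 0"
    and IH: "\<And>Y. Y \<subseteq> {i. Suc k < K \<and> i < width n (Suc k)} \<Longrightarrow>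
      trapezoid_sum n K (Suc k) Y = (if card Y = r then odd_det r Y else 0)"
    and r: "r > 0 \<Longrightarrow> Suc k < K"
  shows "trapezoid_sum n K k X = (if card X = Suc r then even_det (Suc r) X else 0)"
proof -
  let ?I = "{i. Suc k < K \<and> i < width n (Suc k)}"
  have fX: "finite X" using assms(3) finite_subset by blast
  have w: "width n (Suc k) = width n k - 1" using strip_even_width(1)[OF assms(1)] .
  have "trapezoid_sum n K k X = (\<Sum>Y\<in>Pow ?I. (if card X = Suc r \<and> transversal r (enum X) Y then odd_det r Y else 0))"
    unfolding trapezoid_sum_step[OF assms(2)]
  proof (rule sum.cong[OF refl])
    fix Y assume Y: "Y \<in> Pow ?I"
    then have fY: "finite Y" by (auto intro: finite_subset[of _ "{..<width n (Suc k)}"])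
    have Y': "Y \<subseteq> {..<width n (Suc k)}" using Y by auto
    have iff: "interlace X Y \<and> card X = Suc (card Y) \<and> card Y = r \<longleftrightarrow> card X = Suc r \<and> transversal r (enum X) Y"
    proof
      assume tr: "card X = Suc r \<and> transversal r (enum X) Y"
      have mono: "enum X i \<le> enum X (Suc i)" if "i < r" for i
        using enum_less[OF fX, of i "Suc i"] that tr by simp
      have "card (Y \<inter> {..<enum X r}) = r"
        using transversal_card[of r "enum X" Y r, OF mono] tr by auto
      moreover have "Y \<inter> {..<enum X r} = Y" using tr by (auto simp: transversal_def)
      ultimately show "interlace X Y \<and> card X = Suc (card Y) \<and> card Y = r"
        using tr interlace_transversal_odd[OF fX fY] by simp
    qed (use interlace_transversal_odd[OF fX fY] in auto)
    show "(\<Prod>i\<in>Y. wt {U (Suc k) i, D (Suc k) i}) *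
        (tiling_sum loz wt (strip n k - U k ` X - D (Suc k) ` Y) * trapezoid_sum n K (Suc k) Y)
      = (if card X = Suc r \<and> transversal r (enum X) Y then odd_det r Y else 0)"
      using tiling_sum_strip[OF assms(3) Y' assms(4)] IH Y assms(1) iff by (auto simp: wt_vertical)
  qed
  also have "\<dots> = (if card X = Suc r then even_det (Suc r) X else 0)"
  proof (cases "card X = Suc r")
    case True
    \<comment> \<open>Points of Y lie strictly west of the last point of X, so they fit on the next
      line although it is one unit shorter.\<close>
    have "Y \<subseteq> ?I" if "transversal r (enum X) Y" for Y
    proof (cases "r = 0")
      case False
      have "enum X r < width n k" using enum_in[OF fX, of r] True assms(3) by auto
      moreover have "y < enum X r" if "y \<in> Y" for y
        using \<open>transversal r (enum X) Y\<close> that by (auto simp: transversal_def)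
      ultimately show ?thesis using r False unfolding w by fastforce
    qed (use that in \<open>auto simp: transversal_def\<close>)
    then have "{Y. Y \<subseteq> ?I \<and> transversal r (enum X) Y} = {Y. transversal r (enum X) Y}" by blast
    moreover have "(\<Sum>Y\<in>Pow ?I. (if transversal r (enum X) Y then odd_det r Y else 0))
        = (\<Sum>Y | Y \<subseteq> ?I \<and> transversal r (enum X) Y. odd_det r Y)"
      by (subst sum.inter_filter[symmetric]) (auto intro: sum.cong finite_subset[of _ "{..<width n (Suc k)}"])
    ultimately show ?thesis using True sum_odd_det[OF fX True] by simp
  qed simp
  finally show ?thesis .
qed

lemma trapezoid_sum_eq:
  assumes "h \<le> n"
  shows "r < h \<Longrightarrow> X \<subseteq> {..<width n (2 * (h - Suc r))} \<Longrightarrow>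
    trapezoid_sum n (2 * h - 1) (2 * (h - Suc r)) X = (if card X = Suc r then even_det (Suc r) X else 0)"
proof (induction r arbitrary: X)
  case 0
  then have K: "2 * h - 1 = Suc (2 * (h - Suc 0))" by simp
  show ?case
  proof (rule trapezoid_sum_even_step)
    show "0 < width n (2 * (h - Suc 0))" using 0 assms by (simp add: width_def)
    show "trapezoid_sum n (2 * h - 1) (Suc (2 * (h - Suc 0))) Y = (if card Y = 0 then odd_det 0 Y else 0)"
      if "Y \<subseteq> {i. Suc (2 * (h - Suc 0)) < 2 * h - 1 \<and> i < width n (Suc (2 * (h - Suc 0)))}" for Y
      using that unfolding K by (simp add: odd_det_def)
  qed (use 0 K in auto)
next
  case (Suc r)
  let ?k = "2 * (h - Suc (Suc r))"
  have k: "2 * (h - Suc r) = Suc (Suc ?k)" "Suc (Suc ?k) < 2 * h - 1" using Suc.prems(1) by auto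
  show ?case
  proof (rule trapezoid_sum_even_step)
    show w: "0 < width n ?k" using Suc.prems(1) assms by (simp add: width_def)
    fix Y assume Y: "Y \<subseteq> {i. Suc ?k < 2 * h - 1 \<and> i < width n (Suc ?k)}"
    show "trapezoid_sum n (2 * h - 1) (Suc ?k) Y = (if card Y = Suc r then odd_det (Suc r) Y else 0)"
    proof (rule trapezoid_sum_odd_step)
      show "0 < width n (Suc ?k)" using Suc.prems(1) assms by (simp add: width_def)
      show "trapezoid_sum n (2 * h - 1) (Suc (Suc ?k)) X = (if card X = Suc r then even_det (Suc r) X else 0)"
        if "X \<subseteq> {..<width n (Suc (Suc ?k))}" for X
        using Suc.IH[of X] Suc.prems(1) that unfolding k(1) by simp
    qed (use Y k in auto)
  qed (use Suc.prems k in auto)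
qed

text \<open>For h = 0 the height \<open>2 * h - 1\<close> truncates to 0 and the region is empty,
  with sum 1; requiring X to be empty keeps the cardinality condition right in this case.\<close>

lemma tiling_sum_trapezoid:
  assumes "h \<le> n" "X \<subseteq> {..<n}" "h = 0 \<Longrightarrow> X = {}"
  shows "tiling_sum loz wt (trapezoid n (2 * h - 1) 0 - U 0 ` X) = (if card X = h then delta X / H2 (2 * h) else 0)"
proof (cases h)
  case 0
  then show ?thesis using assms(3) by (simp add: delta_def H2_def)
next
  case (Suc r)
  have "finite X" using assms(2) finite_subset by blast
  then show ?thesis
    using trapezoid_sum_eq[OF assms(1), of r X] assms(2) Suc even_det_eq[of X h] by (simp add: trapezoid_sum_def width_def)
qed

section \<open>Forced lozenges\<close>

text \<open>Says that the horizontal side of the triangle lies in the dent; the halves are rounded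
  since the zigzag is shifted by 1/2 on odd lines. The same test serves both orientations above the
  base.\<close>

definition in_dent :: "nat \<Rightarrow> nat \<Rightarrow> nat \<Rightarrow> nat \<Rightarrow> bool" where
  "in_dent p s k i \<longleftrightarrow> p + k div 2 \<le> i \<and> i + 1 + (k + 1) div 2 \<le> p + s"

definition dent :: "nat \<Rightarrow> nat \<Rightarrow> tri set" where
  "dent p s = {U k i | k i. in_dent p s k i} \<union> {D k i | k i. 0 < k \<and> in_dent p s k i}"

definition half_dent :: "nat \<Rightarrow> tri set" where
  "half_dent a = {U k i | k i. i + (k + 1) div 2 < a} \<union> {D k i | k i. 0 < k \<and> i + (k + 1) div 2 < a}"

lemma mem_dent [simp]:
  "U k i \<in> dent p s \<longleftrightarrow> in_dent p s k i" "D k i \<in> dent p s \<longleftrightarrow> 0 < k \<and> in_dent p s k i"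
  by (auto simp: dent_def)

lemma mem_half_dent [simp]:
  "U k i \<in> half_dent a \<longleftrightarrow> i + (k + 1) div 2 < a" "D k i \<in> half_dent a \<longleftrightarrow> 0 < k \<and> i + (k + 1) div 2 < a"
  by (auto simp: half_dent_def)

definition vertical :: "nat \<times> nat \<Rightarrow> tri set" where
  "vertical x = {U (fst x) (snd x), D (fst x) (snd x)}"

lemma vertical_eq: "vertical (k, i) = {U k i, D k i}"
  by (simp add: vertical_def)

lemma mem_vertical [simp]: "U k i \<in> vertical x \<longleftrightarrow> x = (k, i)" "D k i \<in> vertical x \<longleftrightarrow> x = (k, i)"
  by (cases x; auto simp: vertical_def)+

lemma inj_vertical: "inj_on vertical A"
  by (rule inj_onI) (metis mem_vertical(1) prod.collapse)

text \<open>If the two triangles below a down-pointing triangle are absent or already covered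
  from below, then the vertical lozenge on top of it is forced; hence forced lozenges
  propagate upwards from the base.\<close>

lemma tiling_sum_forced_verticals:
  assumes fin: "finite R"
    and sub: "\<And>k i. (k, i) \<in> F \<Longrightarrow> 0 < k \<and> U k i \<in> R \<and> D k i \<in> R"
    and low: "\<And>k i j. (Suc k, j) \<in> F \<Longrightarrow> U k i \<in> R \<Longrightarrow> j = i \<or> (if even k then i = Suc j else j = Suc i) \<Longrightarrow>
      (k, i) \<in> F"
  shows "tiling_sum loz wt R = (\<Prod>x\<in>F. wt (vertical x)) * tiling_sum loz wt (R - \<Union>(vertical ` F))"
proof -
  have force: "(k, i) \<in> F \<Longrightarrow> vertical (k, i) \<in> P" if P: "P \<in> tilesets loz R" for P k i
  proof (induction k arbitrary: i)
    case 0
    then show ?case using sub by blast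
  next
    case (Suc k j)
    have "D (Suc k) j \<in> \<Union>P" using sub[OF Suc.prems] tilesetsD(1)[OF P] by simp
    then obtain l where l: "l \<in> P" "D (Suc k) j \<in> l" by blast
    then have "loz l" using tilesetsD(4)[OF P] by blast
    then obtain k' i where "l = {U k' i, D k' i} \<or>
     (\<exists>j. l = {U k' i, D (Suc k') j} \<and> (j = i \<or> (if even k' then i = Suc j else j = Suc i)))"
      unfolding loz_def by blast
    then show ?case
    proof
      assume "l = {U k' i, D k' i}"
      then show ?case using l by (simp add: vertical_def)
    next
      assume "\<exists>j. l = {U k' i, D (Suc k') j} \<and> (j = i \<or> (if even k' then i = Suc j else j = Suc i))"
      then have l': "l = {U k i, D (Suc k) j}" "j = i \<or> (if even k then i = Suc j else j = Suc i)"
        using l(2) by auto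
      then have "U k i \<in> R" using tilesetsD(5)[OF P l(1)] by simp
      then have "(k, i) \<in> F" using low[OF Suc.prems] l'(2) by blast
      then have "vertical (k, i) \<in> P" by (rule Suc.IH)
      moreover have "vertical (k, i) \<noteq> l" using l'(1) by (auto simp: vertical_def doubleton_eq_iff)
      ultimately have "vertical (k, i) \<inter> l = {}" using disjointD[OF tilesetsD(2)[OF P]] l(1) by blast
      then show ?case using l'(1) by (auto simp: vertical_def)
    qed
  qed
  have "tiling_sum loz wt R = prod wt (vertical ` F) * tiling_sum loz wt (R - \<Union>(vertical ` F))"
  proof (rule tiling_sum_forced[OF fin])
    show "\<Union>(vertical ` F) \<subseteq> R" using sub by (auto simp: vertical_def)
    show "vertical ` F \<subseteq> P" if "P \<in> tilesets loz R" for P using force[OF that] by auto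
    show "disjoint (vertical ` F)"
    proof (rule disjointI)
      fix l l' assume "l \<in> vertical ` F" "l' \<in> vertical ` F" "l \<noteq> l'"
      then obtain x x' where x: "l = vertical x" "l' = vertical x'" "x \<noteq> x'" by blast
      have "t \<notin> l \<or> t \<notin> l'" for t using x by (cases t) auto
      then show "l \<inter> l' = {}" by blast
    qed
    show "loz l \<and> l \<noteq> {}" if "l \<in> vertical ` F" for l
      using that by (auto simp: vertical_def loz_def)
  qed
  also have "prod wt (vertical ` F) = (\<Prod>x\<in>F. wt (vertical x))"
    by (simp add: prod.reindex[OF inj_vertical])
  finally show ?thesis .
qed

text \<open>Dents narrow upwards, so they contain the triangles below each of their down-pointing
  ones. With \<open>half_dent_below\<close> this is the closure that lets forced lozenges
  propagate.\<close>

lemma in_dent_below: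
  assumes "in_dent p s (Suc k) j" "j = i \<or> (if even k then i = Suc j else j = Suc i)"
  shows "in_dent p s k i"
proof (cases "even k")
  case True
  then show ?thesis using assms by (auto simp: in_dent_def elim!: evenE)
next
  case False
  then show ?thesis using assms by (auto simp: in_dent_def elim!: oddE)
qed

lemma half_dent_below:
  assumes "j + (Suc k + 1) div 2 < a" "j = i \<or> (if even k then i = Suc j else j = Suc i)"
  shows "i + (k + 1) div 2 < a"
proof (cases "even k")
  case True
  then show ?thesis using assms by (auto elim!: evenE)
next
  case False
  then show ?thesis using assms by (auto elim!: oddE)
qed

definition dent_base :: "(nat \<times> nat) set \<Rightarrow> nat set" where
  "dent_base E = (\<Union>(p, s)\<in>E. {p..<p + s})"

text \<open>Removing only the bottom row of a dent forces vertical lozenges to fill the rest of it.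
  Among these only the ones of the half dent on the zigzag have weight 1/2; their number a - 1 is a
  truncated difference, so a = 0 gives the factor 1.\<close>

lemma tiling_sum_dented:
  assumes n: "h \<le> n" "a \<le> h" and E: "\<And>p s. (p, s) \<in> E \<Longrightarrow> p + s \<le> n \<and> s \<le> h"
    and S: "S \<subseteq> {..<n}" "h = 0 \<Longrightarrow> S = {}"
    and B: "B = {..<a} \<union> dent_base E \<union> S"
  shows "tiling_sum loz wt (trapezoid n (2 * h - 1) 0 - half_dent a - (\<Union>(p, s)\<in>E. dent p s) - U 0 ` S)
    = 2 ^ (a - 1) * (if card B = h then delta B / H2 (2 * h) else 0)"
proof -
  let ?T = "trapezoid n (2 * h - 1) 0"
  define G where "G k i \<longleftrightarrow> i + (k + 1) div 2 < a \<or> (\<exists>(p, s)\<in>E. in_dent p s k i)" for k i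
  \<comment> \<open>The forced verticals are centred on the segments of the dents above the base
    line; the base row itself is already removed with B.\<close>
  define F where "F = {(k, i). 0 < k \<and> G k i}"
  have range: "k < 2 * h - 1 \<and> i < width n k" if "0 < k" "G k i" for k i
    using that(2) unfolding G_def
  proof
    assume "i + (k + 1) div 2 < a"
    then show ?thesis using n by (auto simp: width_def)
  next
    assume "\<exists>(p, s)\<in>E. in_dent p s k i"
    then obtain p s where "(p, s) \<in> E" and d: "in_dent p s k i" by blast
    then have "p + s \<le> n" "s \<le> h" using E by auto
    moreover have "k + 1 \<le> s" using d unfolding in_dent_def by presburger
    ultimately show ?thesis using d \<open>0 < k\<close> by (auto simp: in_dent_def width_def)
  qed
  have G0: "G 0 i \<longleftrightarrow> i \<in> {..<a} \<union> dent_base E" for i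
    by (force simp: G_def in_dent_def dent_base_def Suc_le_eq)
  have Bn: "B \<subseteq> {..<n}" using n S E unfolding B dent_base_def by fastforce
  have Bh: "h = 0 \<Longrightarrow> B = {}" using n(2) S(2) E unfolding B dent_base_def by fastforce
  have "tiling_sum loz wt (?T - U 0 ` B) = (\<Prod>x\<in>F. wt (vertical x)) * tiling_sum loz wt (?T - U 0 ` B - \<Union>(vertical ` F))"
  proof (rule tiling_sum_forced_verticals)
    show "finite (?T - U 0 ` B)" by (simp add: finite_trapezoid)
    show "0 < k \<and> U k i \<in> ?T - U 0 ` B \<and> D k i \<in> ?T - U 0 ` B" if "(k, i) \<in> F" for k i
      using that range[of k i] by (auto simp: F_def)
    fix k i j assume *: "(Suc k, j) \<in> F" "U k i \<in> ?T - U 0 ` B" "j = i \<or> (if even k then i = Suc j else j = Suc i)"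
    have "G k i" using *(1) in_dent_below[OF _ *(3)] half_dent_below[OF _ *(3)]
      unfolding F_def G_def by blast
    moreover have "k \<noteq> 0" using \<open>G k i\<close> *(2) G0 B by auto
    ultimately show "(k, i) \<in> F" by (simp add: F_def)
  qed
  moreover have "?T - U 0 ` B - \<Union>(vertical ` F) = ?T - half_dent a - (\<Union>(p, s)\<in>E. dent p s) - U 0 ` S"
  proof (rule Set.set_eqI)
    fix t show "t \<in> ?T - U 0 ` B - \<Union>(vertical ` F) \<longleftrightarrow> t \<in> ?T - half_dent a - (\<Union>(p, s)\<in>E. dent p s) - U 0 ` S"
    proof (cases t)
      case (U k i)
      show ?thesis
      proof (cases "k = 0")
        case True
        have "t \<in> ?T - U 0 ` B - \<Union>(vertical ` F) \<longleftrightarrow> t \<in> ?T \<and> i \<notin> B"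
          using True by (auto simp: U F_def)
        also have "\<dots> \<longleftrightarrow> t \<in> ?T \<and> \<not> G 0 i \<and> i \<notin> S" using G0 B by auto
        finally show ?thesis using True by (auto simp: U G_def)
      next
        case False
        then show ?thesis by (auto simp: U F_def G_def)
      qed
    next
      case (D k i)
      then show ?thesis by (auto simp: F_def G_def)
    qed
  qed
  moreover have "(\<Prod>x\<in>F. wt (vertical x)) = (1/2) ^ (a - 1)"
  proof -
    have "F \<subseteq> {..2 * h} \<times> {..n}"
    proof
      fix x assume "x \<in> F"
      then show "x \<in> {..2 * h} \<times> {..n}" using range[of "fst x" "snd x"] by (auto simp: F_def width_def)
    qed
    then have fin: "finite F" by (rule finite_subset) simp
    \<comment> \<open>The forced lozenges at the western corners of the zigzag. A full dent never
      reaches the zigzag above height 1, so they all come from the half dent.\<close>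
    let ?K = "(\<lambda>k. (2 * k, 0)) ` {1..<a}"
    have "2 * k < 2 * h - 1 \<and> (2 * k, 0) \<in> F" if "k \<in> {1..<a}" for k
      using that n by (auto simp: F_def G_def)
    then have "?K \<subseteq> F" by auto
    then have "(\<Prod>x\<in>F. wt (vertical x)) = (\<Prod>x\<in>?K. wt (vertical x))"
    proof (rule prod.mono_neutral_right[OF fin], intro ballI)
      fix x assume x: "x \<in> F - ?K"
      obtain k i where ki: "x = (k, i)" by (cases x)
      have "\<not> (even k \<and> i = 0)"
      proof
        assume e: "even k \<and> i = 0"
        then obtain m where m: "k = 2 * m" by (auto elim: evenE)
        have "0 < m" "G (2 * m) 0" using x e unfolding ki m F_def by auto
        then have "m < a" unfolding G_def in_dent_def by auto
        then show False using x \<open>0 < m\<close> e unfolding ki m by auto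
      qed
      then show "wt (vertical x) = 1" unfolding ki by (auto simp: vertical_eq wt_vertical)
    qed
    also have "\<dots> = (\<Prod>k\<in>{1..<a}. wt (vertical (2 * k, 0)))"
      by (subst prod.reindex) (auto simp: inj_on_def)
    also have "\<dots> = (1/2) ^ (a - 1)"
      by (simp add: vertical_eq wt_vertical)
    finally show ?thesis .
  qed
  ultimately have "tiling_sum loz wt (?T - U 0 ` B) = (1/2) ^ (a - 1) *
      tiling_sum loz wt (?T - half_dent a - (\<Union>(p, s)\<in>E. dent p s) - U 0 ` S)" by simp
  moreover have "tiling_sum loz wt (?T - U 0 ` B) = (if card B = h then delta B / H2 (2 * h) else 0)"
    using tiling_sum_trapezoid[OF n(1) Bn Bh] .
  ultimately show ?thesis by (simp add: power_one_over field_simps)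
qed

section \<open>The triangular lattice\<close>

lemma card_Int_doubleton: "card (s \<inter> t) = 2 \<Longrightarrow> \<exists>p q. p \<noteq> q \<and> p \<in> s \<and> q \<in> s \<and> p \<in> t \<and> q \<in> t"
  by (auto simp: card_2_iff)

lemma card_up_Int_up: "card (up_tri u k \<inter> up_tri v l) \<noteq> 2"
proof
  assume c: "card (up_tri u k \<inter> up_tri v l) = 2"
  have "u = v \<and> k = l"
    using card_Int_doubleton[OF c] by (auto simp: up_tri_def)
  then show False using c by (simp add: up_tri_def)
qed

lemma card_down_Int_down: "card (down_tri u k \<inter> down_tri v l) \<noteq> 2"
proof
  assume c: "card (down_tri u k \<inter> down_tri v l) = 2"
  have "u = v \<and> k = l"
    using card_Int_doubleton[OF c] by (auto simp: down_tri_def)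
  then show False using c by (simp add: down_tri_def)
qed

lemma card_up_Int_down:
  "card (up_tri u k \<inter> down_tri v l) = 2 \<longleftrightarrow> (l = k \<and> v = u) \<or> (l = k + 1 \<and> (v = u + 1/2 \<or> v = u - 1/2))"
proof
  assume c: "card (up_tri u k \<inter> down_tri v l) = 2"
  show "(l = k \<and> v = u) \<or> (l = k + 1 \<and> (v = u + 1/2 \<or> v = u - 1/2))"
    using card_Int_doubleton[OF c] by (auto simp: up_tri_def down_tri_def)
next
  assume "(l = k \<and> v = u) \<or> (l = k + 1 \<and> (v = u + 1/2 \<or> v = u - 1/2))"
  then show "card (up_tri u k \<inter> down_tri v l) = 2"
  proof (elim disjE conjE)
    assume "l = k" "v = u"
    then have "up_tri u k \<inter> down_tri v l = {(u, k), (u + 1, k)}" by (auto simp: up_tri_def down_tri_def)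
    then show ?thesis by simp
  next
    assume "l = k + 1" "v = u + 1/2"
    then have "up_tri u k \<inter> down_tri v l = {(u + 1, k), (u + 1/2, k + 1)}" by (auto simp: up_tri_def down_tri_def)
    then show ?thesis by simp
  next
    assume "l = k + 1" "v = u - 1/2"
    then have "up_tri u k \<inter> down_tri v l = {(u, k), (u + 1/2, k + 1)}" by (auto simp: up_tri_def down_tri_def)
    then show ?thesis by simp
  qed
qed

lemma up_tri_inject [simp]: "up_tri u k = up_tri v l \<longleftrightarrow> u = v \<and> k = l"
proof
  assume "up_tri u k = up_tri v l"
  then have "{(u, k), (u + 1, k), (u + 1/2, k + 1)} \<subseteq> up_tri v l" by (simp add: up_tri_def)
  then show "u = v \<and> k = l" by (auto simp: up_tri_def)
qed simp

lemma down_tri_inject [simp]: "down_tri u k = down_tri v l \<longleftrightarrow> u = v \<and> k = l"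
proof
  assume "down_tri u k = down_tri v l"
  then have "{(u, k), (u + 1, k), (u + 1/2, k - 1)} \<subseteq> down_tri v l" by (simp add: down_tri_def)
  then show "u = v \<and> k = l" by (auto simp: down_tri_def)
qed simp

lemma up_neq_down [simp]: "up_tri u k \<noteq> down_tri v l" "down_tri v l \<noteq> up_tri u k"
proof -
  show "up_tri u k \<noteq> down_tri v l"
  proof
    assume "up_tri u k = down_tri v l"
    then have "{(u, k), (u + 1, k), (u + 1/2, k + 1)} \<subseteq> down_tri v l" by (simp add: up_tri_def)
    then show False by (auto simp: down_tri_def)
  qed
  then show "down_tri v l \<noteq> up_tri u k" by metis
qed

fun geo :: "tri \<Rightarrow> triangle" where
  "geo (U k i) = up_tri (zig (int k) + real i) (int k)"
| "geo (D k i) = down_tri (zig (int k) + real i) (int k)"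

text \<open>The mirror image in the line of height 0, used for the part of the region below that line.\<close>

fun geo' :: "tri \<Rightarrow> triangle" where
  "geo' (U k i) = down_tri (zig (int k) + real i) (- int k)"
| "geo' (D k i) = up_tri (zig (int k) + real i) (- int k)"

lemma inj_geo: "inj geo"
proof (rule injI)
  show "s = t" if "geo s = geo t" for s t using that by (cases s; cases t) auto
qed

lemma inj_geo': "inj geo'"
proof (rule injI)
  show "s = t" if "geo' s = geo' t" for s t using that by (cases s; cases t) auto
qed

lemma zig_lattice: "(zig k + real i, k) \<in> Defs.lattice"
proof (cases "even k")
  case True
  then obtain m where "k = 2 * m" by (auto elim: evenE)
  then have "zig k + real i - of_int k / 2 = of_int (int i - m)" by (simp add: zig_def field_simps)
  then show ?thesis unfolding Defs.lattice_def by (metis (mono_tags, lifting) Ints_of_int case_prodI mem_Collect_eq)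
next
  case False
  then obtain m where "k = 2 * m + 1" by (auto elim: oddE)
  then have "zig k + real i - of_int k / 2 = of_int (int i - m)" by (simp add: zig_def field_simps)
  then show ?thesis unfolding Defs.lattice_def by (metis (mono_tags, lifting) Ints_of_int case_prodI mem_Collect_eq)
qed

lemma zig_minus [simp]: "zig (- k) = zig k"
  by (simp add: zig_def)

lemma geo_unit: "geo t \<in> unit_triangles" "geo' t \<in> unit_triangles"
  using zig_lattice[of "int _"] zig_lattice[of "- int _"]
  by (cases t; force simp: unit_triangles_def)+

lemma geo_adjacent:
  "card (geo (U k i) \<inter> geo (D k' j)) = 2
    \<longleftrightarrow> k' = k \<and> i = j \<or> k' = Suc k \<and> (j = i \<or> (if even k then i = Suc j else j = Suc i))"
  unfolding geo.simps card_up_Int_down by (auto simp: zig_def)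

lemma geo'_adjacent:
  "card (geo' (U k i) \<inter> geo' (D k' j)) = 2
    \<longleftrightarrow> k' = k \<and> i = j \<or> k' = Suc k \<and> (j = i \<or> (if even k then i = Suc j else j = Suc i))"
  unfolding geo'.simps Int_commute[of "down_tri _ _"] card_up_Int_down by (auto simp: zig_def)

text \<open>Stated for an abstract embedding, so that the coordinates above the base and their
  mirror image below it are treated alike: triangles of equal orientation never share an edge, and
  mixed pairs do so as prescribed by \<open>loz\<close>.\<close>

lemma is_lozenge_image:
  assumes inj: "inj \<phi>" and unit: "\<And>t. \<phi> t \<in> unit_triangles"
    and UU: "\<And>k i k' i'. card (\<phi> (U k i) \<inter> \<phi> (U k' i')) \<noteq> 2" and DD: "\<And>k i k' i'. card (\<phi> (D k i) \<inter> \<phi> (D k' i')) \<noteq> 2"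
    and UD: "\<And>k i k' j. card (\<phi> (U k i) \<inter> \<phi> (D k' j)) = 2
    \<longleftrightarrow> k' = k \<and> i = j \<or> k' = Suc k \<and> (j = i \<or> (if even k then i = Suc j else j = Suc i))"
  shows "is_lozenge (\<phi> ` l) \<longleftrightarrow> loz l"
proof
  assume "is_lozenge (\<phi> ` l)"
  then obtain s t where c: "card (s \<inter> t) = 2" and st: "\<phi> ` l = {s, t}" by (auto simp: is_lozenge_def)
  obtain p q where pq: "l = {p, q}" "\<phi> p = s" "\<phi> q = t" using inj_image_doubleton[OF inj st] by blast
  have UDl: "loz {U k i, D k' j}" if "card (\<phi> (U k i) \<inter> \<phi> (D k' j)) = 2" for k i k' j
  proof (cases "k' = k")
    case True
    then have "j = i" using that[unfolded UD] by auto
    then show ?thesis using True unfolding loz_def by blast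
  next
    case False
    then have "k' = Suc k" "j = i \<or> (if even k then i = Suc j else j = Suc i)" using that[unfolded UD] by auto
    then show ?thesis by (intro lozI[of _ k i j]) auto
  qed
  show "loz l"
  proof (cases p)
    case p: (U k i)
    show ?thesis
    proof (cases q)
      case (U k' i')
      then show ?thesis using c UU[of k i k' i'] unfolding pq(2,3)[symmetric] p U by simp
    next
      case (D k' j)
      then show ?thesis using c pq UDl[of k i k' j] p by simp
    qed
  next
    case p: (D k' j)
    show ?thesis
    proof (cases q)
      case (U k i)
      then show ?thesis using c pq UDl[of k i k' j] p by (simp add: Int_commute insert_commute)
    next
      case (D k i)
      then show ?thesis using c DD[of k' j k i] unfolding pq(2,3)[symmetric] p D by simp
    qed
  qed
next
  assume "loz l"
  then obtain k i k' j where l: "l = {U k i, D k' j}"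
    and "k' = k \<and> i = j \<or> k' = Suc k \<and> (j = i \<or> (if even k then i = Suc j else j = Suc i))"
    unfolding loz_def by blast
  then have "card (\<phi> (U k i) \<inter> \<phi> (D k' j)) = 2" unfolding UD by simp
  then show "is_lozenge (\<phi> ` l)" unfolding is_lozenge_def l using unit by auto
qed

lemma is_lozenge_geo: "is_lozenge (geo ` l) \<longleftrightarrow> loz l"
  by (rule is_lozenge_image[OF inj_geo geo_unit(1)]) (simp_all only: geo.simps(1,2)[symmetric] geo_adjacent, simp_all add: card_up_Int_up card_down_Int_down)

lemma is_lozenge_geo': "is_lozenge (geo' ` l) \<longleftrightarrow> loz l"
  by (rule is_lozenge_image[OF inj_geo' geo_unit(2)]) (simp_all only: geo'.simps(1,2)[symmetric] geo'_adjacent, simp_all add: card_up_Int_up card_down_Int_down)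

lemma zig_edge_up:
  "{(zig k + real i, k), (zig k + real i + 1/2, k + 1)} \<in> zig_edges k0 k1
    \<longleftrightarrow> i = 0 \<and> even k \<and> k0 \<le> k \<and> k < k1"
  by (auto simp: zig_edges_def doubleton_eq_iff zig_def split: if_splits)

lemma zig_edge_down:
  "{(zig k + real i, k), (zig k + real i + 1/2, k - 1)} \<in> zig_edges k0 k1
    \<longleftrightarrow> i = 0 \<and> even k \<and> k0 < k \<and> k \<le> k1"
proof
  assume "{(zig k + real i, k), (zig k + real i + 1/2, k - 1)} \<in> zig_edges k0 k1"
  then show "i = 0 \<and> even k \<and> k0 < k \<and> k \<le> k1"
    by (auto simp: zig_edges_def doubleton_eq_iff zig_def split: if_splits)
next
  assume *: "i = 0 \<and> even k \<and> k0 < k \<and> k \<le> k1"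
  then have "{(zig k + real i, k), (zig k + real i + 1/2, k - 1)} = {(zig (k - 1), k - 1), (zig (k - 1 + 1), k - 1 + 1)}"
    by (auto simp: zig_def)
  moreover have "k0 \<le> k - 1 \<and> k - 1 < k1" using * by auto
  ultimately show "{(zig k + real i, k), (zig k + real i + 1/2, k - 1)} \<in> zig_edges k0 k1"
    unfolding zig_edges_def by blast
qed

lemma zig_weight_vertical:
  "zig_weight Z {up_tri u k, down_tri u k}
    = (if {(u, k), (u + 1/2, k + 1)} \<in> Z \<and> {(u, k), (u + 1/2, k - 1)} \<in> Z then 1/2 else 1)"
  by (auto simp: zig_weight_def doubleton_eq_iff)

lemma zig_weight_not_vertical: "u \<noteq> v \<or> k \<noteq> l \<Longrightarrow> zig_weight Z {up_tri u k, down_tri v l} = 1"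
  by (auto simp: zig_weight_def doubleton_eq_iff)

lemma loz_cases:
  assumes "loz l"
  obtains (vertical) k i where "l = {U k i, D k i}"
    | (horizontal) k i j where "l = {U k i, D (Suc k) j}"
  using assms unfolding loz_def by blast

lemma wt_horizontal: "wt {U k i, D (Suc k) j} = 1"
  by (auto simp: wt_def doubleton_eq_iff)

text \<open>Z is only confined between the zigzag of this part and its extension beyond the base, so
  the lemma applies both to quartered hexagons and to the region W. Edges beyond the base cannot
  border a lozenge inside the trapezoid.\<close>

lemma zig_weight_geo:
  assumes "loz l" "l \<subseteq> trapezoid n K 0" "zig_edges 0 (int K) \<subseteq> Z" "Z \<subseteq> zig_edges 0 (int K) \<union> zig_edges k0 0"
  shows "zig_weight Z (geo ` l) = wt l"
  using assms(1)
proof (cases rule: loz_cases)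
  case (vertical k i)
  then have k: "0 < k" "k < K" using assms(2) by auto
  let ?u = "zig (int k) + real i"
  have "{(?u, int k), (?u + 1/2, int k + 1)} \<in> Z \<longleftrightarrow> i = 0 \<and> even k"
    using assms(3,4) zig_edge_up[of "int k" i 0 "int K"] zig_edge_up[of "int k" i k0 0] k by auto
  moreover have "{(?u, int k), (?u + 1/2, int k - 1)} \<in> Z \<longleftrightarrow> i = 0 \<and> even k"
    using assms(3,4) zig_edge_down[of "int k" i 0 "int K"] zig_edge_down[of "int k" i k0 0] k by auto
  ultimately show ?thesis unfolding vertical by (simp add: zig_weight_vertical wt_vertical)
next
  case (horizontal k i j)
  then show ?thesis by (simp add: zig_weight_not_vertical wt_horizontal)
qed

lemma zig_weight_geo':
  assumes "loz l" "l \<subseteq> trapezoid n K 0" "zig_edges (- int K) 0 \<subseteq> Z" "Z \<subseteq> zig_edges (- int K) 0 \<union> zig_edges 0 k1"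
  shows "zig_weight Z (geo' ` l) = wt l"
  using assms(1)
proof (cases rule: loz_cases)
  case (vertical k i)
  then have k: "0 < k" "k < K" using assms(2) by auto
  let ?u = "zig (int k) + real i"
  have "{(?u, - int k), (?u + 1/2, - int k + 1)} \<in> Z \<longleftrightarrow> i = 0 \<and> even k"
    using assms(3,4) zig_edge_up[of "- int k" i "- int K" 0] zig_edge_up[of "- int k" i 0 k1] k by auto
  moreover have "{(?u, - int k), (?u + 1/2, - int k - 1)} \<in> Z \<longleftrightarrow> i = 0 \<and> even k"
    using assms(3,4) zig_edge_down[of "- int k" i "- int K" 0] zig_edge_down[of "- int k" i 0 k1] k by auto
  ultimately show ?thesis unfolding vertical
    by (simp add: zig_weight_vertical wt_vertical insert_commute[of "down_tri _ _" "up_tri _ _"])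
next
  case (horizontal k i j)
  then show ?thesis
    by (simp add: zig_weight_not_vertical wt_horizontal insert_commute[of "down_tri _ _" "up_tri _ _"])
qed

lemma tiling_sum_geo:
  assumes "R \<subseteq> trapezoid n K 0" "zig_edges 0 (int K) \<subseteq> Z" "Z \<subseteq> zig_edges 0 (int K) \<union> zig_edges k0 0"
  shows "tiling_sum is_lozenge (zig_weight Z) (geo ` R) = tiling_sum loz wt R"
proof (rule tiling_sum_image)
  show "inj_on geo R" by (rule inj_on_subset[OF inj_geo]) simp
  show "zig_weight Z (geo ` l) = wt l" if "l \<subseteq> R" "loz l" for l
    using that assms by (intro zig_weight_geo[of l n K Z k0]) auto
qed (rule is_lozenge_geo)

lemma tiling_sum_geo':
  assumes "R \<subseteq> trapezoid n K 0" "zig_edges (- int K) 0 \<subseteq> Z" "Z \<subseteq> zig_edges (- int K) 0 \<union> zig_edges 0 k1"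
  shows "tiling_sum is_lozenge (zig_weight Z) (geo' ` R) = tiling_sum loz wt R"
proof (rule tiling_sum_image)
  show "inj_on geo' R" by (rule inj_on_subset[OF inj_geo']) simp
  show "zig_weight Z (geo' ` l) = wt l" if "l \<subseteq> R" "loz l" for l
    using that assms by (intro zig_weight_geo'[of l n K Z k1]) auto
qed (rule is_lozenge_geo')

lemma lattice_zig:
  assumes "(u, k) \<in> Defs.lattice" "zig k \<le> u"
  obtains i where "u = zig k + real i"
proof -
  have "u - zig k \<in> \<int>"
  proof (cases "even k")
    case True
    then obtain m where m: "k = 2 * m" by (auto elim: evenE)
    then have e: "u - zig k = (u - of_int k / 2) + of_int m" by (simp add: zig_def)
    have "u - of_int k / 2 \<in> \<int>" using assms(1) by (simp add: Defs.lattice_def)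
    then show ?thesis unfolding e by (intro Ints_add Ints_of_int)
  next
    case False
    then obtain m where m: "k = 2 * m + 1" by (auto elim: oddE)
    then have e: "u - zig k = (u - of_int k / 2) + of_int m" by (simp add: zig_def field_simps)
    have "u - of_int k / 2 \<in> \<int>" using assms(1) by (simp add: Defs.lattice_def)
    then show ?thesis unfolding e by (intro Ints_add Ints_of_int)
  qed
  then obtain j where "u - zig k = of_int j" by (auto elim: Ints_cases)
  moreover from this have "0 \<le> j" using assms(2) by linarith
  ultimately have "u = zig k + real (nat j)" by simp
  then show ?thesis using that by blast
qed

text \<open>The triangles \<open>D 0 i\<close> lie below the base line.\<close>

definition upper_tri :: "tri \<Rightarrow> bool" where
  "upper_tri t \<longleftrightarrow> (case t of U k i \<Rightarrow> True | D k i \<Rightarrow> 0 < k)"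

lemma upper_tri_simps [simp]: "upper_tri (U k i)" "upper_tri (D k i) \<longleftrightarrow> 0 < k"
  by (simp_all add: upper_tri_def)

lemma geo_surj:
  assumes "t \<in> unit_triangles" "\<forall>(u, k)\<in>t. 0 \<le> k \<and> zig k \<le> u"
  obtains x where "t = geo x" "upper_tri x"
proof -
  from assms(1) consider u k where "t = up_tri u k" "(u, k) \<in> Defs.lattice" | u k where "t = down_tri u k" "(u, k) \<in> Defs.lattice"
    unfolding unit_triangles_def by blast
  then show ?thesis
  proof cases
    case 1
    then have "0 \<le> k" "zig k \<le> u" using assms(2) by (auto simp: up_tri_def)
    moreover obtain i where "u = zig k + real i" using lattice_zig[OF 1(2) \<open>zig k \<le> u\<close>] .
    ultimately show ?thesis using that[of "U (nat k) i"] 1 by simp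
  next
    case 2
    then have "1 \<le> k" "zig k \<le> u" using assms(2) by (auto simp: down_tri_def)
    moreover obtain i where "u = zig k + real i" using lattice_zig[OF 2(2) \<open>zig k \<le> u\<close>] .
    ultimately show ?thesis using that[of "D (nat k) i"] 2 by simp
  qed
qed

lemma geo'_surj:
  assumes "t \<in> unit_triangles" "\<forall>(u, k)\<in>t. k \<le> 0 \<and> zig k \<le> u"
  obtains x where "t = geo' x" "upper_tri x"
proof -
  from assms(1) consider u k where "t = up_tri u k" "(u, k) \<in> Defs.lattice" | u k where "t = down_tri u k" "(u, k) \<in> Defs.lattice"
    unfolding unit_triangles_def by blast
  then show ?thesis
  proof cases
    case 1
    then have "k \<le> - 1" "zig k \<le> u" using assms(2) by (auto simp: up_tri_def)
    moreover obtain i where "u = zig k + real i" using lattice_zig[OF 1(2) \<open>zig k \<le> u\<close>] .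
    moreover have "zig (- k) = zig k" by simp
    ultimately show ?thesis using that[of "D (nat (- k)) i"] 1 by simp
  next
    case 2
    then have "k \<le> 0" "zig k \<le> u" using assms(2) by (auto simp: down_tri_def)
    moreover obtain i where "u = zig k + real i" using lattice_zig[OF 2(2) \<open>zig k \<le> u\<close>] .
    moreover have "zig (- k) = zig k" by simp
    ultimately show ?thesis using that[of "U (nat (- k)) i"] 2 by simp
  qed
qed

text \<open>The bound \<open>zig k \<le> lo k\<close> keeps all triangles east of the zigzag, where
  they have natural coordinates; the equality of regions then reduces to inequalities for one
  triangle at a time.\<close>

lemma region_geo:
  assumes "\<And>k. k0 \<le> k \<Longrightarrow> k \<le> k1 \<Longrightarrow> zig k \<le> lo k" "k0 \<ge> 0"
    and "\<And>x. upper_tri x \<Longrightarrow> x \<in> G \<longleftrightarrow> (\<forall>(u, k)\<in>geo x. k0 \<le> k \<and> k \<le> k1 \<and> lo k \<le> u \<and> u \<le> hi k)"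
    and "\<And>x. x \<in> G \<Longrightarrow> upper_tri x"
  shows "region_between k0 k1 lo hi = geo ` G"
proof (intro equalityI subsetI)
  fix t assume t: "t \<in> region_between k0 k1 lo hi"
  then have *: "t \<in> unit_triangles" "\<forall>(u, k)\<in>t. k0 \<le> k \<and> k \<le> k1 \<and> lo k \<le> u \<and> u \<le> hi k"
    by (auto simp: region_between_def)
  then have "\<forall>(u, k)\<in>t. 0 \<le> k \<and> zig k \<le> u" using assms(1,2) by (fastforce intro: order_trans)
  then obtain x where "t = geo x" "upper_tri x" using geo_surj[OF *(1)] by blast
  then show "t \<in> geo ` G" using * assms(3) by blast
next
  fix t assume "t \<in> geo ` G"
  then show "t \<in> region_between k0 k1 lo hi"
    using assms(3,4) geo_unit(1) unfolding region_between_def by blast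
qed

lemma region_geo':
  assumes "\<And>k. k0 \<le> k \<Longrightarrow> k \<le> k1 \<Longrightarrow> zig k \<le> lo k" "k1 \<le> 0"
    and "\<And>x. upper_tri x \<Longrightarrow> x \<in> G \<longleftrightarrow> (\<forall>(u, k)\<in>geo' x. k0 \<le> k \<and> k \<le> k1 \<and> lo k \<le> u \<and> u \<le> hi k)"
    and "\<And>x. x \<in> G \<Longrightarrow> upper_tri x"
  shows "region_between k0 k1 lo hi = geo' ` G"
proof (intro equalityI subsetI)
  fix t assume t: "t \<in> region_between k0 k1 lo hi"
  then have *: "t \<in> unit_triangles" "\<forall>(u, k)\<in>t. k0 \<le> k \<and> k \<le> k1 \<and> lo k \<le> u \<and> u \<le> hi k"
    by (auto simp: region_between_def)
  then have "\<forall>(u, k)\<in>t. k \<le> 0 \<and> zig k \<le> u" using assms(1,2) by (fastforce intro: order_trans)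
  then obtain x where "t = geo' x" "upper_tri x" using geo'_surj[OF *(1)] by blast
  then show "t \<in> geo' ` G" using * assms(3) by blast
next
  fix t assume "t \<in> geo' ` G"
  then show "t \<in> region_between k0 k1 lo hi"
    using assms(3,4) geo_unit(2) unfolding region_between_def by blast
qed

section \<open>The regions\<close>

text \<open>Moves comparisons of indices to the reals, where linear arithmetic can compare them with
  the half-integral boundary lines.\<close>

lemmas to_real = of_nat_le_iff[where 'a=real, symmetric] nat_less_real_le
  of_int_le_iff[where 'a=real, symmetric] int_less_real_le
  of_nat_simps of_int_add of_int_mult of_int_diff of_int_minus of_int_numeral of_int_of_nat_eq
  of_nat_numeral of_int_1 of_int_0 add_divide_distrib diff_divide_distrib minus_divide_left[symmetric]

lemma less_width: "i < width n k \<longleftrightarrow> i + (k + 1) div 2 < n"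
  by (auto simp: width_def)

lemma zig_le: "0 \<le> k \<Longrightarrow> zig k \<le> of_int k / 2"
  by (cases "k = 0") (auto simp: zig_def not_less not_le)

lemma ball_geo:
  "(\<forall>(u, l)\<in>geo (U k i). Q u l) \<longleftrightarrow> Q (zig (int k) + real i) (int k) \<and> Q (zig (int k) + real i + 1) (int k)
    \<and> Q (zig (int k) + real i + 1/2) (int k + 1)"
  "(\<forall>(u, l)\<in>geo (D k i). Q u l) \<longleftrightarrow> Q (zig (int k) + real i) (int k) \<and> Q (zig (int k) + real i + 1) (int k)
    \<and> Q (zig (int k) + real i + 1/2) (int k - 1)"
  by (simp_all add: up_tri_def down_tri_def)

lemma ball_geo':
  "(\<forall>(u, l)\<in>geo' (U k i). Q u l) \<longleftrightarrow> Q (zig (int k) + real i) (- int k) \<and> Q (zig (int k) + real i + 1) (- int k)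
    \<and> Q (zig (int k) + real i + 1/2) (- int k - 1)"
  "(\<forall>(u, l)\<in>geo' (D k i). Q u l) \<longleftrightarrow> Q (zig (int k) + real i) (- int k) \<and> Q (zig (int k) + real i + 1) (- int k)
    \<and> Q (zig (int k) + real i + 1/2) (- int k + 1)"
  by (simp_all add: up_tri_def down_tri_def)

lemma trapezoid_geo:
  "region_between 0 (2 * int h - 1) zig (\<lambda>k. real n - of_int k / 2) = geo ` trapezoid n (2 * h - 1) 0"
proof (rule region_geo)
  fix x assume "upper_tri x"
  show "x \<in> trapezoid n (2 * h - 1) 0 \<longleftrightarrow>
    (\<forall>(u, k)\<in>geo x. 0 \<le> k \<and> k \<le> 2 * int h - 1 \<and> zig k \<le> u \<and> u \<le> real n - of_int k / 2)"
  proof (cases x)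
    case (U k i)
    show ?thesis unfolding U ball_geo
      by (cases "even k"; auto elim!: evenE oddE simp: zig_def not_less not_le less_width less_diff_conv; (simp only: to_real)?; linarith)
  next
    case (D k i)
    show ?thesis using \<open>upper_tri x\<close> unfolding D ball_geo
      by (cases "even k"; auto elim!: evenE oddE simp: zig_def not_less not_le less_width less_diff_conv; (simp only: to_real)?; linarith)
  qed
next
  show "x \<in> trapezoid n (2 * h - 1) 0 \<Longrightarrow> upper_tri x" for x by (cases x) auto
qed auto

lemma up_dent_geo: "up_dent p s = geo ` dent p s"
  unfolding up_dent_def
proof (rule region_geo)
  fix x assume "upper_tri x"
  show "x \<in> dent p s \<longleftrightarrow> (\<forall>(u, k)\<in>geo x. 0 \<le> k \<and> k \<le> int s
      \<and> real p + of_int k / 2 \<le> u \<and> u \<le> real p + real s - of_int k / 2)"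
  proof (cases x)
    case (U k i)
    show ?thesis unfolding U ball_geo
      by (cases "even k"; auto elim!: evenE oddE simp: zig_def not_less not_le in_dent_def; (simp only: to_real)?; linarith)
  next
    case (D k i)
    show ?thesis using \<open>upper_tri x\<close> unfolding D ball_geo
      by (cases "even k"; auto elim!: evenE oddE simp: zig_def not_less not_le in_dent_def; (simp only: to_real)?; linarith)
  qed
next
  show "x \<in> dent p s \<Longrightarrow> upper_tri x" for x by (cases x) auto
  show "zig k \<le> real p + of_int k / 2" if "0 \<le> k" for k using zig_le[OF that] by simp
qed auto

lemma down_dent_geo': "down_dent p s = geo' ` dent p s"
  unfolding down_dent_def
proof (rule region_geo')
  fix x assume "upper_tri x"
  show "x \<in> dent p s \<longleftrightarrow> (\<forall>(u, k)\<in>geo' x. - int s \<le> k \<and> k \<le> 0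
      \<and> real p - of_int k / 2 \<le> u \<and> u \<le> real p + real s + of_int k / 2)"
  proof (cases x)
    case (U k i)
    show ?thesis unfolding U ball_geo'
      by (cases "even k"; auto elim!: evenE oddE simp: zig_def not_less not_le in_dent_def; (simp only: to_real)?; linarith)
  next
    case (D k i)
    show ?thesis using \<open>upper_tri x\<close> unfolding D ball_geo'
      by (cases "even k"; auto elim!: evenE oddE simp: zig_def not_less not_le in_dent_def; (simp only: to_real)?; linarith)
  qed
next
  show "x \<in> dent p s \<Longrightarrow> upper_tri x" for x by (cases x) auto
  show "zig k \<le> real p - of_int k / 2" if "k \<le> 0" for k using zig_le[of "- k"] that by simp
qed auto

text \<open>No triangle straddles the line u = a_1 - k/2, so failing the vertex test there is the
  same as lying in the half dent.\<close>

lemma W_upper_geo: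
  "W_upper x y a b = geo ` (trapezoid (W_len x y a b) (2 * (y + osum a + osum b) - 1) 0 - half_dent (nth1 a 1))"
proof -
  have "(\<forall>(u, k)\<in>geo t. real c - of_int k / 2 \<le> u) \<longleftrightarrow> t \<notin> half_dent c" if "upper_tri t" for t c
  proof (cases t)
    case (U k i)
    show ?thesis unfolding U ball_geo
      by (cases "even k"; auto elim!: evenE oddE simp: zig_def not_less not_le; (simp only: to_real)?; linarith)
  next
    case (D k i)
    show ?thesis using that unfolding D ball_geo
      by (cases "even k"; auto elim!: evenE oddE simp: zig_def not_less not_le; (simp only: to_real)?; linarith)
  qed
  moreover have "upper_tri t" if "t \<in> trapezoid n K 0" for t n K using that by (cases t) auto
  ultimately show ?thesis unfolding W_upper_def W_top_def trapezoid_geo by blast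
qed

text \<open>The bulge to the east is undone by enlarging the trapezoid to base length L + z and
  cutting out an artificial dent of side z at L. This dent is what the last entry z of
  \<open>t_minus\<close> records.\<close>

lemma W_lower_geo':
  "W_lower x y z a b = geo' ` (trapezoid (W_len x y a b + z) (2 * (y + z + esum a + esum b) - 1) 0 - dent (W_len x y a b) z)"
  unfolding W_lower_def W_bot_def
proof (rule region_geo')
  fix t assume t: "upper_tri t"
  let ?L = "W_len x y a b" and ?h = "y + z + esum a + esum b"
  show "t \<in> trapezoid (?L + z) (2 * ?h - 1) 0 - dent ?L z \<longleftrightarrow> (\<forall>(u, k)\<in>geo' t.
      - (2 * int ?h - 1) \<le> k \<and> k \<le> 0 \<and> zig k \<le> u \<and>
      u \<le> (if - int z \<le> k then real ?L - of_int k / 2 else real ?L + real z + of_int k / 2))"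
  proof (cases t)
    case (U k i)
    show ?thesis unfolding U ball_geo'
      by (cases "even k"; cases "k < z"; cases "k = z"; auto elim!: evenE oddE simp: zig_def not_less not_le less_width less_diff_conv in_dent_def; (simp only: to_real)?; linarith)
  next
    case (D k i)
    show ?thesis using t unfolding D ball_geo'
      by (cases "even k"; cases "k < z"; cases "k = z"; auto elim!: evenE oddE simp: zig_def not_less not_le less_width less_diff_conv in_dent_def; (simp only: to_real)?; linarith)
  qed
next
  show "t \<in> trapezoid n K 0 - dent L z \<Longrightarrow> upper_tri t" for t n K L by (cases t) auto
qed auto

section \<open>Dents described by sequences\<close>

lemma psum_0 [simp]: "psum xs 0 = 0"
  by (simp add: psum_def)

lemma psum_Suc: "psum xs (Suc k) = psum xs k + nth1 xs (Suc k)"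
  by (simp add: psum_def)

lemma psum_mono: "i \<le> j \<Longrightarrow> psum xs i \<le> psum xs j"
  by (induction j rule: dec_induct) (simp_all add: psum_Suc)

lemma psum_take: "psum xs k = sum_list (take k xs)"
proof (induction k)
  case (Suc k)
  then show ?case by (cases "k < length xs") (simp_all add: psum_Suc nth1_def take_Suc_conv_app_nth)
qed simp

lemma psum_all: "length xs \<le> k \<Longrightarrow> psum xs k = sum_list xs"
  by (simp add: psum_take)

lemma psum_le: "psum xs k \<le> sum_list xs"
  using psum_mono[of k "max k (length xs)" xs] psum_all[of xs "max k (length xs)"] by simp

text \<open>The i-th block, counted from 1; truncated subtraction makes block 0 empty, as are the
  blocks beyond the list, so \<open>cells\<close> needs no bound on i.\<close>

definition cell :: "nat list \<Rightarrow> nat \<Rightarrow> nat set" where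
  "cell xs i = {psum xs (i - 1)..<psum xs i}"

definition cells :: "(nat \<Rightarrow> bool) \<Rightarrow> nat list \<Rightarrow> nat set" where
  "cells p xs = (\<Union>i\<in>Collect p. cell xs i)"

lemma cell_0 [simp]: "cell xs 0 = {}"
  by (simp add: cell_def)

lemma cell_beyond: "length xs < i \<Longrightarrow> cell xs i = {}"
  by (simp add: cell_def psum_all)

lemma cell_disjoint:
  assumes "i \<noteq> j"
  shows "cell xs i \<inter> cell xs j = {}"
proof (cases "i = 0 \<or> j = 0")
  case False
  show ?thesis
  proof (cases "i < j")
    case True
    then have "psum xs i \<le> psum xs (j - 1)" by (intro psum_mono) simp
    then show ?thesis by (auto simp: cell_def)
  next
    case nless: False
    then have "psum xs j \<le> psum xs (i - 1)" using assms by (intro psum_mono) simp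
    then show ?thesis by (auto simp: cell_def)
  qed
qed auto

lemma card_cell_list: "0 < i \<Longrightarrow> card (cell xs i) = nth1 xs i"
  using psum_Suc[of xs "i - 1"] by (simp add: cell_def)

lemma cells_subset: "cells p xs \<subseteq> {..<sum_list xs}"
  using psum_le[of xs] by (force simp: cells_def cell_def intro: less_le_trans)

lemma finite_cells [simp]: "finite (cells p xs)"
  using cells_subset finite_subset by blast

lemma cells_disjoint: "(\<And>i. p i \<Longrightarrow> \<not> q i) \<Longrightarrow> cells p xs \<inter> cells q xs = {}"
proof (rule equals0I)
  fix x assume pq: "\<And>i. p i \<Longrightarrow> \<not> q i" and "x \<in> cells p xs \<inter> cells q xs"
  then obtain i j where "p i" "x \<in> cell xs i" "q j" "x \<in> cell xs j" by (auto simp: cells_def)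
  then show False using cell_disjoint[of i j xs] pq[of i] by (cases "i = j") auto
qed

lemma cells_cover:
  assumes "x < sum_list xs"
  shows "\<exists>i. x \<in> cell xs i"
proof -
  have "x \<in> {psum xs 0..<psum xs (length xs)}" using assms by (simp add: psum_all)
  then obtain i where "x \<in> {psum xs i..<psum xs (Suc i)}" using in_some_cell[of x "psum xs"] by blast
  then have "x \<in> cell xs (Suc i)" by (simp add: cell_def)
  then show ?thesis by blast
qed

lemma cells_odd_Un_even: "cells odd xs \<union> cells even xs = {..<sum_list xs}"
proof (intro equalityI subsetI)
  fix x assume "x \<in> {..<sum_list xs}"
  then obtain i where "x \<in> cell xs i" using cells_cover by blast
  then show "x \<in> cells odd xs \<union> cells even xs" unfolding cells_def by blast
qed (use cells_subset in blast)

lemma cells_bounded: "cells p xs = (\<Union>i\<in>{i\<in>{1..length xs}. p i}. cell xs i)"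
proof (intro equalityI subsetI)
  fix x assume "x \<in> cells p xs"
  then obtain i where "p i" "x \<in> cell xs i" by (auto simp: cells_def)
  moreover have "i \<noteq> 0 \<and> i \<le> length xs" using cell_beyond[of xs i] \<open>x \<in> cell xs i\<close>
    by (metis cell_0 empty_iff not_le)
  ultimately have "i \<in> {i\<in>{1..length xs}. p i}" by simp
  then show "x \<in> (\<Union>i\<in>{i\<in>{1..length xs}. p i}. cell xs i)" using \<open>x \<in> cell xs i\<close> by blast
qed (auto simp: cells_def)

lemma card_cells: "card (cells p xs) = (\<Sum>i | i \<in> {1..length xs} \<and> p i. nth1 xs i)"
proof -
  have "card (cells p xs) = (\<Sum>i | i \<in> {1..length xs} \<and> p i. card (cell xs i))"
    unfolding cells_bounded
    by (rule card_UN_disjoint) (use cell_disjoint in \<open>auto simp: cell_def\<close>)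
  then show ?thesis by (simp add: card_cell_list)
qed

lemma card_cells_odd: "card (cells odd xs) = osum xs" and card_cells_even: "card (cells even xs) = esum xs"
  by (simp_all add: card_cells osum_def esum_def)

lemma osum_plus_esum: "osum xs + esum xs = sum_list xs"
proof -
  have "card (cells odd xs \<union> cells even xs) = osum xs + esum xs"
    by (subst card_Un_disjoint) (auto simp: card_cells_odd card_cells_even cells_disjoint)
  then show ?thesis by (simp add: cells_odd_Un_even)
qed

lemma nth1_le_card_cells:
  assumes "p i"
  shows "nth1 xs i \<le> card (cells p xs)"
proof (cases "i = 0")
  case False
  then have "nth1 xs i = card (cell xs i)" by (simp add: card_cell_list)
  also have "\<dots> \<le> card (cells p xs)"
    by (rule card_mono[OF finite_cells]) (use assms in \<open>auto simp: cells_def\<close>)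
  finally show ?thesis .
qed (simp add: nth1_def)

text \<open>The case of \<open>tiling_sum_dented\<close> with neither half dent nor crossings: the
  dents are the blocks of even index, and their sides add up to \<open>esum t\<close>, the required
  number of positions.\<close>

lemma K'_eq: "K' t = delta (cells even t) / H2 (2 * esum t)"
proof (cases "esum t = 0")
  case True
  then have "cells even t = {}" using card_cells_even[of t] by simp
  then show ?thesis using True by (simp add: K'_def delta_def H2_def)
next
  case False
  let ?h = "esum t" and ?n = "osum t + esum t"
  let ?E = "(\<lambda>i. (psum t (2 * i - 1), nth1 t (2 * i))) ` {1..length t div 2}"
  let ?T = "trapezoid ?n (2 * ?h - 1) 0"
  have base: "dent_base ?E = cells even t"
  proof -
    have e: "(\<lambda>i. 2 * i) ` {1..length t div 2} = {i\<in>{1..length t}. even i}"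
    proof (intro equalityI subsetI)
      fix j assume "j \<in> {i\<in>{1..length t}. even i}"
      then show "j \<in> (\<lambda>i. 2 * i) ` {1..length t div 2}" by (auto elim!: evenE)
    qed auto
    have "cells even t = (\<Union>i\<in>{1..length t div 2}. cell t (2 * i))"
      unfolding cells_bounded e[symmetric] by (simp only: image_image)
    also have "\<dots> = (\<Union>i\<in>{1..length t div 2}. {psum t (2 * i - 1)..<psum t (2 * i - 1) + nth1 t (2 * i)})"
    proof (rule SUP_cong[OF refl])
      fix i assume "i \<in> {1..length t div 2}"
      then have "psum t (2 * i) = psum t (2 * i - 1) + nth1 t (2 * i)" using psum_Suc[of t "2 * i - 1"] by simp
      then show "cell t (2 * i) = {psum t (2 * i - 1)..<psum t (2 * i - 1) + nth1 t (2 * i)}" by (simp add: cell_def)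
    qed
    finally show ?thesis by (simp add: dent_base_def)
  qed
  have R: "quartered_hexagon t = geo ` (?T - half_dent 0 - (\<Union>(p, s)\<in>?E. dent p s) - U 0 ` {})"
  proof -
    have "half_dent 0 = {}" by (auto simp: half_dent_def)
    then show ?thesis
      unfolding quartered_hexagon_def up_dent_geo using trapezoid_geo[of ?h ?n] inj_geo
      by (simp add: image_set_diff image_UN)
  qed
  have "K' t = tiling_sum loz wt (?T - half_dent 0 - (\<Union>(p, s)\<in>?E. dent p s) - U 0 ` {})"
    unfolding K'_def M_eq_tiling_sum R using False
    by (subst tiling_sum_geo[of _ ?n "2 * ?h - 1" _ 0]) (auto simp: of_nat_diff)
  also have "\<dots> = 2 ^ (0 - 1) * (if card (cells even t) = ?h then delta (cells even t) / H2 (2 * ?h) else 0)"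
  proof (rule tiling_sum_dented[where E = ?E and S = "{}" and a = 0])
    fix p s assume "(p, s) \<in> ?E"
    then obtain i where i: "1 \<le> i" "p = psum t (2 * i - 1)" "s = nth1 t (2 * i)" by auto
    then have "p + s = psum t (2 * i)" using psum_Suc[of t "2 * i - 1"] by simp
    then show "p + s \<le> ?n \<and> s \<le> ?h"
      using psum_le[of t "2 * i"] nth1_le_card_cells[of even "2 * i" t] i(3) by (simp add: osum_plus_esum card_cells_even)
  next
    show "cells even t = {..<0} \<union> dent_base ?E \<union> {}" unfolding base by simp
  qed auto
  finally show ?thesis by (simp add: card_cells_even)
qed

text \<open>The blocks of b are measured from the east end, so unit segment v of [0, n] becomes n -
  1 - v.\<close>

definition mirror :: "nat \<Rightarrow> nat set \<Rightarrow> nat set" where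
  "mirror n X = (\<lambda>v. n - 1 - v) ` X"

lemma inj_on_mirror: "X \<subseteq> {..<n::nat} \<Longrightarrow> inj_on (\<lambda>v. n - 1 - v) X"
proof (rule inj_onI)
  fix x y assume "X \<subseteq> {..<n}" "x \<in> X" "y \<in> X" "n - 1 - x = n - 1 - y"
  moreover from this have "x < n" "y < n" by auto
  ultimately show "x = y" by arith
qed

lemma mirror_interval: "q \<le> n \<Longrightarrow> mirror n {p..<q} = {n - q..<n - p}"
proof (intro equalityI subsetI)
  fix x assume "q \<le> n" "x \<in> {n - q..<n - p}"
  then have "n - 1 - x \<in> {p..<q}" "x = n - 1 - (n - 1 - x)" by auto
  then show "x \<in> mirror n {p..<q}" unfolding mirror_def by blast
qed (auto simp: mirror_def)

lemma mirror_cell: "sum_list b \<le> n \<Longrightarrow> mirror n (cell b i) = {n - psum b i..<n - psum b (i - 1)}"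
  unfolding cell_def using psum_le[of b i] by (intro mirror_interval) simp

lemma psum_append: "psum (xs @ ys) k = psum xs k + psum ys (k - length xs)"
  by (simp add: psum_take)

lemma psum_Cons: "psum (t # xs) (Suc k) = t + psum xs k"
  by (simp add: psum_take)

lemma psum_prefix:
  assumes "k < n"
  shows "psum (map (nth1 a) [1..<n]) k = psum a k"
  unfolding psum_def by (rule sum.cong[OF refl]) (use assms in \<open>auto simp: nth1_def\<close>)

lemma psum_prefix_all: "n - 1 \<le> k \<Longrightarrow> 0 < n \<Longrightarrow> psum (map (nth1 a) [1..<n]) k = psum a (n - 1)"
  using psum_prefix[of "n - 1" n a] psum_all[of "map (nth1 a) [1..<n]"] by simp

lemma psum_rev_prefix:
  assumes "q < n"
  shows "psum (rev (map (nth1 b) [1..<n])) q + psum b (n - 1 - q) = psum b (n - 1)"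
  using assms
proof (induction q)
  case (Suc q)
  have "nth1 (rev (map (nth1 b) [1..<n])) (Suc q) = nth1 b (n - 1 - q)"
    using Suc.prems by (auto simp: nth1_def[of "rev _"] rev_nth Suc_diff_Suc)
  moreover have "psum b (n - 1 - q) = psum b (n - 1 - Suc q) + nth1 b (n - 1 - q)"
    using psum_Suc[of b "n - 1 - Suc q"] Suc.prems by (simp add: Suc_diff_Suc)
  ultimately show ?case using Suc by (simp add: psum_Suc)
qed simp

text \<open>The leading 0 moves the odd blocks of a to even indices. As \<open>\<mu>\<close> and
  \<open>\<nu>\<close> are even, the middle entry has odd index \<open>\<mu> + 1\<close>, and the
  entry at index \<open>\<mu> + 1 + q\<close> is block \<open>\<nu> - q\<close> of b, with the
  parities reversed likewise.\<close>

lemma cells_t_plus: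
  "cells even (t_plus x y a b)
    = cells odd a \<union> mirror (W_len x y a b) (cells odd b)"
proof -
  let ?L = "W_len x y a b" and ?t = "t_plus x y a b"
  define \<mu> where "\<mu> = 2 * ((seq_len a + 1) div 2)"
  define \<nu> where "\<nu> = 2 * ((seq_len b + 1) div 2)"
  have \<mu>: "even \<mu>" "0 < \<mu>" "length a \<le> \<mu>" and \<nu>: "even \<nu>" "0 < \<nu>" "length b \<le> \<nu>"
    by (auto simp: \<mu>_def \<nu>_def seq_len_def)
  have t: "?t = 0 # map (nth1 a) [1..<\<mu>] @ [nth1 a \<mu> + x + y + nth1 b \<nu>] @ rev (map (nth1 b) [1..<\<nu>])"
    by (simp add: t_plus_def Let_def \<mu>_def \<nu>_def)
  have len: "length ?t = \<mu> + \<nu>" using \<mu> \<nu> unfolding t by simp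
  have p1: "psum ?t (Suc i) = psum a i" if "i < \<mu>" for i
    using that psum_prefix[of i \<mu> a] unfolding t psum_Cons psum_append by simp
  \<comment> \<open>The entries from the middle one on are located from the east end: what is left
    to the right of them is an initial part of b.\<close>
  have p2: "psum ?t (\<mu> + 1 + q) = ?L - psum b (\<nu> - 1 - q)" if "q < \<nu>" for q
  proof -
    have "psum ?t (\<mu> + 1 + q) = psum a (\<mu> - 1) + (nth1 a \<mu> + x + y + nth1 b \<nu> + psum (rev (map (nth1 b) [1..<\<nu>])) q)"
      using \<mu>(2) psum_prefix_all[of \<mu> "\<mu> + q" a] unfolding t
      by (simp add: psum_Cons psum_append del: map_append upt_Suc)
    moreover have "psum a (\<mu> - 1) + nth1 a \<mu> = sum_list a"
      using psum_Suc[of a "\<mu> - 1"] \<mu> psum_all[of a \<mu>] by simp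
    moreover have "psum b (\<nu> - 1) + nth1 b \<nu> = sum_list b"
      using psum_Suc[of b "\<nu> - 1"] \<nu> psum_all[of b \<nu>] by simp
    ultimately show ?thesis using psum_rev_prefix[OF that, of b] by (simp add: W_len_def)
  qed
  have c1: "cell ?t (Suc i) = cell a i" if "0 < i" "i < \<mu>" for i
    using p1[of "i - 1"] p1[of i] that by (simp add: cell_def)
  have c2: "cell ?t (\<mu> + 1 + q) = mirror ?L (cell b (\<nu> - q))" if "0 < q" "q < \<nu>" for q
  proof -
    have "\<mu> + 1 + q - 1 = \<mu> + 1 + (q - 1)" using that by simp
    then show ?thesis
      using p2[of "q - 1"] p2[of q] that
      by (subst mirror_cell) (auto simp: cell_def W_len_def diff_diff_eq add.commute)
  qed
  show ?thesis
  proof (intro equalityI subsetI)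
    fix v assume "v \<in> cells even ?t"
    then obtain j where j: "even j" "v \<in> cell ?t j" by (auto simp: cells_def)
    have "j \<le> \<mu> + \<nu>" using j cell_beyond[of ?t j] len by (auto simp: not_less[symmetric])
    have "j \<noteq> 0" using j(2) by (cases j) auto
    then obtain i where i: "j = Suc i" "odd i" using j(1) by (cases j) auto
    show "v \<in> cells odd a \<union> mirror ?L (cells odd b)"
    proof (cases "i < \<mu>")
      case True
      then have "v \<in> cell a i" using c1[of i] i j by (simp add: odd_pos)
      then show ?thesis using i(2) by (auto simp: cells_def)
    next
      case False
      define q where "q = i - \<mu>"
      have q: "odd q" "q < \<nu>" "j = \<mu> + 1 + q" using False i \<mu>(1) \<open>j \<le> \<mu> + \<nu>\<close> by (auto simp: q_def)
      then have "v \<in> mirror ?L (cell b (\<nu> - q))" using c2[of q] j(2) by (simp add: odd_pos)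
      moreover have "odd (\<nu> - q)" using q \<nu>(1) by simp
      ultimately show ?thesis unfolding cells_def mirror_def by blast
    qed
  next
    fix v assume "v \<in> cells odd a \<union> mirror ?L (cells odd b)"
    then consider i where "odd i" "v \<in> cell a i" | j where "odd j" "v \<in> mirror ?L (cell b j)"
      unfolding cells_def mirror_def by blast
    then show "v \<in> cells even ?t"
    proof cases
      case 1
      then have "i \<le> \<mu>" using cell_beyond[of a i] \<mu>(3) by (metis empty_iff le_trans not_le)
      then have "i < \<mu>" using 1(1) \<mu>(1) by (cases "i = \<mu>") auto
      then have "v \<in> cell ?t (Suc i)" using c1[of i] 1 by (simp add: odd_pos)
      then show ?thesis using 1(1) unfolding cells_def by (intro UN_I[of "Suc i"]) auto
    next
      case 2
      then have "j \<le> \<nu>" using cell_beyond[of b j] \<nu>(3) unfolding mirror_def by (metis empty_iff image_empty le_trans not_le)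
      then have "j < \<nu>" using 2(1) \<nu>(1) by (cases "j = \<nu>") auto
      then have "v \<in> cell ?t (\<mu> + 1 + (\<nu> - j))" using c2[of "\<nu> - j"] 2 by (simp add: odd_pos)
      moreover have "even (\<mu> + 1 + (\<nu> - j))" using 2(1) \<mu>(1) \<nu>(1) \<open>j < \<nu>\<close> by simp
      ultimately show ?thesis unfolding cells_def by blast
    qed
  qed
qed

text \<open>Without a leading 0 the blocks of a keep their index, and index
  \<open>\<mu> + 1 + q\<close> holds block \<open>\<nu> + 1 - q\<close> of b, so even blocks stay
  even; the final entry z has the even index \<open>\<mu> + \<nu> + 2\<close>.\<close>

lemma cells_t_minus:
  "cells even (t_minus x y z a b)
    = cells even a \<union> mirror (W_len x y a b) (cells even b) \<union> {W_len x y a b..<W_len x y a b + z}"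
proof -
  let ?L = "W_len x y a b" and ?t = "t_minus x y z a b"
  define \<mu> where "\<mu> = 2 * (seq_len a div 2)"
  define \<nu> where "\<nu> = 2 * (seq_len b div 2)"
  have \<mu>: "even \<mu>" "length a \<le> \<mu> + 1" and \<nu>: "even \<nu>" "length b \<le> \<nu> + 1"
    by (auto simp: \<mu>_def \<nu>_def seq_len_def)
  have t: "?t = map (nth1 a) [1..<\<mu> + 1] @ [nth1 a (\<mu> + 1) + x + y + nth1 b (\<nu> + 1)] @ rev (map (nth1 b) [1..<\<nu> + 1]) @ [z]"
    by (simp add: t_minus_def Let_def \<mu>_def \<nu>_def)
  have len: "length ?t = \<mu> + \<nu> + 2" unfolding t by simp
  have p1: "psum ?t i = psum a i" if "i \<le> \<mu>" for i
    using that psum_prefix[of i "\<mu> + 1" a] unfolding t psum_append by simp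
  have mid: "psum ?t (\<mu> + 1 + q) = sum_list a + x + y + nth1 b (\<nu> + 1)
      + psum (rev (map (nth1 b) [1..<\<nu> + 1])) q + psum [z] (q - \<nu>)" for q
  proof -
    have "psum ?t (\<mu> + 1 + q) = psum a \<mu> + (nth1 a (\<mu> + 1) + x + y + nth1 b (\<nu> + 1)
        + (psum (rev (map (nth1 b) [1..<\<nu> + 1])) q + psum [z] (q - \<nu>)))"
      using psum_prefix_all[of "\<mu> + 1" "\<mu> + 1 + q" a] unfolding t
      by (simp add: psum_Cons psum_append del: map_append upt_Suc)
    moreover have "psum a \<mu> + nth1 a (\<mu> + 1) = sum_list a"
      using psum_Suc[of a \<mu>] \<mu> psum_all[of a "\<mu> + 1"] by simp
    ultimately show ?thesis by simp
  qed
  have sb: "psum b \<nu> + nth1 b (\<nu> + 1) = sum_list b"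
    using psum_Suc[of b \<nu>] \<nu> psum_all[of b "\<nu> + 1"] by simp
  have p2: "psum ?t (\<mu> + 1 + q) = ?L - psum b (\<nu> - q)" if "q \<le> \<nu>" for q
    using mid[of q] sb psum_rev_prefix[of q "\<nu> + 1" b] that by (simp add: W_len_def)
  have p3: "psum ?t (\<mu> + \<nu> + 2) = ?L + z"
  proof -
    have "psum (rev (map (nth1 b) [1..<\<nu> + 1])) (\<nu> + 1) = psum b \<nu>"
      using psum_rev_prefix[of \<nu> "\<nu> + 1" b] psum_all[of "rev (map (nth1 b) [1..<\<nu> + 1])"] by simp
    then show ?thesis using mid[of "\<nu> + 1"] sb psum_Cons[of z "[]" 0] by (simp add: W_len_def)
  qed
  have c1: "cell ?t i = cell a i" if "i \<le> \<mu>" for i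
    using p1[of "i - 1"] p1[of i] that by (simp add: cell_def)
  have c2: "cell ?t (\<mu> + 1 + q) = mirror ?L (cell b (\<nu> + 1 - q))" if "0 < q" "q \<le> \<nu>" for q
  proof -
    have "\<mu> + 1 + q - 1 = \<mu> + 1 + (q - 1)" "\<nu> - (q - 1) = \<nu> + 1 - q" "\<nu> + 1 - q - 1 = \<nu> - q" using that by auto
    then show ?thesis
      using p2[of "q - 1"] p2[of q] that
      by (subst mirror_cell) (simp_all add: cell_def W_len_def)
  qed
  have c3: "cell ?t (\<mu> + \<nu> + 2) = {?L..<?L + z}"
    using p2[of \<nu>] p3 by (simp add: cell_def)
  show ?thesis
  proof (intro equalityI subsetI)
    fix v assume "v \<in> cells even ?t"
    then obtain j where j: "even j" "v \<in> cell ?t j" by (auto simp: cells_def)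
    then have "j \<le> \<mu> + \<nu> + 2" using cell_beyond[of ?t j] len by (auto simp: not_less[symmetric])
    show "v \<in> cells even a \<union> mirror ?L (cells even b) \<union> {?L..<?L + z}"
    proof (cases "j \<le> \<mu>")
      case True
      then have "v \<in> cell a j" using c1[of j] j by simp
      then show ?thesis using j(1) by (auto simp: cells_def)
    next
      case False
      define q where "q = j - \<mu> - 1"
      have "j \<noteq> \<mu> + 1" using j(1) \<mu>(1) by auto
      then have q: "odd q" "q \<le> \<nu> + 1" "j = \<mu> + 1 + q"
        using False j(1) \<mu>(1) \<open>j \<le> \<mu> + \<nu> + 2\<close> by (auto simp: q_def)
      show ?thesis
      proof (cases "q \<le> \<nu>")
        case True
        then have "v \<in> mirror ?L (cell b (\<nu> + 1 - q))" using c2[of q] j(2) q by (simp add: odd_pos)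
        moreover have "even (\<nu> + 1 - q)" using q \<nu>(1) by simp
        ultimately show ?thesis unfolding cells_def mirror_def by blast
      next
        case False
        then have "j = \<mu> + \<nu> + 2" using q by simp
        then show ?thesis using j(2) c3 by simp
      qed
    qed
  next
    fix v assume "v \<in> cells even a \<union> mirror ?L (cells even b) \<union> {?L..<?L + z}"
    then consider i where "even i" "v \<in> cell a i" | j where "even j" "v \<in> mirror ?L (cell b j)" | "v \<in> {?L..<?L + z}"
      unfolding cells_def mirror_def by blast
    then show "v \<in> cells even ?t"
    proof cases
      case 1
      then have "i \<le> \<mu> + 1" using cell_beyond[of a i] \<mu>(2) by (metis empty_iff le_trans not_le)
      then have "i \<le> \<mu>" using 1(1) \<mu>(1) by (cases "i = \<mu> + 1") auto
      then have "v \<in> cell ?t i" using c1[of i] 1 by simp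
      then show ?thesis using 1(1) unfolding cells_def by blast
    next
      case 2
      then have "j \<le> \<nu> + 1" "j \<noteq> 0" using cell_beyond[of b j] \<nu>(2) cell_0[of b] unfolding mirror_def
        by (metis empty_iff image_empty le_trans not_le)+
      then have "j \<le> \<nu>" using 2(1) \<nu>(1) by (cases "j = \<nu> + 1") auto
      then have "v \<in> cell ?t (\<mu> + 1 + (\<nu> + 1 - j))" using c2[of "\<nu> + 1 - j"] 2 \<open>j \<noteq> 0\<close> by simp
      moreover have "even (\<mu> + 1 + (\<nu> + 1 - j))" using 2(1) \<mu>(1) \<nu>(1) \<open>j \<le> \<nu>\<close> by simp
      ultimately show ?thesis unfolding cells_def by blast
    next
      case 3
      then have "v \<in> cell ?t (\<mu> + \<nu> + 2)" using c3 by simp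
      moreover have "even (\<mu> + \<nu> + 2)" using \<mu>(1) \<nu>(1) by simp
      ultimately show ?thesis unfolding cells_def by blast
    qed
  qed
qed

section \<open>Splitting along the base line\<close>

text \<open>The base consists of lattice edges, so across it only the two triangles over the same
  unit segment are adjacent.\<close>

lemma card_geo_Int_geo':
  assumes "upper_tri s" "upper_tri t"
  shows "card (geo s \<inter> geo' t) = 2 \<longleftrightarrow> (\<exists>i. s = U 0 i \<and> t = U 0 i)"
proof (cases s)
  case s: (U k i)
  show ?thesis
  proof (cases t)
    case (U k' i')
    show ?thesis unfolding s U geo.simps geo'.simps card_up_Int_down by (auto simp: zig_def)
  next
    case (D k' i')
    then show ?thesis using s card_up_Int_up by simp
  qed
next
  case s: (D k i)
  show ?thesis
  proof (cases t)
    case (U k' i')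
    then show ?thesis using s card_down_Int_down by simp
  next
    case (D k' i')
    show ?thesis
      using assms unfolding s D geo.simps geo'.simps Int_commute[of "down_tri _ _"] card_up_Int_down by auto
  qed
qed

lemma geo_neq_geo':
  assumes "upper_tri s" "upper_tri t"
  shows "geo s \<noteq> geo' t"
  using assms by (cases s; cases t) auto

definition crossing :: "nat \<Rightarrow> lozenge" where
  "crossing i = {geo (U 0 i), geo' (U 0 i)}"

text \<open>A set of tiles across the base is given by the set S of its positions, and it removes
  the same bottom triangles from both parts.\<close>

lemma tiling_sum_geo_Un:
  assumes fin: "finite A" "finite B" and up: "\<And>t. t \<in> A \<union> B \<Longrightarrow> upper_tri t"
  shows "tiling_sum is_lozenge w (geo ` A \<union> geo' ` B)
    = (\<Sum>S\<in>Pow {i. U 0 i \<in> A \<and> U 0 i \<in> B}. (\<Prod>i\<in>S. w (crossing i))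
        * (tiling_sum is_lozenge w (geo ` (A - U 0 ` S)) * tiling_sum is_lozenge w (geo' ` (B - U 0 ` S))))"
proof -
  let ?G = "{i. U 0 i \<in> A \<and> U 0 i \<in> B}"
  have neq: "geo s \<noteq> geo' t" if "s \<in> A \<union> B" "t \<in> A \<union> B" for s t
    using geo_neq_geo' up that by blast
  have dis: "geo ` A \<inter> geo' ` B = {}" using neq by blast
  have inj: "inj_on crossing S" for S
  proof (rule inj_onI)
    fix i j assume "crossing i = crossing j"
    moreover have "geo (U 0 i) \<noteq> geo' (U 0 j)" by (rule geo_neq_geo') simp_all
    ultimately have "geo (U 0 i) = geo (U 0 j)" unfolding crossing_def by (metis doubleton_eq_iff)
    then show "i = j" by simp
  qed
  have "crossings is_lozenge (geo ` A) (geo' ` B) = (`) crossing ` Pow ?G"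
  proof (intro equalityI subsetI)
    fix C assume C: "C \<in> crossings is_lozenge (geo ` A) (geo' ` B)"
    have "\<exists>i\<in>?G. l = crossing i" if "l \<in> C" for l
    proof -
      have l: "is_lozenge l" "l \<inter> geo ` A \<noteq> {}" "l \<inter> geo' ` B \<noteq> {}"
        using C that by (auto simp: crossings_def)
      obtain s t where st: "s \<in> A" "t \<in> B" "geo s \<in> l" "geo' t \<in> l" using l(2,3) by blast
      obtain p q where pq: "card (p \<inter> q) = 2" "l = {p, q}" using l(1) by (auto simp: is_lozenge_def)
      have "geo s \<noteq> geo' t" using neq st by blast
      then have "l = {geo s, geo' t}" "card (geo s \<inter> geo' t) = 2"
        using st(3,4) pq by (auto simp: Int_commute)
      moreover have "\<exists>i. s = U 0 i \<and> t = U 0 i"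
        using card_geo_Int_geo' up st(1,2) calculation(2) by blast
      ultimately show ?thesis using st(1,2) by (auto simp: crossing_def)
    qed
    then have "C = crossing ` {i \<in> ?G. crossing i \<in> C}" by auto
    then show "C \<in> (`) crossing ` Pow ?G" by blast
  next
    fix C assume "C \<in> (`) crossing ` Pow ?G"
    then obtain S where S: "S \<subseteq> ?G" "C = crossing ` S" by blast
    have D: "crossing i \<inter> crossing j = {}" if "i \<noteq> j" for i j
    proof -
      have "geo (U 0 i) \<noteq> geo' (U 0 j)" "geo (U 0 j) \<noteq> geo' (U 0 i)" by (rule geo_neq_geo'; simp)+
      then show ?thesis using that by (auto simp: crossing_def)
    qed
    have "disjoint C"
    proof (rule disjointI)
      fix l l' assume "l \<in> C" "l' \<in> C" "l \<noteq> l'"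
      then obtain i j where "l = crossing i" "l' = crossing j" "i \<noteq> j" unfolding S(2) by blast
      then show "l \<inter> l' = {}" using D by simp
    qed
    moreover have "is_lozenge (crossing i) \<and> crossing i \<subseteq> geo ` A \<union> geo' ` B
        \<and> crossing i \<inter> geo ` A \<noteq> {} \<and> crossing i \<inter> geo' ` B \<noteq> {}" if "i \<in> S" for i
    proof -
      have "card (geo (U 0 i) \<inter> geo' (U 0 i)) = 2" by (subst card_geo_Int_geo') simp_all
      then have "is_lozenge (crossing i)" unfolding is_lozenge_def crossing_def using geo_unit by blast
      then show ?thesis using that S(1) unfolding crossing_def by blast
    qed
    ultimately show "C \<in> crossings is_lozenge (geo ` A) (geo' ` B)" unfolding crossings_def S(2) by blast
  qed
  then have "tiling_sum is_lozenge w (geo ` A \<union> geo' ` B) = (\<Sum>C\<in>(`) crossing ` Pow ?G. prod w C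
      * (tiling_sum is_lozenge w (geo ` A - \<Union>C) * tiling_sum is_lozenge w (geo' ` B - \<Union>C)))"
    using tiling_sum_split[OF _ _ dis, of is_lozenge w] fin by simp
  also have "\<dots> = (\<Sum>S\<in>Pow ?G. prod w (crossing ` S)
      * (tiling_sum is_lozenge w (geo ` A - \<Union>(crossing ` S)) * tiling_sum is_lozenge w (geo' ` B - \<Union>(crossing ` S))))"
  proof (subst sum.reindex)
    have "inj crossing" by (rule inj)
    then show "inj_on ((`) crossing) (Pow ?G)" by (simp add: inj_on_def inj_image_eq_iff)
  qed simp
  also have "\<dots> = (\<Sum>S\<in>Pow ?G. (\<Prod>i\<in>S. w (crossing i))
        * (tiling_sum is_lozenge w (geo ` (A - U 0 ` S)) * tiling_sum is_lozenge w (geo' ` (B - U 0 ` S))))"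
  proof (rule sum.cong[OF refl])
    fix S assume "S \<in> Pow ?G"
    then have S: "U 0 i \<in> A" "U 0 i \<in> B" if "i \<in> S" for i using that by auto
    have eq: "\<Union>(crossing ` S) = geo ` U 0 ` S \<union> geo' ` U 0 ` S" unfolding crossing_def by blast
    have d: "geo ` A \<inter> geo' ` U 0 ` S = {}" "geo' ` B \<inter> geo ` U 0 ` S = {}"
    proof -
      show "geo ` A \<inter> geo' ` U 0 ` S = {}" using neq S by blast
      have "geo' t \<noteq> geo (U 0 i)" if "t \<in> B" "i \<in> S" for t i using neq[of "U 0 i" t] S(1)[OF that(2)] that(1) by auto
      then show "geo' ` B \<inter> geo ` U 0 ` S = {}" by blast
    qed
    have "geo ` A - \<Union>(crossing ` S) = geo ` (A - U 0 ` S)"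
      unfolding eq image_set_diff[OF inj_geo] using d(1) by blast
    moreover have "geo' ` B - \<Union>(crossing ` S) = geo' ` (B - U 0 ` S)"
      unfolding eq image_set_diff[OF inj_geo'] using d(2) by blast
    ultimately show "prod w (crossing ` S)
      * (tiling_sum is_lozenge w (geo ` A - \<Union>(crossing ` S)) * tiling_sum is_lozenge w (geo' ` B - \<Union>(crossing ` S)))
      = (\<Prod>i\<in>S. w (crossing i))
        * (tiling_sum is_lozenge w (geo ` (A - U 0 ` S)) * tiling_sum is_lozenge w (geo' ` (B - U 0 ` S)))"
      by (simp add: prod.reindex[OF inj])
  qed
  finally show ?thesis .
qed

text \<open>Of the two western sides of the crossing lozenge at 0, one lies on the upper and one on
  the lower zigzag; therefore both parts have to be nonempty.\<close>

lemma zig_weight_crossing: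
  assumes "0 < k1" "k0 < 0"
  shows "zig_weight (zig_edges 0 k1 \<union> zig_edges k0 0) (crossing i) = half0 i"
  unfolding crossing_def geo.simps geo'.simps
  using assms zig_edge_up[of 0 i 0 k1] zig_edge_up[of 0 i k0 0] zig_edge_down[of 0 i 0 k1] zig_edge_down[of 0 i k0 0]
  by (simp add: zig_weight_vertical)

text \<open>The positions of the dents above the base line (\<open>p = odd\<close>) and below it (\<open>p = even\<close>), except
  for the first dent, which does not have the shape of a full triangle if it is above the line.\<close>

definition dents :: "(nat \<Rightarrow> bool) \<Rightarrow> nat \<Rightarrow> nat list \<Rightarrow> nat list \<Rightarrow> (nat \<times> nat) set" where
  "dents p n a b = (\<lambda>i. (psum a (i - 1), nth1 a i)) ` {i\<in>{2..length a}. p i}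
    \<union> (\<lambda>j. (n - psum b j, nth1 b j)) ` {j\<in>{1..length b}. p j}"

text \<open>Both parts get the form required by \<open>tiling_sum_dented\<close>: the lower one has
  an empty half dent and the artificial dent \<open>(n, z)\<close> for its eastern bulge.\<close>

lemma W_geo:
  fixes x y z :: nat and a b :: "nat list"
  defines "n \<equiv> W_len x y a b"
  shows "W x y z a b = geo ` (trapezoid n (2 * (y + osum a + osum b) - 1) 0 - half_dent (nth1 a 1)
        - (\<Union>(p, s)\<in>dents odd n a b. dent p s))
    \<union> geo' ` (trapezoid (n + z) (2 * (y + z + esum a + esum b) - 1) 0 - half_dent 0
        - (\<Union>(p, s)\<in>insert (n, z) (dents even n a b). dent p s))"
proof -
  let ?A = "trapezoid n (2 * (y + osum a + osum b) - 1) 0 - half_dent (nth1 a 1)"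
  let ?B = "trapezoid (n + z) (2 * (y + z + esum a + esum b) - 1) 0 - dent n z"
  let ?O = "\<Union>(p, s)\<in>dents odd n a b. dent p s" and ?E = "\<Union>(p, s)\<in>dents even n a b. dent p s"
  have "a_dents a \<union> b_dents n b = geo ` ?O \<union> geo' ` ?E"
  proof -
    have "a_dents a = (\<Union>i\<in>{i\<in>{2..length a}. odd i}. geo ` dent (psum a (i - 1)) (nth1 a i))
        \<union> (\<Union>i\<in>{i\<in>{2..length a}. even i}. geo' ` dent (psum a (i - 1)) (nth1 a i))"
      unfolding a_dents_def up_dent_geo[abs_def] down_dent_geo'[abs_def] by (auto split: if_splits)
    moreover have "b_dents n b = (\<Union>j\<in>{j\<in>{1..length b}. odd j}. geo ` dent (n - psum b j) (nth1 b j))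
        \<union> (\<Union>j\<in>{j\<in>{1..length b}. even j}. geo' ` dent (n - psum b j) (nth1 b j))"
      unfolding b_dents_def up_dent_geo[abs_def] down_dent_geo'[abs_def] by (auto split: if_splits)
    ultimately show ?thesis
      unfolding dents_def image_UN by (simp only: UN_Un UN_simps prod.case) blast
  qed
  then have W: "W x y z a b = geo ` ?A \<union> geo' ` ?B - (geo ` ?O \<union> geo' ` ?E)"
    unfolding W_def W_upper_geo W_lower_geo' n_def by blast
  have up: "upper_tri t" if "t \<in> ?A \<union> ?B \<union> ?O \<union> ?E" for t
  proof -
    have "upper_tri t" if "t \<in> dent p s" for p s using that by (cases t) auto
    moreover have "upper_tri t" if "t \<in> trapezoid n' K 0" for n' K using that by (cases t) auto
    ultimately show ?thesis using that by blast
  qed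
  have "geo ` ?A \<inter> geo' ` ?E = {}" "geo' ` ?B \<inter> geo ` ?O = {}"
  proof -
    show "geo ` ?A \<inter> geo' ` ?E = {}" using geo_neq_geo' up by blast
    have "geo' s \<noteq> geo t" if "s \<in> ?B" "t \<in> ?O" for s t using geo_neq_geo'[of t s] up that by (metis UnI1 UnI2)
    then show "geo' ` ?B \<inter> geo ` ?O = {}" by blast
  qed
  moreover have "P \<inter> S = {} \<Longrightarrow> Q \<inter> R = {} \<Longrightarrow> P \<union> Q - (R \<union> S) = (P - R) \<union> (Q - S)" for P Q R S :: region
    by blast
  ultimately have "W x y z a b = (geo ` ?A - geo ` ?O) \<union> (geo' ` ?B - geo' ` ?E)" unfolding W by metis
  also have "\<dots> = geo ` (?A - ?O) \<union> geo' ` (?B - ?E)"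
    by (simp only: image_set_diff[OF inj_geo] image_set_diff[OF inj_geo'])
  also have "?B - ?E = trapezoid (n + z) (2 * (y + z + esum a + esum b) - 1) 0 - half_dent 0
        - (\<Union>(p, s)\<in>insert (n, z) (dents even n a b). dent p s)"
  proof -
    have "half_dent 0 = {}" by (auto simp: half_dent_def)
    then show ?thesis by auto
  qed
  finally show ?thesis .
qed

lemma dent_base_dents:
  fixes a b :: "nat list"
  assumes "sum_list b \<le> n"
  shows "cells p a \<union> mirror n (cells p b) = (if p 1 then {..<nth1 a 1} else {}) \<union> dent_base (dents p n a b)"
proof -
  have a: "(\<Union>i\<in>{i\<in>{2..length a}. p i}. {psum a (i - 1)..<psum a (i - 1) + nth1 a i})
      = (\<Union>i\<in>{i\<in>{2..length a}. p i}. cell a i)"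
  proof (rule SUP_cong[OF refl])
    fix i assume "i \<in> {i\<in>{2..length a}. p i}"
    then show "{psum a (i - 1)..<psum a (i - 1) + nth1 a i} = cell a i"
      using psum_Suc[of a "i - 1"] by (simp add: cell_def)
  qed
  have b: "(\<Union>j\<in>{j\<in>{1..length b}. p j}. {n - psum b j..<n - psum b j + nth1 b j}) = mirror n (cells p b)"
  proof -
    have "mirror n (cells p b) = (\<Union>j\<in>{j\<in>{1..length b}. p j}. mirror n (cell b j))"
      unfolding cells_bounded mirror_def by blast
    also have "\<dots> = (\<Union>j\<in>{j\<in>{1..length b}. p j}. {n - psum b j..<n - psum b j + nth1 b j})"
    proof (rule SUP_cong[OF refl])
      fix j assume "j \<in> {j\<in>{1..length b}. p j}"
      then have "psum b j = psum b (j - 1) + nth1 b j" using psum_Suc[of b "j - 1"] by simp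
      then show "mirror n (cell b j) = {n - psum b j..<n - psum b j + nth1 b j}"
        using psum_le[of b j] assms by (subst mirror_cell) auto
    qed
    finally show ?thesis ..
  qed
  have c: "cells p a = (if p 1 then {..<nth1 a 1} else {}) \<union> (\<Union>i\<in>{i\<in>{2..length a}. p i}. cell a i)"
  proof -
    have one: "cell a 1 = {..<nth1 a 1}" by (auto simp: cell_def psum_Suc[of a 0, simplified])
    have "v \<in> cells p a \<longleftrightarrow> (p 1 \<and> v \<in> cell a 1) \<or> v \<in> (\<Union>i\<in>{i\<in>{2..length a}. p i}. cell a i)" for v
    proof
      assume "v \<in> cells p a"
      then obtain i where i: "1 \<le> i" "i \<le> length a" "p i" "v \<in> cell a i" by (auto simp: cells_bounded)
      then show "(p 1 \<and> v \<in> cell a 1) \<or> v \<in> (\<Union>i\<in>{i\<in>{2..length a}. p i}. cell a i)"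
        by (cases "i = 1") force+
    qed (auto simp: cells_def)
    then show ?thesis unfolding one by auto
  qed
  show ?thesis
    unfolding c dent_base_def dents_def
    using a b by (simp add: UN_Un Un_assoc)
qed

lemma dents_bounds:
  assumes "(q, s) \<in> dents p n a b" "sum_list a \<le> n" "sum_list b \<le> n"
  shows "q + s \<le> n \<and> s \<le> card (cells p a) + card (cells p b)"
proof -
  from assms(1) consider i where "2 \<le> i" "p i" "q = psum a (i - 1)" "s = nth1 a i"
    | j where "1 \<le> j" "p j" "q = n - psum b j" "s = nth1 b j"
    unfolding dents_def by auto
  then show ?thesis
  proof cases
    case 1
    then have "q + s = psum a i" using psum_Suc[of a "i - 1"] by simp
    then show ?thesis using psum_le[of a i] assms(2) nth1_le_card_cells[of p i a] 1 by simp
  next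
    case 2
    then have "psum b j = psum b (j - 1) + s" using psum_Suc[of b "j - 1"] by simp
    then show ?thesis using psum_le[of b j] assms(3) nth1_le_card_cells[of p j b] 2 by simp
  qed
qed

text \<open>For h = 0 the integer height is -1 and the natural one is 0, but the zigzag is empty in
  both cases.\<close>

lemma zig_edges_nat: "zig_edges 0 (2 * int h - 1) = zig_edges 0 (int (2 * h - 1))"
  "zig_edges (- (2 * int h - 1)) 0 = zig_edges (- int (2 * h - 1)) 0"
proof -
  have empty: "zig_edges k0 k1 = {}" if "k1 \<le> k0" for k0 k1 using that by (auto simp: zig_edges_def)
  have e: "2 * int h - 1 = int (2 * h - 1)" if "h \<noteq> 0" using that by linarith
  show "zig_edges 0 (2 * int h - 1) = zig_edges 0 (int (2 * h - 1))"
  proof (cases "h = 0")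
    case False
    show ?thesis unfolding e[OF False] ..
  qed (simp add: empty)
  show "zig_edges (- (2 * int h - 1)) 0 = zig_edges (- int (2 * h - 1)) 0"
  proof (cases "h = 0")
    case False
    show ?thesis unfolding e[OF False] ..
  qed (simp add: empty)
qed

lemma mem_base_dented:
  "U 0 i \<in> trapezoid n (2 * h - 1) 0 - half_dent a - (\<Union>(p, s)\<in>E. dent p s)
    \<longleftrightarrow> 0 < h \<and> i < n \<and> i \<notin> {..<a} \<union> dent_base E"
proof -
  have "U 0 i \<in> (case x of (p, s) \<Rightarrow> dent p s) \<longleftrightarrow> i \<in> (case x of (p, s) \<Rightarrow> {p..<p + s})" for x
    by (cases x) (simp add: in_dent_def Suc_le_eq)
  then have "U 0 i \<in> (\<Union>(p, s)\<in>E. dent p s) \<longleftrightarrow> i \<in> dent_base E"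
    by (simp add: dent_base_def)
  then show ?thesis by (simp add: less_width del: UN_iff) linarith
qed

section \<open>The product formulas\<close>

lemma card_mirror: "X \<subseteq> {..<n} \<Longrightarrow> card (mirror n X) = card X"
  unfolding mirror_def by (rule card_image) (rule inj_on_mirror)

lemma mirror_disjoint: "X \<union> Y \<subseteq> {..<n} \<Longrightarrow> X \<inter> Y = {} \<Longrightarrow> mirror n X \<inter> mirror n Y = {}"
  unfolding mirror_def using inj_on_image_Int[OF inj_on_mirror, of "X \<union> Y" n X Y] by simp

lemma mirror_subset: "X \<subseteq> {..<m} \<Longrightarrow> m \<le> n \<Longrightarrow> mirror n X \<subseteq> {n - m..<n}"
  using mirror_interval[of m n 0] unfolding mirror_def by (auto simp: lessThan_atLeast0)

text \<open>Odd and even blocks of one sequence fill an interval together. The artificial dent of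
  side z continues the mirrored blocks of b to the east, so b and z enter the occupied set only
  through b + z.\<close>

lemma base_cells:
  fixes x y z :: nat and a b :: "nat list"
  defines "n \<equiv> W_len x y a b" and "P \<equiv> cells even (t_plus x y a b)" and "Q \<equiv> cells even (t_minus x y z a b)"
  shows "card P = osum a + osum b" "card Q = esum a + esum b + z" "P \<inter> Q = {}"
    "P \<union> Q = {..<sum_list a} \<union> {sum_list a + x + y..<sum_list a + x + y + (sum_list b + z)}"
proof -
  have n: "sum_list b \<le> n" "n - sum_list b = sum_list a + x + y" "sum_list a \<le> n - sum_list b"
    by (simp_all add: n_def W_len_def)
  have P: "P = cells odd a \<union> mirror n (cells odd b)"
    unfolding P_def n_def by (rule cells_t_plus)
  have Q: "Q = cells even a \<union> mirror n (cells even b) \<union> {n..<n + z}"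
    unfolding Q_def n_def by (rule cells_t_minus)
  have bn: "cells p b \<subseteq> {..<n}" for p using cells_subset[of p b] n(1) by auto
  have m: "mirror n (cells p b) \<subseteq> {n - sum_list b..<n}" for p by (rule mirror_subset[OF cells_subset n(1)])
  have c: "cells p a \<subseteq> {..<sum_list a}" for p by (rule cells_subset)
  have am: "cells p a \<inter> mirror n (cells q b) = {}" for p q using m[of q] c[of p] n(3) by fastforce
  have fin: "finite (mirror n (cells p b))" for p by (simp add: mirror_def)
  show "card P = osum a + osum b"
    unfolding P using am fin by (simp add: card_Un_disjoint card_mirror[OF bn] card_cells_odd)
  have z: "(cells p a \<union> mirror n (cells q b)) \<inter> {n..<n + z} = {}" for p q using m[of q] c[of p] n(3) by fastforce
  show "card Q = esum a + esum b + z"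
    unfolding Q using am fin z by (simp add: card_Un_disjoint card_mirror[OF bn] card_cells_even)
  have oe: "cells odd a \<inter> cells even a = {}" "mirror n (cells odd b) \<inter> mirror n (cells even b) = {}"
    using bn by (auto intro!: cells_disjoint mirror_disjoint)
  show "P \<inter> Q = {}"
    using oe am[of odd even] am[of even odd] z[of odd odd] unfolding P Q by blast
  have "mirror n (cells odd b) \<union> mirror n (cells even b) = mirror n {0..<sum_list b}"
    using cells_odd_Un_even[of b] unfolding mirror_def by (metis image_Un lessThan_atLeast0)
  also have "\<dots> = {n - sum_list b..<n}" using mirror_interval[OF n(1), of 0] by simp
  finally have "P \<union> Q = {..<sum_list a} \<union> {n - sum_list b..<n} \<union> {n..<n + z}"
    using cells_odd_Un_even[of a] unfolding P Q by blast
  also have "\<dots> = {..<sum_list a} \<union> {sum_list a + x + y..<sum_list a + x + y + (sum_list b + z)}"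
    by (auto simp: n_def W_len_def)
  finally show "P \<union> Q = {..<sum_list a} \<union> {sum_list a + x + y..<sum_list a + x + y + (sum_list b + z)}" .
qed

text \<open>Inside the gap s exceeds all p < a and is smaller than all p >= m, which determines the
  sign of every factor.\<close>

lemma prod_selberg_weight:
  assumes "S \<subseteq> {a..<m}"
  shows "prod (selberg_weight a c m) S = (\<Prod>s\<in>S. half0 s) * (\<Prod>s\<in>S. \<Prod>p\<in>{..<a} \<union> {m..<m + c}. \<bar>(real s)\<^sup>2 - (real p)\<^sup>2\<bar>)"
  unfolding prod.distrib[symmetric]
proof (rule prod.cong[OF refl])
  fix s assume "s \<in> S"
  then have s: "a \<le> s" "s < m" using assms by auto
  have "(\<Prod>p\<in>{..<a} \<union> {m..<m + c}. \<bar>(real s)\<^sup>2 - (real p)\<^sup>2\<bar>)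
      = (\<Prod>p<a. \<bar>(real s)\<^sup>2 - (real p)\<^sup>2\<bar>) * (\<Prod>p=m..<m + c. \<bar>(real s)\<^sup>2 - (real p)\<^sup>2\<bar>)"
    using s by (intro prod.union_disjoint) auto
  also have "(\<Prod>p<a. \<bar>(real s)\<^sup>2 - (real p)\<^sup>2\<bar>) = (\<Prod>p<a. (real s)\<^sup>2 - (real p)\<^sup>2)"
  proof (rule prod.cong[OF refl])
    fix p assume "p \<in> {..<a}"
    then have "(real p)\<^sup>2 \<le> (real s)\<^sup>2" using s by (intro power_mono) auto
    then show "\<bar>(real s)\<^sup>2 - (real p)\<^sup>2\<bar> = (real s)\<^sup>2 - (real p)\<^sup>2" by simp
  qed
  also have "(\<Prod>p=m..<m + c. \<bar>(real s)\<^sup>2 - (real p)\<^sup>2\<bar>) = (\<Prod>p=m..<m + c. (real p)\<^sup>2 - (real s)\<^sup>2)"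
  proof (rule prod.cong[OF refl])
    fix p assume "p \<in> {m..<m + c}"
    then have "(real s)\<^sup>2 \<le> (real p)\<^sup>2" using s by (intro power_mono) auto
    then show "\<bar>(real s)\<^sup>2 - (real p)\<^sup>2\<bar> = (real p)\<^sup>2 - (real s)\<^sup>2" by simp
  qed
  finally show "selberg_weight a c m s = half0 s * (\<Prod>p\<in>{..<a} \<union> {m..<m + c}. \<bar>(real s)\<^sup>2 - (real p)\<^sup>2\<bar>)"
    by (simp add: selberg_weight_def)
qed

text \<open>If one part is empty (h = 0 or h' = 0), nothing can cross the base; the conditions on h
  and h' then leave only the empty S. The cardinality tests say when a part with S removed has a
  tiling at all.\<close>

lemma MW_sum:
  fixes x y z :: nat and a b :: "nat list"
  defines "n \<equiv> W_len x y a b" and "P \<equiv> cells even (t_plus x y a b)" and "Q \<equiv> cells even (t_minus x y z a b)"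
    and "h \<equiv> y + osum a + osum b" and "h' \<equiv> y + z + esum a + esum b"
  shows "MW x y z a b = (\<Sum>S\<in>Pow {i. 0 < h \<and> 0 < h' \<and> i < n \<and> i \<notin> P \<union> Q}. (\<Prod>i\<in>S. half0 i) *
    (2 ^ (nth1 a 1 - 1) * (if card (P \<union> S) = h then delta (P \<union> S) / H2 (2 * h) else 0) *
      (if card (Q \<union> S) = h' then delta (Q \<union> S) / H2 (2 * h') else 0)))"
proof -
  let ?Z = "zig_edges 0 (int (2 * h - 1)) \<union> zig_edges (- int (2 * h' - 1)) 0"
  let ?w = "zig_weight ?Z" and ?d = "\<lambda>(p, s). dent p s"
  define Eo where "Eo = dents odd n a b"
  define Ee where "Ee = insert (n, z) (dents even n a b)"
  define A where "A = trapezoid n (2 * h - 1) 0 - half_dent (nth1 a 1) - (\<Union>e\<in>Eo. ?d e)"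
  define B where "B = trapezoid (n + z) (2 * h' - 1) 0 - half_dent 0 - (\<Union>e\<in>Ee. ?d e)"
  let ?G = "{i. 0 < h \<and> 0 < h' \<and> i < n \<and> i \<notin> P \<union> Q}"
  have n: "sum_list a \<le> n" "sum_list b \<le> n" by (simp_all add: n_def W_len_def)
  have P: "P = {..<nth1 a 1} \<union> dent_base Eo"
    using dent_base_dents[OF n(2), of odd a] unfolding P_def Eo_def cells_t_plus n_def[symmetric] by fastforce
  have "dent_base Ee = dent_base (dents even n a b) \<union> {n..<n + z}"
    unfolding Ee_def dent_base_def by auto
  then have Q: "Q = {..<0} \<union> dent_base Ee"
    using dent_base_dents[OF n(2), of even a] unfolding Q_def cells_t_minus n_def[symmetric] by simp
  have up: "upper_tri t" if "t \<in> A \<union> B" for t using that unfolding A_def B_def by (cases t) auto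
  have fin: "finite A" "finite B" unfolding A_def B_def by (simp_all add: finite_trapezoid)
  have G: "{i. U 0 i \<in> A \<and> U 0 i \<in> B} = ?G"
    unfolding A_def B_def mem_base_dented P[symmetric] Q[symmetric] by auto
  have "MW x y z a b = tiling_sum is_lozenge ?w (geo ` A \<union> geo' ` B)"
    unfolding MW_def M_eq_tiling_sum W_zigzag_def W_top_def W_bot_def W_geo zig_edges_nat A_def B_def Eo_def Ee_def n_def h_def h'_def ..
  also have "\<dots> = (\<Sum>S\<in>Pow ?G. (\<Prod>i\<in>S. ?w (crossing i))
        * (tiling_sum is_lozenge ?w (geo ` (A - U 0 ` S)) * tiling_sum is_lozenge ?w (geo' ` (B - U 0 ` S))))"
    using tiling_sum_geo_Un[OF fin up, of ?w] unfolding G .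
  also have "\<dots> = (\<Sum>S\<in>Pow ?G. (\<Prod>i\<in>S. half0 i) *
    (2 ^ (nth1 a 1 - 1) * (if card (P \<union> S) = h then delta (P \<union> S) / H2 (2 * h) else 0) *
      (if card (Q \<union> S) = h' then delta (Q \<union> S) / H2 (2 * h') else 0)))"
  proof (rule sum.cong[OF refl])
    fix S assume "S \<in> Pow ?G"
    then have S: "S \<subseteq> ?G" by simp
    have "(\<Prod>i\<in>S. ?w (crossing i)) = (\<Prod>i\<in>S. half0 i)"
    proof (rule prod.cong[OF refl])
      fix i assume "i \<in> S"
      then have "0 < h" "0 < h'" using S by auto
      then show "?w (crossing i) = half0 i" by (intro zig_weight_crossing) auto
    qed
    moreover have "tiling_sum is_lozenge ?w (geo ` (A - U 0 ` S))
      = 2 ^ (nth1 a 1 - 1) * (if card (P \<union> S) = h then delta (P \<union> S) / H2 (2 * h) else 0)"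
    proof -
      have "tiling_sum is_lozenge ?w (geo ` (A - U 0 ` S)) = tiling_sum loz wt (A - U 0 ` S)"
        by (rule tiling_sum_geo[of _ n "2 * h - 1" _ "- int (2 * h' - 1)"]) (auto simp: A_def)
      also have "\<dots> = 2 ^ (nth1 a 1 - 1) * (if card (P \<union> S) = h then delta (P \<union> S) / H2 (2 * h) else 0)"
        unfolding A_def
      proof (rule tiling_sum_dented)
        show "h \<le> n" using osum_plus_esum[of a] osum_plus_esum[of b] by (simp add: h_def n_def W_len_def)
        show "nth1 a 1 \<le> h" using nth1_le_card_cells[of odd 1 a] by (simp add: h_def card_cells_odd)
        show "p + s \<le> n \<and> s \<le> h" if "(p, s) \<in> Eo" for p s
          using dents_bounds[OF that[unfolded Eo_def] n] by (simp add: h_def card_cells_odd)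
        show "S \<subseteq> {..<n}" "h = 0 \<Longrightarrow> S = {}" using S by auto
      qed (simp add: P)
      finally show ?thesis .
    qed
    moreover have "tiling_sum is_lozenge ?w (geo' ` (B - U 0 ` S))
      = (if card (Q \<union> S) = h' then delta (Q \<union> S) / H2 (2 * h') else 0)"
    proof -
      have "tiling_sum is_lozenge ?w (geo' ` (B - U 0 ` S)) = tiling_sum loz wt (B - U 0 ` S)"
        by (rule tiling_sum_geo'[of _ "n + z" "2 * h' - 1" _ "int (2 * h - 1)"]) (auto simp: B_def)
      also have "\<dots> = 2 ^ (0 - 1) * (if card (Q \<union> S) = h' then delta (Q \<union> S) / H2 (2 * h') else 0)"
        unfolding B_def
      proof (rule tiling_sum_dented)
        show "h' \<le> n + z" using osum_plus_esum[of a] osum_plus_esum[of b] by (simp add: h'_def n_def W_len_def)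
        show "p + s \<le> n + z \<and> s \<le> h'" if "(p, s) \<in> Ee" for p s
          using that dents_bounds[of p s even n a b, OF _ n] unfolding Ee_def by (auto simp: h'_def card_cells_even)
        show "S \<subseteq> {..<n + z}" "h' = 0 \<Longrightarrow> S = {}" using S by auto
      qed (simp_all add: Q)
      finally show ?thesis by simp
    qed
    ultimately show "(\<Prod>i\<in>S. ?w (crossing i)) * (tiling_sum is_lozenge ?w (geo ` (A - U 0 ` S)) * tiling_sum is_lozenge ?w (geo' ` (B - U 0 ` S)))
      = (\<Prod>i\<in>S. half0 i) * (2 ^ (nth1 a 1 - 1) * (if card (P \<union> S) = h then delta (P \<union> S) / H2 (2 * h) else 0) *
        (if card (Q \<union> S) = h' then delta (Q \<union> S) / H2 (2 * h') else 0))"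
      by simp
  qed
  finally show ?thesis .
qed

text \<open>Both cardinality tests amount to card S = y. The factors of P \<union> S and Q \<union>
  S split by \<open>delta_Un\<close>, and the mixed factors together run once over P \<union> Q,
  which turns them into \<open>selberg_weight\<close>.\<close>

lemma MW_selberg:
  fixes x y z :: nat and a b :: "nat list"
  defines "P \<equiv> cells even (t_plus x y a b)" and "Q \<equiv> cells even (t_minus x y z a b)"
    and "h \<equiv> y + osum a + osum b" and "h' \<equiv> y + z + esum a + esum b"
    and "m \<equiv> sum_list a + x + y"
  shows "MW x y z a b = 2 ^ (nth1 a 1 - 1) * (delta P / H2 (2 * h)) * (delta Q / H2 (2 * h')) *
    (\<Sum>S | S \<subseteq> {sum_list a..<m} \<and> card S = y. prod (selberg_weight (sum_list a) (sum_list b + z) m) S * (delta S)\<^sup>2)"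
proof -
  let ?A = "sum_list a" and ?c = "sum_list b + z"
  let ?G = "{i. 0 < h \<and> 0 < h' \<and> i < W_len x y a b \<and> i \<notin> P \<union> Q}"
  let ?f = "\<lambda>S. (\<Prod>i\<in>S. half0 i) *
    (2 ^ (nth1 a 1 - 1) * (if card (P \<union> S) = h then delta (P \<union> S) / H2 (2 * h) else 0) *
      (if card (Q \<union> S) = h' then delta (Q \<union> S) / H2 (2 * h') else 0))"
  note base = base_cells(1)[of x y a b, folded P_def]
    base_cells(2-4)[where x = x and y = y and z = z and a = a and b = b, folded P_def Q_def m_def]
  have fin: "finite P" "finite Q" by (simp_all add: P_def Q_def)
  have G: "?G = (if 0 < h \<and> 0 < h' then {?A..<m} else {})"
    unfolding base(4) by (auto simp: W_len_def m_def)
  have Gm: "S \<subseteq> {?A..<m}" if "S \<subseteq> ?G" for S using that unfolding G by (auto split: if_splits)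
  have finS: "finite S" if "S \<subseteq> {?A..<m}" for S using that finite_subset by auto
  have dis: "P \<inter> S = {}" "Q \<inter> S = {}" if "S \<subseteq> {?A..<m}" for S
  proof -
    have "(P \<union> Q) \<inter> S = {}"
    proof (rule equals0I)
      fix v assume v: "v \<in> (P \<union> Q) \<inter> S"
      then have "v \<in> {..<?A} \<union> {m..<m + ?c}" using base(4) by simp
      moreover have "v \<in> {?A..<m}" using v that by auto
      ultimately show False by simp
    qed
    then show "P \<inter> S = {}" "Q \<inter> S = {}" by blast+
  qed
  have "MW x y z a b = (\<Sum>S\<in>Pow ?G. ?f S)"
    unfolding P_def Q_def h_def h'_def by (rule MW_sum)
  also have "\<dots> = (\<Sum>S | S \<subseteq> ?G \<and> card S = y. ?f S)"
  proof (rule sum.mono_neutral_right)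
    show "\<forall>S\<in>Pow ?G - {S. S \<subseteq> ?G \<and> card S = y}. ?f S = 0"
    proof
      fix S assume S: "S \<in> Pow ?G - {S. S \<subseteq> ?G \<and> card S = y}"
      then have "S \<subseteq> {?A..<m}" using Gm by blast
      then have "card (P \<union> S) = card P + card S" using dis(1) fin finS by (intro card_Un_disjoint) auto
      then have "card (P \<union> S) \<noteq> h" using S base(1) by (auto simp: h_def)
      then show "?f S = 0" by simp
    qed
  qed auto
  also have "{S. S \<subseteq> ?G \<and> card S = y} = {S. S \<subseteq> {?A..<m} \<and> card S = y}"
  \<comment> \<open>The conditions 0 < h and 0 < h' hold if y > 0; if y = 0, only the empty S is
    left on either side.\<close>
  proof (cases "y = 0")
    case True
    have "S = {}" if "S \<subseteq> {?A..<m}" "card S = 0" for S using that finS by simp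
    then show ?thesis using True Gm by auto
  next
    case False
    then show ?thesis unfolding G by (simp add: h_def h'_def)
  qed
  also have "(\<Sum>S | S \<subseteq> {?A..<m} \<and> card S = y. ?f S)
      = (\<Sum>S | S \<subseteq> {?A..<m} \<and> card S = y. 2 ^ (nth1 a 1 - 1) * (delta P / H2 (2 * h)) * (delta Q / H2 (2 * h')) *
          (prod (selberg_weight ?A ?c m) S * (delta S)\<^sup>2))"
  proof (rule sum.cong[OF refl])
    fix S assume "S \<in> {S. S \<subseteq> {?A..<m} \<and> card S = y}"
    then have S: "S \<subseteq> {?A..<m}" "card S = y" "finite S" using finS by auto
    have "card (P \<union> S) = h" "card (Q \<union> S) = h'"
      using dis[OF S(1)] fin S(2,3) base(1,2) by (simp_all add: card_Un_disjoint h_def h'_def)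
    moreover have "delta (P \<union> S) = delta P * delta S * (\<Prod>s\<in>S. \<Prod>p\<in>P. \<bar>(real s)\<^sup>2 - (real p)\<^sup>2\<bar>)"
      "delta (Q \<union> S) = delta Q * delta S * (\<Prod>s\<in>S. \<Prod>p\<in>Q. \<bar>(real s)\<^sup>2 - (real p)\<^sup>2\<bar>)"
      using dis[OF S(1)] fin S(3) by (simp_all add: delta_Un)
    moreover have "prod (selberg_weight ?A ?c m) S = (\<Prod>s\<in>S. half0 s) *
        ((\<Prod>s\<in>S. \<Prod>p\<in>P. \<bar>(real s)\<^sup>2 - (real p)\<^sup>2\<bar>) * (\<Prod>s\<in>S. \<Prod>p\<in>Q. \<bar>(real s)\<^sup>2 - (real p)\<^sup>2\<bar>))"
    proof -
      have "(\<Prod>p\<in>{..<?A} \<union> {m..<m + ?c}. \<bar>(real s)\<^sup>2 - (real p)\<^sup>2\<bar>)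
          = (\<Prod>p\<in>P. \<bar>(real s)\<^sup>2 - (real p)\<^sup>2\<bar>) * (\<Prod>p\<in>Q. \<bar>(real s)\<^sup>2 - (real p)\<^sup>2\<bar>)" for s
        unfolding base(4)[symmetric] using fin base(3) by (rule prod.union_disjoint)
      then show ?thesis unfolding prod_selberg_weight[OF S(1)] by (simp add: prod.distrib)
    qed
    ultimately show "?f S = 2 ^ (nth1 a 1 - 1) * (delta P / H2 (2 * h)) * (delta Q / H2 (2 * h')) *
          (prod (selberg_weight ?A ?c m) S * (delta S)\<^sup>2)"
      by (simp add: power2_eq_square mult_ac)
  qed
  finally show ?thesis by (simp add: sum_distrib_left)
qed

lemma MW_formula:
  "MW x y z a b
           = (if nth1 a 1 = 0 then 2 else 1)
             * (2 powi (- int y + int (nth1 a 1) - 1)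
                * K' (t_plus x y a b) * K' (t_minus x y z a b)
                * (H2 (2 * osum a + 2 * osum b) * H2 (2 * esum a + 2 * esum b + 2 * z)
                   / (H2 (2 * osum a + 2 * osum b + 2 * y)
                      * H2 (2 * esum a + 2 * esum b + 2 * y + 2 * z)))
                * (H (2 * int (sum_list a) + int (sum_list b) + 2 * int y + int z - 1)
                     * H (int (sum_list b) + int y + int z)
                   / (H (2 * int (sum_list a) + int (sum_list b) + int y + int z - 1)
                      * H (int (sum_list b) + int z)))
                * TV_quot x y z (sum_list a) (sum_list b))"
proof -
  let ?P = "cells even (t_plus x y a b)" and ?Q = "cells even (t_minus x y z a b)"
  let ?a1 = "nth1 a 1"
  have e: "esum (t_plus x y a b) = osum a + osum b" "esum (t_minus x y z a b) = esum a + esum b + z"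
    using base_cells(1)[of x y a b] base_cells(2)[of x y z a b] by (simp_all add: card_cells_even)
  have P: "delta ?P = K' (t_plus x y a b) * H2 (2 * osum a + 2 * osum b)"
    using H2_pos[of "2 * osum a + 2 * osum b"] by (simp add: K'_eq e)
  have Q: "delta ?Q = K' (t_minus x y z a b) * H2 (2 * esum a + 2 * esum b + 2 * z)"
    using H2_pos[of "2 * esum a + 2 * esum b + 2 * z"] by (simp add: K'_eq e)
  \<comment> \<open>The truncated exponent \<open>?a1 - 1\<close> agrees with the integer one except
    at \<open>?a1 = 0\<close>, where it is larger by 1; this is the factor 2.\<close>
  have pow: "2 ^ (?a1 - 1) * (1/2) ^ y = (if ?a1 = 0 then 2 else 1) * (2::real) powi (- int y + int ?a1 - 1)"
    by (cases ?a1) (simp_all add: power_int_add power_int_minus power_int_diff power_one_over field_simps)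
  have h: "2 * (y + osum a + osum b) = 2 * osum a + 2 * osum b + 2 * y"
    "2 * (y + z + esum a + esum b) = 2 * esum a + 2 * esum b + 2 * y + 2 * z" by simp_all
  have "MW x y z a b = (2 ^ (?a1 - 1) * (1/2) ^ y) * (delta ?P / H2 (2 * osum a + 2 * osum b + 2 * y))
      * (delta ?Q / H2 (2 * esum a + 2 * esum b + 2 * y + 2 * z))
      * (H (2 * int (sum_list a) + int (sum_list b) + 2 * int y + int z - 1)
                     * H (int (sum_list b) + int y + int z)
                   / (H (2 * int (sum_list a) + int (sum_list b) + int y + int z - 1)
                      * H (int (sum_list b) + int z)))
      * TV_quot x y z (sum_list a) (sum_list b)"
    unfolding MW_selberg selberg_sum_TV h by (simp only: mult_ac)
  then show ?thesis unfolding pow P Q by (simp only: mult_ac times_divide_eq_left times_divide_eq_right divide_divide_eq_left)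
qed

lemma T_pos: "x > 0 \<Longrightarrow> T x n m > 0"
  unfolding T_def by (intro prod_pos ballI pochhammer_pos) simp

lemma V_pos: "x > 0 \<Longrightarrow> V x n m > 0"
  unfolding V_def by (intro prod_pos ballI bracket_pos) simp

lemma TV_quot_trivial: "TV_quot 0 y z a b = 1" "TV_quot x 0 z a b = 1"
  using T_pos[of 1] V_pos[of "2 * real a + 1"]
  by (auto simp: TV_quot_def T_def V_def less_imp_neq[symmetric])

lemma K'_pos: "K' t > 0"
  unfolding K'_eq using delta_pos[OF finite_cells] H2_pos by simp

theorem theorem2p7:
  fixes x y z :: nat and a b :: "nat list"
  shows "MW x y z a b
           = MW (x + y) 0 z a b * MW 0 y z a b / MW y 0 z a b
             * TV_quot x y z (sum_list a) (sum_list b)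
       \<and> MW x y z a b
           = (if nth1 a 1 = 0 then 2 else 1)
             * (2 powi (- int y + int (nth1 a 1) - 1)
                * K' (t_plus x y a b) * K' (t_minus x y z a b)
                * (H2 (2 * osum a + 2 * osum b) * H2 (2 * esum a + 2 * esum b + 2 * z)
                   / (H2 (2 * osum a + 2 * osum b + 2 * y)
                      * H2 (2 * esum a + 2 * esum b + 2 * y + 2 * z)))
                * (H (2 * int (sum_list a) + int (sum_list b) + 2 * int y + int z - 1)
                     * H (int (sum_list b) + int y + int z)
                   / (H (2 * int (sum_list a) + int (sum_list b) + int y + int z - 1)
                      * H (int (sum_list b) + int z)))
                * TV_quot x y z (sum_list a) (sum_list b))"
proof
  \<comment> \<open>The pair (x + y, 0) gives the same two sequences as (x, y), so the values of
    \<open>K'\<close> in numerator and denominator cancel.\<close>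
  have shift: "t_plus (x + y) 0 a b = t_plus x y a b" "t_minus (x + y) 0 z a b = t_minus x y z a b" for x y
    by (simp_all add: t_plus_def t_minus_def add.assoc)
  let ?c = "(if nth1 a 1 = 0 then 2 else 1) :: real"
  let ?p = "\<lambda>y. (2 :: real) powi (- int y + int (nth1 a 1) - 1)"
  \<comment> \<open>For y = 0 the quotients of \<open>H2\<close>, of \<open>H\<close> and of
    \<open>T\<close> and \<open>V\<close> all equal 1, and only the power of 2 and the
    \<open>K'\<close> factors remain.\<close>
  have M0: "MW (x + y) 0 z a b = ?c * (?p 0 * K' (t_plus x y a b) * K' (t_minus x y z a b))" for x y
    unfolding MW_formula[of "x + y" 0] shift TV_quot_trivial using H2_pos H_pos
    by (simp add: less_imp_neq[symmetric])
  have pos: "?p 0 \<noteq> 0" "K' (t_plus 0 y a b) \<noteq> 0" "K' (t_minus 0 y z a b) \<noteq> 0"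
    using K'_pos by (simp_all add: less_imp_neq[symmetric])
  \<comment> \<open>\<open>MW 0 y\<close> contributes all factors depending on y alone, and its
    \<open>K'\<close> factors are removed by \<open>MW y 0\<close>; \<open>MW (x + y) 0\<close>
    restores those for x + y.\<close>
  show "MW x y z a b = MW (x + y) 0 z a b * MW 0 y z a b / MW y 0 z a b * TV_quot x y z (sum_list a) (sum_list b)"
    unfolding M0[of x y] M0[of 0 y, simplified] MW_formula[of 0 y] MW_formula[of x y] TV_quot_trivial
    using pos by (simp add: field_simps)
qed (rule MW_formula)

end
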